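(* Assume $(\varphi_0,u_0,\mu_0)\in H_0^1\times H_0^1\times H$, $\eta_1\in H_0^1$, $\eta_2\in H$. Let $(\mathbf P_M,\mathbf Q_M,\mathbf U_M,\mathbf V_M)$ be the solution on $[0,T]$ of the central-difference semi-discretization $$\begin{cases}d\mathbf Q_M=(\mathbf A\mathbf P_M+\mathbf U_M\cdot\mathbf P_M)\,dt-C_1\boldsymbol\eta_1\,dB_0(t),\\ d\mathbf P_M=-(\mathbf A\mathbf Q_M+\mathbf U_M\cdot\mathbf Q_M)\,dt+C_1\boldsymbol\eta_1\,dB_1(t),\\ d\mathbf V_M=\tfrac12(\mathbf A\mathbf U_M-\mathbf U_M+\mathbf P_M\cdot\mathbf P_M+\mathbf Q_M\cdot\mathbf Q_M)\,dt+\tfrac12C_2\boldsymbol\eta_2\,dB_2(t),\\ d\mathbf U_M=2\mathbf V_M\,dt,\end{cases}$$ and let $$\mathcal H(\mathbf P,\mathbf Q,\mathbf U,\mathbf V)=2\langle\mathbf U,\mathbf P\cdot\mathbf P+\mathbf Q\cdot\mathbf Q\rangle_h-\|\mathbf U\|_h^2-4\|\mathbf V\|_h^2+\langle\mathbf U,\mathbf A\mathbf U\rangle_h+2\langle\mathbf P,\mathbf A\mathbf P\rangle_h+2\langle\mathbf Q,\mathbf A\mathbf Q\rangle_h.$$ Then $$\mathbb{E}[\mathcal H(\mathbf P_M(t),\mathbf Q_M(t),\mathbf U_M(t),\mathbf V_M(t))]=\mathbb{E}[\mathcal H(\mathbf P_M(0),\mathbf Q_M(0),\mathbf U_M(0),\mathbf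 V_M(0))]-C_2^2\mathcal Q_2t+4C_1^2\widetilde{\mathcal Q}_1t+4C_1^2\,\mathbb{E}\Big[\int_0^t\langle\mathbf U_M(s),\boldsymbol\eta_1\cdot\boldsymbol\eta_1\rangle_h\,ds\Big],$$ where $\mathcal Q_2=\|\boldsymbol\eta_2\|_h^2$ and $\widetilde{\mathcal Q}_1=\langle\boldsymbol\eta_1,\mathbf A\boldsymbol\eta_1\rangle_h$.
   Context: $H=L^2([a,b])$ and $H_0^1$ is the space of $H^1([a,b])$ functions vanishing at $a,b$. $C_1,C_2\in\mathbb{R}$, $T>0$; $B_0,B_1,B_2$ are independent standard real Wiener processes; $\eta_1,\eta_2$ are sufficiently smooth real-valued functions on $[a,b]$. $M$ is a positive integer, $h=(b-a)/M$, $x_i=a+ih$, and $\boldsymbol\eta_k=(\eta_k(x_1),\dots,\eta_k(x_{M-1}))^\top$ for $k=1,2$. $\mathbf A$ is the $(M-1)\times(M-1)$ tridiagonal matrix $h^{-2}\,\mathrm{tridiag}(1,-2,1)$. For vectors in $\mathbb{R}^{M-1}$, $\cdot$ denotes the componentwise product, $\langle f,g\rangle_h=h\sum_{i=1}^{M-1}\operatorname{Re}(f_i\bar g_i)$ and $\|f\|_h=\sqrt{\langle f,f\rangle_h}$. The unknowns are $\mathbb{R}^{M-1}$-valued processes; $\mathbf P_M(0),\mathbf Q_M(0),\mathbf U_M(0),\mathbf V_M(0)\in\mathbb{R}^{M-1}$ are the approximations at the grid points $x_1,\dots,x_{M-1}$ of $\operatorname{Re}\varphi_0,\operatorname{Im}\varphi_0,u_0,\tfrac12\mu_0$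 respectively. The system approximates the stochastic Klein--Gordon--Schrödinger equation with initial data $\varphi_0$ (complex-valued), $u_0$, $\mu_0$ (real-valued, $u(0)=u_0$, $u_t(0)=\mu_0$) and homogeneous Dirichlet boundary conditions. *)

theory Defs
  imports "HOL-Probability.Probability"
begin

section \<open>Function spaces on an interval\<close>

definition in_L2 :: "real \<Rightarrow> real \<Rightarrow> (real \<Rightarrow> 'b::{banach, second_countable_topology}) \<Rightarrow> bool" where
  "in_L2 a b f \<longleftrightarrow> set_borel_measurable lebesgue {a..b} f \<and>
     set_integrable lebesgue {a..b} (\<lambda>x. (norm (f x))\<^sup>2)"

text \<open>
  In one space dimension an element of $H^1$ has a unique continuous representative, namely the
  indefinite integral of its weak derivative \<open>g\<close>. The predicate singles out this representative,
  so that boundary values and grid values make sense.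
\<close>

definition in_H1 :: "real \<Rightarrow> real \<Rightarrow> (real \<Rightarrow> 'b::{banach, second_countable_topology}) \<Rightarrow> bool" where
  "in_H1 a b f \<longleftrightarrow>
     (\<exists>g. in_L2 a b g \<and> (\<forall>x\<in>{a..b}. f x = f a + (LINT y:{a..x}|lebesgue. g y)))"

definition in_H10 :: "real \<Rightarrow> real \<Rightarrow> (real \<Rightarrow> 'b::{banach, second_countable_topology}) \<Rightarrow> bool" where
  "in_H10 a b f \<longleftrightarrow> in_H1 a b f \<and> f a = 0 \<and> f b = 0"

section \<open>Wiener processes\<close>

text \<open>
  A standard Wiener process on \<open>[0, \<infinity>)\<close> relative to a filtration \<open>F\<close>. The filtration is indexed by
  all reals, but only its members with nonnegative index matter.
\<close>

definition wiener_process ::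
    "'w measure \<Rightarrow> (real \<Rightarrow> 'w measure) \<Rightarrow> (real \<Rightarrow> 'w \<Rightarrow> real) \<Rightarrow> bool" where
  "wiener_process \<Omega> F B \<longleftrightarrow>
     (\<forall>t\<ge>0. B t \<in> borel_measurable (F t)) \<and>
     (AE \<omega> in \<Omega>. B 0 \<omega> = 0) \<and>
     (AE \<omega> in \<Omega>. continuous_on {0..} (\<lambda>t. B t \<omega>)) \<and>
     (\<forall>s\<ge>0. \<forall>t>s.
        distributed \<Omega> lborel (\<lambda>\<omega>. B t \<omega> - B s \<omega>) (normal_density 0 (sqrt (t - s))) \<and>
        prob_space.indep_set \<Omega> (sets (F s))
          {(\<lambda>\<omega>. B t \<omega> - B s \<omega>) -` A \<inter> space \<Omega> | A. A \<in> sets borel})"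

text \<open>
  Independence of \<open>B 0\<close>, \<open>B 1\<close>, \<open>B 2\<close> means independence of the three processes as random
  elements of the path space \<open>\<real>\<^bsup>[0,\<infinity>)\<^esup>\<close> with the product sigma-algebra.
\<close>

definition indep_wiener3 ::
    "'w measure \<Rightarrow> (real \<Rightarrow> 'w measure) \<Rightarrow> (nat \<Rightarrow> real \<Rightarrow> 'w \<Rightarrow> real) \<Rightarrow> bool" where
  "indep_wiener3 \<Omega> F B \<longleftrightarrow>
     (\<forall>k\<in>{0, 1, 2}. wiener_process \<Omega> F (B k)) \<and>
     prob_space.indep_vars \<Omega> (\<lambda>_. PiM {0..} (\<lambda>_. borel)) (\<lambda>k \<omega>. \<lambda>t\<in>{0..}. B k t \<omega>) {0, 1, 2}"

section \<open>Grid functions\<close>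

text \<open>
  A vector in \<open>\<real>\<^bsup>M-1\<^esup>\<close> is a function \<open>nat \<Rightarrow> real\<close> of which only the components with index in
  \<open>{1..<M}\<close> are used.
\<close>

definition mesh :: "real \<Rightarrow> real \<Rightarrow> nat \<Rightarrow> real" where
  "mesh a b M = (b - a) / real M"

definition grid_vec :: "real \<Rightarrow> real \<Rightarrow> nat \<Rightarrow> (real \<Rightarrow> real) \<Rightarrow> nat \<Rightarrow> real" where
  "grid_vec a b M f = (\<lambda>i. f (a + real i * mesh a b M))"

definition tridiag :: "real \<Rightarrow> real \<Rightarrow> real \<Rightarrow> nat \<Rightarrow> nat \<Rightarrow> real" where
  "tridiag l d u i j = (if i = Suc j then l else if i = j then d else if j = Suc i then u else 0)"

definition lap_mat :: "real \<Rightarrow> real \<Rightarrow> nat \<Rightarrow> nat \<Rightarrow> nat \<Rightarrow> real" where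
  "lap_mat a b M i j = (1 / (mesh a b M)\<^sup>2) * tridiag 1 (- 2) 1 i j"

definition lap :: "real \<Rightarrow> real \<Rightarrow> nat \<Rightarrow> (nat \<Rightarrow> real) \<Rightarrow> nat \<Rightarrow> real" where
  "lap a b M f = (\<lambda>i. \<Sum>j\<in>{1..<M}. lap_mat a b M i j * f j)"

definition cmul :: "(nat \<Rightarrow> real) \<Rightarrow> (nat \<Rightarrow> real) \<Rightarrow> nat \<Rightarrow> real"  (infixl "\<odot>" 70) where
  "f \<odot> g = (\<lambda>i. f i * g i)"

text \<open>All vectors are real, so real part and conjugation do not appear.\<close>

definition inner_h :: "real \<Rightarrow> real \<Rightarrow> nat \<Rightarrow> (nat \<Rightarrow> real) \<Rightarrow> (nat \<Rightarrow> real) \<Rightarrow> real" where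
  "inner_h a b M f g = mesh a b M * (\<Sum>i\<in>{1..<M}. f i * g i)"

definition norm_h :: "real \<Rightarrow> real \<Rightarrow> nat \<Rightarrow> (nat \<Rightarrow> real) \<Rightarrow> real" where
  "norm_h a b M f = sqrt (inner_h a b M f f)"

definition energy ::
    "real \<Rightarrow> real \<Rightarrow> nat \<Rightarrow> (nat \<Rightarrow> real) \<Rightarrow> (nat \<Rightarrow> real) \<Rightarrow> (nat \<Rightarrow> real) \<Rightarrow> (nat \<Rightarrow> real) \<Rightarrow> real" where
  "energy a b M P Q U V =
     2 * inner_h a b M U (\<lambda>i. (P \<odot> P) i + (Q \<odot> Q) i)
     - (norm_h a b M U)\<^sup>2 - 4 * (norm_h a b M V)\<^sup>2
     + inner_h a b M U (lap a b M U)
     + 2 * inner_h a b M P (lap a b M P) + 2 * inner_h a b M Q (lap a b M Q)"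

section \<open>The semi-discrete system\<close>

text \<open>
  A vector-valued process \<open>X\<close> on \<open>[0, T]\<close>: \<open>X t \<omega> i\<close> is the \<open>i\<close>-th component. All paths, not just
  almost all of them, are continuous: the underlying probability space need not be complete,
  and on an exceptional null set with irregular paths a time integral of \<open>X\<close> could fail to be
  measurable in \<open>\<omega>\<close>.
\<close>

definition cont_adapted ::
    "'w measure \<Rightarrow> (real \<Rightarrow> 'w measure) \<Rightarrow> real \<Rightarrow> nat \<Rightarrow> (real \<Rightarrow> 'w \<Rightarrow> nat \<Rightarrow> real) \<Rightarrow> bool" where
  "cont_adapted \<Omega> F T M X \<longleftrightarrow> (\<forall>i\<in>{1..<M}.
     (\<forall>t\<in>{0..T}. (\<lambda>\<omega>. X t \<omega> i) \<in> borel_measurable (F t)) \<and>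
     (\<forall>\<omega>\<in>space \<Omega>. continuous_on {0..T} (\<lambda>t. X t \<omega> i)))"

text \<open>
  The coefficients of the noise are deterministic and constant in time, so the stochastic
  integrals in the integrated form of the system are \<open>\<integral>\<^sub>0\<^sup>t c dB\<^sub>k = c (B\<^sub>k(t) - B\<^sub>k(0))\<close>.
\<close>

definition kgs_solution ::
    "'w measure \<Rightarrow> (real \<Rightarrow> 'w measure) \<Rightarrow> (nat \<Rightarrow> real \<Rightarrow> 'w \<Rightarrow> real) \<Rightarrow> real \<Rightarrow>
     real \<Rightarrow> real \<Rightarrow> nat \<Rightarrow> real \<Rightarrow> real \<Rightarrow> (real \<Rightarrow> real) \<Rightarrow> (real \<Rightarrow> real) \<Rightarrow>
     (nat \<Rightarrow> real) \<Rightarrow> (nat \<Rightarrow> real) \<Rightarrow> (nat \<Rightarrow> real) \<Rightarrow> (nat \<Rightarrow> real) \<Rightarrow>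
     (real \<Rightarrow> 'w \<Rightarrow> nat \<Rightarrow> real) \<Rightarrow> (real \<Rightarrow> 'w \<Rightarrow> nat \<Rightarrow> real) \<Rightarrow>
     (real \<Rightarrow> 'w \<Rightarrow> nat \<Rightarrow> real) \<Rightarrow> (real \<Rightarrow> 'w \<Rightarrow> nat \<Rightarrow> real) \<Rightarrow> bool" where
  "kgs_solution \<Omega> F B T a b M C1 C2 \<eta>1 \<eta>2 P0 Q0 U0 V0 P Q U V \<longleftrightarrow>
     cont_adapted \<Omega> F T M P \<and> cont_adapted \<Omega> F T M Q \<and>
     cont_adapted \<Omega> F T M U \<and> cont_adapted \<Omega> F T M V \<and>
     (AE \<omega> in \<Omega>. \<forall>t\<in>{0..T}. \<forall>i\<in>{1..<M}.
        Q t \<omega> i = Q0 i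
          + (LBINT s:{0..t}. lap a b M (P s \<omega>) i + (U s \<omega> \<odot> P s \<omega>) i)
          - C1 * grid_vec a b M \<eta>1 i * (B 0 t \<omega> - B 0 0 \<omega>) \<and>
        P t \<omega> i = P0 i
          + (LBINT s:{0..t}. - (lap a b M (Q s \<omega>) i + (U s \<omega> \<odot> Q s \<omega>) i))
          + C1 * grid_vec a b M \<eta>1 i * (B 1 t \<omega> - B 1 0 \<omega>) \<and>
        V t \<omega> i = V0 i
          + (LBINT s:{0..t}. (1/2) * (lap a b M (U s \<omega>) i - U s \<omega> i
                              + (P s \<omega> \<odot> P s \<omega>) i + (Q s \<omega> \<odot> Q s \<omega>) i))
          + (1/2) * C2 * grid_vec a b M \<eta>2 i * (B 2 t \<omega> - B 2 0 \<omega>) \<and>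
        U t \<omega> i = U0 i + (LBINT s:{0..t}. 2 * V s \<omega> i))"

end

theory Submission
  imports Defs "HOL-Library.Landau_Symbols"
begin

text \<open>
  The charge \<open>N = \<Sum>\<^sub>i P\<^sub>i\<^sup>2 + Q\<^sub>i\<^sup>2\<close> and the energy are invariants of the noiseless system, and the noise is
  additive, so the expected energy changes only through the second-order terms of the noise. The
  proof avoids stochastic integrals. Let \<open>\<tau>\<close> be the time up to which all components are bounded by \<open>R\<close>,
  and switch off the drift, but not the noise, after \<open>\<tau>\<close>. The drift of the resulting process \<open>Y\<close> is
  bounded, so all moments of \<open>Y\<close> exist, and it is still tangent to the level sets of charge and energy.

  For a function \<open>f\<close> whose gradient is orthogonal to the drift, differentiating
  \<open>f (Y\<^sub>r + \<sigma> (W\<^sub>t - W\<^sub>r))\<close> in \<open>r\<close> along \<open>[s, t]\<close>, a path that is differentiable before \<open>\<tau>\<close> and constant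
  after it, shows that \<open>f (Y\<^sub>t)\<close> and \<open>f (Y\<^sub>s + \<sigma> (W\<^sub>t - W\<^sub>s))\<close> differ in expectation by
  \<open>O((t - s)\<^sup>3\<^sup>/\<^sup>2)\<close>. The energy is quadratic in the noisy variables, so the expectation of the latter
  is explicit and the errors, being of order larger than one, add up to zero over fine partitions.
  The same comparison for \<open>f = N\<^sup>4\<close> and a discrete Gronwall argument bound \<open>E N\<^sup>4\<close> independently of
  \<open>R\<close>; the equations for \<open>U\<close> and \<open>V\<close>, linear with source \<open>N\<close>, then give fourth moments of \<open>U\<close> and
  \<open>V\<close>. Hence the energy is bounded in \<open>L\<^sup>2\<close> uniformly in \<open>R\<close>, and \<open>R \<rightarrow> \<infinity>\<close> is allowed.
\<close>

section \<open>Random variables with moments of all orders\<close>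

text \<open>The energy gives no bound by itself, since its cubic term has no sign; the bounds come
  from the charge, which is positive definite in \<open>P\<close> and \<open>Q\<close>. The power
  \<open>N ^ 4\<close> is dictated by the end of the proof: the limit needs the energy bounded in
  L2, hence fourth moments of \<open>U\<close> and \<open>V\<close>, and these are driven by the
  source \<open>N\<close>. The noise goes on after the exit time because its increment over [s, t]
  then remains an unaltered Wiener increment, independent of the past. If it were stopped as well,
  its increments would have no explicit law. The order 3/2 arises as follows. At zero noise
  increments the derivative along the drift vanishes by conservation, so in general it is of the
  size of the increments, in mean sqrt (t - s), and integration over [s, t] adds a factor t - s. The
  constant in front may depend on \<open>R\<close>, because partitions are refined with
  \<open>R\<close> fixed. Only what survives the refinement has to be uniform in
  \<open>R\<close>.\<close>

text \<open>Rounding the time down to a grid leaves countably many time values, for which joint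
  measurability is clear; continuity of the paths then gives the limit. The clamping to
  \<open>{s..T}\<close> keeps rounded times inside the interval where the process is known. Joint
  measurability is needed for Fubini and for evaluation at random times.\<close>

lemma caratheodory_measurable:
  fixes X :: "real \<Rightarrow> 'w \<Rightarrow> real"
  assumes st: "s \<le> T"
    and meas: "\<And>t. t \<in> {s..T} \<Longrightarrow> X t \<in> borel_measurable M"
    and cont: "\<And>w. w \<in> space M \<Longrightarrow> continuous_on {s..T} (\<lambda>t. X t w)"
  shows "(\<lambda>(t, w). X (max s (min T t)) w) \<in> borel_measurable (borel \<Otimes>\<^sub>M M)"
proof -
  define c where "c t = max s (min T t)" for t :: real
  have c: "c t \<in> {s..T}" for t using st by (auto simp: c_def)
  define g where "g n t = real_of_int \<lfloor>real (Suc n) * t\<rfloor> / real (Suc n)" for n t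
  have g: "(\<lambda>n. g n t) \<longlonglongrightarrow> t" for t
  proof -
    have "(\<lambda>n. \<bar>g n t - t\<bar>) \<longlonglongrightarrow> 0"
    proof (rule tendsto_sandwich[OF _ _ tendsto_const LIMSEQ_inverse_real_of_nat])
      have "\<bar>g n t - t\<bar> \<le> inverse (real (Suc n))" for n
      proof -
        have "g n t - t = (real_of_int \<lfloor>real (Suc n) * t\<rfloor> - real (Suc n) * t) / real (Suc n)"
          unfolding g_def by (simp add: field_simps)
        also have "\<bar>\<dots>\<bar> \<le> 1 / real (Suc n)"
          unfolding abs_divide by (intro divide_mono) (auto, linarith)
        finally show ?thesis by (simp add: divide_inverse)
      qed
      then show "\<forall>\<^sub>F n in sequentially. \<bar>g n t - t\<bar> \<le> inverse (real (Suc n))" by simp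
    qed simp
    then show ?thesis using LIM_zero_cancel tendsto_rabs_zero_iff by blast
  qed
  have "(\<lambda>x. X (c (fst x)) (snd x)) \<in> borel_measurable (borel \<Otimes>\<^sub>M M)"
  proof (rule borel_measurable_LIMSEQ_metric)
    fix n
    show "(\<lambda>x. X (c (g n (fst x))) (snd x)) \<in> borel_measurable (borel \<Otimes>\<^sub>M M)"
    proof -
      have "(\<lambda>x. X (c (real_of_int k / real (Suc n))) (snd x)) \<in> borel_measurable (borel \<Otimes>\<^sub>M M)"
        for k :: int
        by (rule measurable_compose[OF measurable_snd meas[OF c]])
      moreover have "(\<lambda>x. \<lfloor>real (Suc n) * fst x\<rfloor>) \<in> measurable (borel \<Otimes>\<^sub>M M) (count_space UNIV)"
        by measurable
      ultimately show ?thesis unfolding g_def by (rule measurable_compose_countable)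
    qed
  next
    fix x assume "x \<in> space (borel \<Otimes>\<^sub>M M :: (real \<times> 'w) measure)"
    then have "snd x \<in> space M" by (auto simp: space_pair_measure)
    have "(\<lambda>n. c (g n (fst x))) \<longlonglongrightarrow> c (fst x)"
      unfolding c_def by (intro tendsto_intros g)
    then show "(\<lambda>n. X (c (g n (fst x))) (snd x)) \<longlonglongrightarrow> X (c (fst x)) (snd x)"
      by (rule continuous_on_tendsto_compose[OF cont[OF \<open>snd x \<in> space M\<close>] _ c]) (use c in auto)
  qed
  then show ?thesis by (simp add: c_def case_prod_unfold)
qed

text \<open>This class is closed under sums and products, so that integrability of any polynomial in
  the components, such as the energy or \<open>N ^ 4\<close>, reduces to the components
  themselves.\<close>

definition all_moments :: "'w measure \<Rightarrow> ('w \<Rightarrow> real) \<Rightarrow> bool" where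
  "all_moments M X \<longleftrightarrow> X \<in> borel_measurable M \<and> (\<forall>k::nat. integrable M (\<lambda>w. \<bar>X w\<bar> ^ k))"

lemma all_moments_measurable: "all_moments M X \<Longrightarrow> X \<in> borel_measurable M"
  by (simp add: all_moments_def)

lemma all_moments_integrable_power: "all_moments M X \<Longrightarrow> integrable M (\<lambda>w. \<bar>X w\<bar> ^ k)"
  by (simp add: all_moments_def)

lemma all_moments_integrable:
  assumes "all_moments M X" shows "integrable M X"
proof -
  have "integrable M (\<lambda>w. \<bar>X w\<bar> ^ 1)" by (rule all_moments_integrable_power[OF assms])
  then show ?thesis
    using assms by (intro integrable_abs_cancel[of M X]) (auto simp: all_moments_def)
qed

lemma all_moments_dominated:
  assumes "all_moments M Y" "X \<in> borel_measurable M" "AE w in M. \<bar>X w\<bar> \<le> \<bar>Y w\<bar>"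
  shows "all_moments M X"
  unfolding all_moments_def
proof (intro conjI allI)
  fix k
  have "AE w in M. norm (\<bar>X w\<bar> ^ k) \<le> norm (\<bar>Y w\<bar> ^ k)"
    using assms(3) by eventually_elim (auto intro: power_mono)
  then show "integrable M (\<lambda>w. \<bar>X w\<bar> ^ k)"
    using assms(2) by (intro Bochner_Integration.integrable_bound[OF all_moments_integrable_power[OF assms(1)]]) auto
qed (use assms in auto)

lemma power_add_le: "\<bar>x + y :: real\<bar> ^ k \<le> 2 ^ k * (\<bar>x\<bar> ^ k + \<bar>y\<bar> ^ k)"
proof -
  have "\<bar>x + y\<bar> ^ k \<le> (2 * max \<bar>x\<bar> \<bar>y\<bar>) ^ k" by (rule power_mono) auto
  also have "\<dots> = 2 ^ k * (max \<bar>x\<bar> \<bar>y\<bar>) ^ k" by (rule power_mult_distrib)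
  also have "\<dots> \<le> 2 ^ k * (\<bar>x\<bar> ^ k + \<bar>y\<bar> ^ k)" by (intro mult_left_mono) (auto simp: max_def)
  finally show ?thesis .
qed

lemma all_moments_add:
  assumes "all_moments M X" "all_moments M Y"
  shows "all_moments M (\<lambda>w. X w + Y w)"
  unfolding all_moments_def
proof (intro conjI allI)
  fix k
  have "integrable M (\<lambda>w. 2 ^ k * (\<bar>X w\<bar> ^ k + \<bar>Y w\<bar> ^ k))"
    using assms unfolding all_moments_def by auto
  then show "integrable M (\<lambda>w. \<bar>X w + Y w\<bar> ^ k)"
    by (rule Bochner_Integration.integrable_bound) (use assms power_add_le in \<open>auto simp: all_moments_def\<close>)
qed (use assms in \<open>auto simp: all_moments_def\<close>)

text \<open>From 2xy <= x^2 + y^2 applied to k-th powers. The doubled order costs nothing because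
  moments of every order are available.\<close>

lemma all_moments_mult:
  assumes "all_moments M X" "all_moments M Y"
  shows "all_moments M (\<lambda>w. X w * Y w)"
  unfolding all_moments_def
proof (intro conjI allI)
  fix k
  have le: "\<bar>x * y\<bar> ^ k \<le> \<bar>x\<bar> ^ (2 * k) + \<bar>y\<bar> ^ (2 * k)" for x y :: real
  proof -
    have "2 * (\<bar>x\<bar> ^ k * \<bar>y\<bar> ^ k) \<le> (\<bar>x\<bar> ^ k)\<^sup>2 + (\<bar>y\<bar> ^ k)\<^sup>2"
      using sum_squares_bound[of "\<bar>x\<bar> ^ k" "\<bar>y\<bar> ^ k"] by (simp add: mult.assoc)
    moreover have "0 \<le> \<bar>x\<bar> ^ k * \<bar>y\<bar> ^ k" by simp
    ultimately have "\<bar>x\<bar> ^ k * \<bar>y\<bar> ^ k \<le> (\<bar>x\<bar> ^ k)\<^sup>2 + (\<bar>y\<bar> ^ k)\<^sup>2" by linarith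
    then show ?thesis
      unfolding abs_mult power_mult_distrib by (simp only: power_mult mult.commute[of 2 k])
  qed
  have "integrable M (\<lambda>w. \<bar>X w\<bar> ^ (2 * k) + \<bar>Y w\<bar> ^ (2 * k))"
    by (intro Bochner_Integration.integrable_add all_moments_integrable_power assms)
  then show "integrable M (\<lambda>w. \<bar>X w * Y w\<bar> ^ k)"
    by (rule Bochner_Integration.integrable_bound) (use assms le in \<open>auto simp: all_moments_def\<close>)
qed (use assms in \<open>auto simp: all_moments_def\<close>)

lemma (in prob_space) all_moments_const: "all_moments M (\<lambda>_. c)"
  by (simp add: all_moments_def)

lemma (in prob_space) all_moments_sum:
  "(\<And>i. i \<in> I \<Longrightarrow> all_moments M (X i)) \<Longrightarrow> all_moments M (\<lambda>w. \<Sum>i\<in>I. X i w)"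
  by (induction I rule: infinite_finite_induct)
    (auto intro: all_moments_add all_moments_const)

lemma (in prob_space) all_moments_power:
  "all_moments M X \<Longrightarrow> all_moments M (\<lambda>w. X w ^ k)"
  by (induction k) (auto intro: all_moments_mult all_moments_const)

lemma (in prob_space) all_moments_uminus:
  "all_moments M X \<Longrightarrow> all_moments M (\<lambda>w. - X w)"
  by (simp add: all_moments_def)

lemma (in prob_space) all_moments_diff:
  "all_moments M X \<Longrightarrow> all_moments M Y \<Longrightarrow> all_moments M (\<lambda>w. X w - Y w)"
  using all_moments_add[OF _ all_moments_uminus, of X Y] by simp

lemma all_moments_abs:
  "all_moments M X \<Longrightarrow> all_moments M (\<lambda>w. \<bar>X w\<bar>)"
  by (auto simp: all_moments_def)

lemmas (in prob_space) all_moments_intros =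
  all_moments_const all_moments_add all_moments_mult all_moments_sum all_moments_power
  all_moments_uminus all_moments_diff all_moments_abs

lemma (in prob_space) normal_moments:
  assumes D: "distributed M lborel D (normal_density 0 \<sigma>)" and \<sigma>: "0 < \<sigma>"
  shows "all_moments M D" "expectation D = 0" "expectation (\<lambda>w. (D w)\<^sup>2) = \<sigma>\<^sup>2"
    "expectation (\<lambda>w. D w ^ 8) = 105 * \<sigma> ^ 8" "expectation (\<lambda>w. \<bar>D w\<bar>) \<le> \<sigma>"
proof -
  have [measurable]: "D \<in> borel_measurable M" using distributed_measurable[OF D] by simp
  have int: "integrable M (\<lambda>w. \<bar>D w\<bar> ^ k)" for k :: nat
    using distributed_integrable[OF D, of "\<lambda>x. \<bar>x\<bar> ^ k"] integrable_normal_moment_abs[OF \<sigma>, of 0 k]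
    by simp
  then show am: "all_moments M D" by (simp add: all_moments_def)
  have E: "expectation (\<lambda>w. g (D w)) = (\<integral>x. normal_density 0 \<sigma> x * g x \<partial>lborel)"
    if "g \<in> borel_measurable lborel" for g :: "real \<Rightarrow> real"
    using distributed_integral[OF D that] by simp
  show "expectation D = 0"
    using E[of "\<lambda>x. x"] integral_normal_moment_odd[OF \<sigma>, of 0 0] by simp
  show E2: "expectation (\<lambda>w. (D w)\<^sup>2) = \<sigma>\<^sup>2"
    using E[of "\<lambda>x. x\<^sup>2"] integral_normal_moment_even[OF \<sigma>, of 0 1] \<sigma>
    by (simp add: field_simps power2_eq_square)
  \<comment> \<open>105 = 1 * 3 * 5 * 7. The order 8 is the degree of \<open>N ^ 4\<close> as a
    polynomial in \<open>P\<close> and \<open>Q\<close>.\<close>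
  show "expectation (\<lambda>w. D w ^ 8) = 105 * \<sigma> ^ 8"
    using E[of "\<lambda>x. x ^ 8"] integral_normal_moment_even[OF \<sigma>, of 0 4] \<sigma>
    by (simp add: field_simps fact_numeral eval_nat_numeral)
  have le: "\<bar>D w\<bar> \<le> ((D w)\<^sup>2 / \<sigma> + \<sigma>) / 2" for w
  proof -
    have "2 * \<bar>D w\<bar> * \<sigma> \<le> (D w)\<^sup>2 + \<sigma>\<^sup>2" using sum_squares_bound[of "\<bar>D w\<bar>" \<sigma>] by simp
    then show ?thesis using \<sigma> by (simp add: field_simps power2_eq_square)
  qed
  have "expectation (\<lambda>w. \<bar>D w\<bar>) \<le> expectation (\<lambda>w. ((D w)\<^sup>2 / \<sigma> + \<sigma>) / 2)"
    using int[of 1] int[of 2] by (intro integral_mono le) auto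
  also have "\<dots> = \<sigma>" using int[of 2] E2 \<sigma> by (simp add: prob_space power2_eq_square field_simps)
  finally show "expectation (\<lambda>w. \<bar>D w\<bar>) \<le> \<sigma>" .
qed

section \<open>Inequalities that accumulate over fine partitions\<close>

text \<open>With m equal steps of length d = t / m the extra terms add up to m * K * d * sqrt d = K
  * t * sqrt d, which vanishes as m grows; so \<open>K\<close> leaves no trace in the conclusion.
  The alternative \<open>C = 0\<close> admits functions of any sign.\<close>

lemma discrete_Gronwall:
  fixes u :: "real \<Rightarrow> real"
  assumes t: "0 \<le> t" and C: "0 \<le> C" and K: "0 \<le> K" and nonneg: "C = 0 \<or> 0 \<le> u 0"
    and step: "\<And>s r. 0 \<le> s \<Longrightarrow> s < r \<Longrightarrow> r \<le> t \<Longrightarrow>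
      u r \<le> (1 + C * (r - s)) * u s + K * ((r - s) * sqrt (r - s))"
  shows "u t \<le> exp (C * t) * u 0"
proof (cases "t = 0")
  case True then show ?thesis by simp
next
  case False
  with t have t: "0 < t" by simp
  have bound: "u t \<le> exp (C * t) * (u 0 + K * t * sqrt (t / real (Suc n)))" for n
  proof -
    define m where "m = real (Suc n)"
    define d where "d = t / m"
    have m: "0 < m" by (simp add: m_def)
    have d: "0 < d" using t m by (simp add: d_def)
    define e where "e = K * (d * sqrt d)"
    have e: "0 \<le> e" using K d by (simp add: e_def)
    have "u (real k * d) \<le> (1 + C * d) ^ k * (u 0 + real k * e)" if "k \<le> Suc n" for k
      using that
    proof (induction k)
      case 0 show ?case by simp
    next
      case (Suc k)
      let ?s = "real k * d" and ?r = "real (Suc k) * d"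
      have "real (Suc k) * d \<le> m * d" using Suc.prems d by (intro mult_right_mono) (auto simp: m_def)
      then have r: "?r \<le> t" using m by (simp add: d_def)
      have rs: "?r - ?s = d" by (simp add: algebra_simps)
      have "u ?r \<le> (1 + C * d) * u ?s + e"
        using step[of ?s ?r, unfolded rs] r d unfolding e_def by simp
      \<comment> \<open>The new error is enlarged by a factor of at least 1, so that all errors
        share the factor of \<open>u 0\<close>.\<close>
      also have "\<dots> \<le> (1 + C * d) * ((1 + C * d) ^ k * (u 0 + real k * e)) + (1 + C * d) ^ Suc k * e"
      proof (intro add_mono mult_left_mono)
        show "u ?s \<le> (1 + C * d) ^ k * (u 0 + real k * e)" using Suc by simp
        have "1 \<le> (1 + C * d) ^ Suc k" using C d by (intro one_le_power) simp
        then show "e \<le> (1 + C * d) ^ Suc k * e" using e by (simp add: mult_right_mono mult_le_cancel_right1)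
      qed (use C d in auto)
      also have "\<dots> = (1 + C * d) ^ Suc k * (u 0 + real (Suc k) * e)" by (simp add: algebra_simps)
      finally show ?case .
    qed
    from this[of "Suc n"] have "u t \<le> (1 + C * d) ^ Suc n * (u 0 + m * e)"
      using m by (simp add: d_def m_def)
    also have "m * e = K * t * sqrt d" using m by (simp add: e_def d_def)
    also have "(1 + C * d) ^ Suc n * (u 0 + K * t * sqrt d) \<le> exp (C * t) * (u 0 + K * t * sqrt d)"
    proof (cases "C = 0")
      \<comment> \<open>Only here the sign of \<open>u 0\<close> matters; for \<open>C = 0\<close>
        both factors are 1.\<close>
      case False
      show ?thesis
      proof (rule mult_right_mono)
        have "(1 + C * d) ^ Suc n \<le> exp (C * d) ^ Suc n"
          using C d by (intro power_mono) auto
        also have "\<dots> = exp (m * (C * d))" unfolding m_def by (rule exp_of_nat_mult[symmetric])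
        also have "m * (C * d) = C * t" using m by (simp add: d_def)
        finally show "(1 + C * d) ^ Suc n \<le> exp (C * t)" .
        show "0 \<le> u 0 + K * t * sqrt d" using nonneg False K t d by simp
      qed
    qed simp
    finally show ?thesis by (simp add: d_def m_def)
  qed
  have "(\<lambda>n. exp (C * t) * (u 0 + K * t * sqrt (t * inverse (real (Suc n))))) \<longlonglongrightarrow>
      exp (C * t) * (u 0 + K * t * sqrt (t * 0))"
    by (intro tendsto_intros LIMSEQ_inverse_real_of_nat)
  then have "u t \<le> exp (C * t) * (u 0 + K * t * sqrt (t * 0))"
    by (rule LIMSEQ_le_const) (use bound in \<open>auto simp: divide_inverse\<close>)
  then show ?thesis by simp
qed

text \<open>Gronwall with \<open>C = 0\<close> applies to \<open>g\<close> and to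
  \<open>- g\<close>. In this form the one-step comparison of the energy becomes an
  identity.\<close>

lemma constant_if_superlinear_increments:
  fixes g :: "real \<Rightarrow> real"
  assumes t: "0 \<le> t" and K: "0 \<le> K"
    and step: "\<And>s r. 0 \<le> s \<Longrightarrow> s < r \<Longrightarrow> r \<le> t \<Longrightarrow> \<bar>g r - g s\<bar> \<le> K * ((r - s) * sqrt (r - s))"
  shows "g t = g 0"
proof -
  have "g r \<le> (1 + 0 * (r - s)) * g s + K * ((r - s) * sqrt (r - s))"
    "- g r \<le> (1 + 0 * (r - s)) * - g s + K * ((r - s) * sqrt (r - s))" if "0 \<le> s" "s < r" "r \<le> t" for s r
    using step[OF that] by (simp_all add: abs_le_iff)
  then have "g t \<le> exp (0 * t) * g 0" "- g t \<le> exp (0 * t) * - g 0"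
    using discrete_Gronwall[OF t order_refl K, of g] discrete_Gronwall[OF t order_refl K, of "\<lambda>s. - g s"] by blast+
  then show ?thesis by simp
qed

section \<open>Passage to the limit in expectations\<close>

text \<open>An instance of Vitali's theorem: boundedness in L2 implies uniform integrability. Fatou
  transfers the bound to \<open>Z\<close>, and the difference lives on the sets \<open>A n\<close>,
  whose probability tends to zero. Eventual equality is the mode of convergence that truncation at
  growing levels produces.\<close>

lemma (in prob_space) expectation_convergence_L2_bounded:
  fixes Z :: "'a \<Rightarrow> real" and X :: "nat \<Rightarrow> 'a \<Rightarrow> real"
  assumes meas: "\<And>n. X n \<in> borel_measurable M" "Z \<in> borel_measurable M"
    and int: "\<And>n. integrable M (\<lambda>w. (X n w)\<^sup>2)"
    and bound: "\<And>n. expectation (\<lambda>w. (X n w)\<^sup>2) \<le> C"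
    and ev: "\<And>w. w \<in> space M \<Longrightarrow> eventually (\<lambda>n. X n w = Z w) sequentially"
  shows "integrable M (\<lambda>w. (Z w)\<^sup>2)" "expectation (\<lambda>w. (Z w)\<^sup>2) \<le> C"
    "integrable M Z" "(\<lambda>n. expectation (X n)) \<longlonglongrightarrow> expectation Z"
proof -
  note [measurable] = meas
  have C: "0 \<le> C" using bound[of 0] by (meson Bochner_Integration.integral_nonneg order_trans zero_le_power2)
  have nn: "(\<integral>\<^sup>+w. ennreal ((Z w)\<^sup>2) \<partial>M) \<le> ennreal C"
  proof -
    have "(\<integral>\<^sup>+w. ennreal ((Z w)\<^sup>2) \<partial>M) = (\<integral>\<^sup>+w. liminf (\<lambda>n. ennreal ((X n w)\<^sup>2)) \<partial>M)"
    proof (rule nn_integral_cong)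
      fix w assume "w \<in> space M"
      then have "(\<lambda>n. ennreal ((X n w)\<^sup>2)) \<longlonglongrightarrow> ennreal ((Z w)\<^sup>2)"
        by (intro tendsto_eventually eventually_mono[OF ev]) auto
      then show "ennreal ((Z w)\<^sup>2) = liminf (\<lambda>n. ennreal ((X n w)\<^sup>2))"
        by (intro lim_imp_Liminf[symmetric]) auto
    qed
    also have "\<dots> \<le> liminf (\<lambda>n. \<integral>\<^sup>+w. ennreal ((X n w)\<^sup>2) \<partial>M)"
      by (rule nn_integral_liminf) simp
    also have "\<dots> \<le> ennreal C"
    proof (rule Liminf_le)
      show "\<forall>\<^sub>F n in sequentially. (\<integral>\<^sup>+w. ennreal ((X n w)\<^sup>2) \<partial>M) \<le> ennreal C"
      proof (intro always_eventually allI)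
        fix n
        have "(\<integral>\<^sup>+w. ennreal ((X n w)\<^sup>2) \<partial>M) = ennreal (expectation (\<lambda>w. (X n w)\<^sup>2))"
          by (rule nn_integral_eq_integral[OF int]) simp
        then show "(\<integral>\<^sup>+w. ennreal ((X n w)\<^sup>2) \<partial>M) \<le> ennreal C"
          using bound by (simp add: ennreal_leI)
      qed
    qed simp
    finally show ?thesis .
  qed
  then show Z2: "integrable M (\<lambda>w. (Z w)\<^sup>2)"
    by (intro integrableI_bounded) (auto intro: order_le_less_trans)
  have "(\<integral>\<^sup>+w. ennreal ((Z w)\<^sup>2) \<partial>M) = ennreal (expectation (\<lambda>w. (Z w)\<^sup>2))"
    by (rule nn_integral_eq_integral[OF Z2]) simp
  with nn show EZ2: "expectation (\<lambda>w. (Z w)\<^sup>2) \<le> C"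
    using C by simp
  show Z1: "integrable M Z" by (rule square_integrable_imp_integrable[OF meas(2) Z2])
  have X1: "integrable M (X n)" for n by (rule square_integrable_imp_integrable[OF meas(1) int])
  define A where "A n = {w\<in>space M. X n w \<noteq> Z w}" for n
  have [measurable]: "A n \<in> sets M" for n unfolding A_def by measurable
  have Aint [simp]: "integrable M (indicat_real (A n))" for n
    by (intro integrable_real_indicator) (auto simp: emeasure_eq_measure)
  have probA: "(\<lambda>n. expectation (indicator (A n))) \<longlonglongrightarrow> expectation (\<lambda>_. 0 :: real)"
  proof (rule integral_dominated_convergence[where w = "\<lambda>_. 1"])
    show "AE w in M. (\<lambda>n. indicator (A n) w :: real) \<longlonglongrightarrow> 0"
    proof (rule AE_I2)
      fix w assume "w \<in> space M"
      from ev[OF this] show "(\<lambda>n. indicator (A n) w :: real) \<longlonglongrightarrow> 0"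
        by (intro tendsto_eventually) (auto elim!: eventually_mono simp: A_def)
    qed
  qed (auto simp: indicator_def)
  show "(\<lambda>n. expectation (X n)) \<longlonglongrightarrow> expectation Z"
  proof (rule LIMSEQ_I)
    fix e :: real assume e: "0 < e"
    \<comment> \<open>Chosen so that \<open>4 * C / k < e\<close>; the summand 1 keeps
      \<open>k\<close> positive when \<open>C = 0\<close>.\<close>
    define k where "k = (4 * C + 1) / e"
    have k: "0 < k" using C e by (simp add: k_def)
    have le: "\<bar>expectation (X n) - expectation Z\<bar> \<le> (4 * C) / k + k * expectation (indicator (A n))" for n
    proof -
      have "\<bar>expectation (X n) - expectation Z\<bar> = \<bar>expectation (\<lambda>w. X n w - Z w)\<bar>"
        using X1 Z1 by simp
      also have "\<dots> \<le> expectation (\<lambda>w. \<bar>X n w - Z w\<bar>)" by (rule integral_abs_bound)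
      also have "\<dots> \<le> expectation (\<lambda>w. (2 * (X n w)\<^sup>2 + 2 * (Z w)\<^sup>2) / k + k * indicator (A n) w)"
      proof (rule integral_mono)
        fix w assume "w \<in> space M"
        show "\<bar>X n w - Z w\<bar> \<le> (2 * (X n w)\<^sup>2 + 2 * (Z w)\<^sup>2) / k + k * indicator (A n) w"
        proof (cases "w \<in> A n")
          case True
          let ?d = "\<bar>X n w - Z w\<bar>"
          \<comment> \<open>AM-GM with weight \<open>k\<close>: the second moments are divided by
            \<open>k\<close>, and the remaining \<open>k\<close> is paid only on
            \<open>A n\<close>.\<close>
          have "2 * ?d * k \<le> ?d\<^sup>2 + k\<^sup>2" by (rule sum_squares_bound)
          moreover have "?d\<^sup>2 \<le> 2 * (X n w)\<^sup>2 + 2 * (Z w)\<^sup>2"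
            using zero_le_power2[of "X n w + Z w"] by (simp add: power2_diff power2_sum)
          moreover have "0 \<le> ?d * k" using k by simp
          ultimately have "?d * k \<le> 2 * (X n w)\<^sup>2 + 2 * (Z w)\<^sup>2 + k\<^sup>2" by linarith
          then show ?thesis using k True by (simp add: field_simps power2_eq_square)
        next
          case False
          then have "X n w = Z w" using \<open>w \<in> space M\<close> by (simp add: A_def)
          then show ?thesis using k by simp
        qed
      qed (use X1 Z1 Z2 int Aint in auto)
      also have "\<dots> = (2 * expectation (\<lambda>w. (X n w)\<^sup>2) + 2 * expectation (\<lambda>w. (Z w)\<^sup>2)) / k
          + k * expectation (indicator (A n))"
        using X1 Z1 Z2 int by simp
      also have "\<dots> \<le> (4 * C) / k + k * expectation (indicator (A n))"
        using bound[of n] EZ2 k by (intro add_right_mono divide_right_mono) auto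
      finally show ?thesis .
    qed
    have lt: "(4 * C) / k < e" using C e by (simp add: k_def field_simps)
    have "(\<lambda>n. (4 * C) / k + k * expectation (indicator (A n))) \<longlonglongrightarrow> (4 * C) / k + k * 0"
      using probA by (intro tendsto_intros) simp
    then have "\<forall>\<^sub>F n in sequentially. (4 * C) / k + k * expectation (indicator (A n)) < e"
      using lt by (intro order_tendstoD) auto
    then show "\<exists>N. \<forall>n\<ge>N. norm (expectation (X n) - expectation Z) < e"
      using le by (auto simp: eventually_sequentially intro: le_less_trans)
  qed
qed


section \<open>Calculus along paths\<close>

text \<open>The gauge integral recovers a function from its derivative without continuity of the
  derivative; only the majorant \<open>h\<close> has to be continuous.\<close>

lemma increment_le_integral:
  fixes F :: "real \<Rightarrow> real"
  assumes "s \<le> t"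
    and F: "\<And>r. r \<in> {s..t} \<Longrightarrow> (F has_real_derivative F' r) (at r within {s..t})"
    and le: "\<And>r. r \<in> {s..t} \<Longrightarrow> \<bar>F' r\<bar> \<le> h r" and h: "continuous_on {s..t} h"
  shows "\<bar>F t - F s\<bar> \<le> integral {s..t} h"
proof -
  have *: "(F' has_integral F t - F s) {s..t}"
    using F by (intro fundamental_theorem_of_calculus \<open>s \<le> t\<close>)
      (auto simp: has_real_derivative_iff_has_vector_derivative)
  have "norm (integral {s..t} F') \<le> integral {s..t} h"
    using le by (intro integral_norm_bound_integral has_integral_integrable[OF *]
      integrable_continuous_real h) auto
  with * show ?thesis by (simp add: integral_unique)
qed

text \<open>By the integrating factor \<open>exp (- L * r)\<close>, which is at most 1 and can
  therefore be dropped in front of the nonnegative \<open>h\<close>.\<close>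

lemma Gronwall_derivative:
  fixes q :: "real \<Rightarrow> real"
  assumes \<tau>: "0 \<le> \<tau>" and L: "0 \<le> L"
    and q: "\<And>r. r \<in> {0..\<tau>} \<Longrightarrow> (q has_real_derivative q' r) (at r within {0..\<tau>})"
    and le: "\<And>r. r \<in> {0..\<tau>} \<Longrightarrow> q' r \<le> L * q r + h r"
    and h: "continuous_on {0..\<tau>} h" "\<And>r. r \<in> {0..\<tau>} \<Longrightarrow> 0 \<le> h r"
  shows "q \<tau> \<le> exp (L * \<tau>) * (q 0 + integral {0..\<tau>} h)"
proof -
  define f where "f r = exp (- L * r) * q r" for r
  have "(f has_real_derivative exp (- L * r) * (q' r - L * q r)) (at r within {0..\<tau>})"
    if "r \<in> {0..\<tau>}" for r
    unfolding f_def by (rule derivative_eq_intros q[OF that] refl)+ (simp add: algebra_simps)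
  then have "((\<lambda>r. exp (- L * r) * (q' r - L * q r)) has_integral f \<tau> - f 0) {0..\<tau>}"
    by (intro fundamental_theorem_of_calculus \<tau>)
      (auto simp: has_real_derivative_iff_has_vector_derivative)
  moreover have "(h has_integral integral {0..\<tau>} h) {0..\<tau>}"
    by (intro integrable_integral integrable_continuous_real h)
  moreover have "exp (- L * r) * (q' r - L * q r) \<le> h r" if r: "r \<in> {0..\<tau>}" for r
  proof -
    have "exp (- L * r) * (q' r - L * q r) \<le> exp (- L * r) * h r"
      using le[OF r] by (intro mult_left_mono) auto
    also have "\<dots> \<le> 1 * h r" using L r h(2)[OF r] by (intro mult_right_mono) auto
    finally show ?thesis by simp
  qed
  ultimately have "f \<tau> - f 0 \<le> integral {0..\<tau>} h" by (rule has_integral_le)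
  then have "exp (L * \<tau>) * f \<tau> \<le> exp (L * \<tau>) * (q 0 + integral {0..\<tau>} h)"
    by (intro mult_left_mono) (auto simp: f_def)
  moreover have "exp (L * \<tau>) * f \<tau> = q \<tau>" by (simp add: f_def exp_minus)
  ultimately show ?thesis by simp
qed

section \<open>Perturbation and differentiation of charge and energy\<close>

lemma lap_add: "lap a b M (\<lambda>i. p i + q i) i = lap a b M p i + lap a b M q i"
  by (simp add: lap_def distrib_left sum.distrib)

lemma lap_cmult: "lap a b M (\<lambda>i. c * p i) i = c * lap a b M p i"
  by (simp add: lap_def sum_distrib_left mult.left_commute)

lemma lap_shift: "lap a b M (\<lambda>i. p i + f i * x) i = lap a b M p i + x * lap a b M f i"
  using lap_add[of a b M p "\<lambda>i. x * f i" i] lap_cmult[of a b M x f i] by (simp add: mult.commute)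

lemma lap_shift_minus: "lap a b M (\<lambda>i. p i - f i * x) i = lap a b M p i - x * lap a b M f i"
  using lap_shift[of a b M p f "- x" i] by simp

text \<open>Discrete integration by parts. It is behind the conservation of charge and merges the
  mixed terms in the expansion of the energy.\<close>

lemma lap_symmetric:
  "(\<Sum>i\<in>{1..<M}. p i * lap a b M q i) = (\<Sum>i\<in>{1..<M}. q i * lap a b M p i)"
proof -
  have sym: "lap_mat a b M i j = lap_mat a b M j i" for i j
    by (auto simp: lap_mat_def tridiag_def)
  have "(\<Sum>i\<in>{1..<M}. p i * lap a b M q i)
      = (\<Sum>i\<in>{1..<M}. \<Sum>j\<in>{1..<M}. p i * (lap_mat a b M i j * q j))"
    by (simp add: lap_def sum_distrib_left)
  also have "\<dots> = (\<Sum>j\<in>{1..<M}. \<Sum>i\<in>{1..<M}. p i * (lap_mat a b M i j * q j))"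
    by (rule sum.swap)
  also have "\<dots> = (\<Sum>j\<in>{1..<M}. q j * lap a b M p j)"
    by (simp add: lap_def sum_distrib_left sym[of _ _] mult.left_commute mult.commute)
  finally show ?thesis .
qed

lemma lap_has_real_derivative:
  assumes "\<And>i. i \<in> {1..<M} \<Longrightarrow> ((\<lambda>r. p r i) has_real_derivative p' i) (at r within S)"
  shows "((\<lambda>r. lap a b M (p r) i) has_real_derivative lap a b M p' i) (at r within S)"
  unfolding lap_def by (intro DERIV_sum DERIV_cmult assms)

text \<open>The charge, without the mesh weight that \<open>inner_h\<close> carries.\<close>

definition nsq :: "nat \<Rightarrow> (nat \<Rightarrow> real) \<Rightarrow> (nat \<Rightarrow> real) \<Rightarrow> real" where
  "nsq M p q = (\<Sum>i\<in>{1..<M}. (p i)\<^sup>2 + (q i)\<^sup>2)"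

lemma nsq_nonneg: "0 \<le> nsq M p q"
  by (auto simp: nsq_def intro!: sum_nonneg)

lemma nsq_has_real_derivative:
  assumes "\<And>i. i \<in> {1..<M} \<Longrightarrow> ((\<lambda>r. p r i) has_real_derivative p' i) (at r within S)"
    and "\<And>i. i \<in> {1..<M} \<Longrightarrow> ((\<lambda>r. q r i) has_real_derivative q' i) (at r within S)"
  shows "((\<lambda>r. nsq M (p r) (q r)) has_real_derivative
    (\<Sum>i\<in>{1..<M}. 2 * (p r i * p' i + q r i * q' i))) (at r within S)"
  unfolding nsq_def
  by (rule DERIV_sum, (rule derivative_eq_intros assms refl | assumption)+) (simp add: algebra_simps)

text \<open>The linear terms are kept exactly because they have mean zero at independent increments;
  everything else is estimated. With \<open>\<kappa>\<close> the squared norm of the perturbation,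
  Cauchy-Schwarz bounds the square of the linear part \<open>l\<close> by
  \<open>2 * (N * \<kappa>)\<close>. This leaves a second-order term weighted by
  \<open>N ^ 3\<close>, which feeds Gronwall, and a term \<open>\<kappa> ^ 4\<close> free of
  \<open>N\<close>.\<close>

lemma nsq4_perturb:
  fixes M :: nat and f p q :: "nat \<Rightarrow> real"
  defines "N \<equiv> nsq M p q"
  shows "nsq M (\<lambda>i. p i + f i * x) (\<lambda>i. q i - f i * y) ^ 4
    \<le> N ^ 4 + 8 * (N ^ 3 * (\<Sum>i\<in>{1..<M}. p i * f i) * x - N ^ 3 * (\<Sum>i\<in>{1..<M}. q i * f i) * y)
      + 2000 * (N ^ 3 * ((\<Sum>i\<in>{1..<M}. (f i)\<^sup>2) * (x\<^sup>2 + y\<^sup>2)) + ((\<Sum>i\<in>{1..<M}. (f i)\<^sup>2) * (x\<^sup>2 + y\<^sup>2)) ^ 4)"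
proof -
  define c where "c = (\<Sum>i\<in>{1..<M}. (f i)\<^sup>2)"
  define X where "X = (\<Sum>i\<in>{1..<M}. p i * f i)"
  define Y where "Y = (\<Sum>i\<in>{1..<M}. q i * f i)"
  define \<kappa> where "\<kappa> = c * (x\<^sup>2 + y\<^sup>2)"
  define l where "l = X * x - Y * y"
  define e where "e = 2 * l + \<kappa>"
  have N: "0 \<le> N" unfolding N_def by (rule nsq_nonneg)
  have c: "0 \<le> c" by (auto simp: c_def intro: sum_nonneg)
  have \<kappa>: "0 \<le> \<kappa>" using c by (simp add: \<kappa>_def)
  have eq: "nsq M (\<lambda>i. p i + f i * x) (\<lambda>i. q i - f i * y) = N + e"
    unfolding N_def nsq_def e_def l_def \<kappa>_def c_def X_def Y_def
    by (simp add: sum_distrib_left sum_distrib_right sum.distrib[symmetric] sum_subtractf[symmetric]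
      power2_eq_square algebra_simps)
  have "l\<^sup>2 \<le> 2 * (N * \<kappa>)"
  proof -
    have "X\<^sup>2 \<le> (\<Sum>i\<in>{1..<M}. (p i)\<^sup>2) * c" unfolding X_def c_def by (rule Cauchy_Schwarz_ineq_sum)
    also have "\<dots> \<le> N * c" unfolding N_def nsq_def by (intro mult_right_mono sum_mono c) auto
    finally have "X\<^sup>2 * x\<^sup>2 \<le> N * c * x\<^sup>2" by (intro mult_right_mono) auto
    moreover have "Y\<^sup>2 \<le> (\<Sum>i\<in>{1..<M}. (q i)\<^sup>2) * c" unfolding Y_def c_def by (rule Cauchy_Schwarz_ineq_sum)
    moreover have "(\<Sum>i\<in>{1..<M}. (q i)\<^sup>2) * c \<le> N * c"
      unfolding N_def nsq_def by (intro mult_right_mono sum_mono c) auto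
    ultimately have XY: "X\<^sup>2 * x\<^sup>2 \<le> N * c * x\<^sup>2" "Y\<^sup>2 * y\<^sup>2 \<le> N * c * y\<^sup>2"
      by (auto intro!: mult_right_mono)
    have "l\<^sup>2 \<le> 2 * (X\<^sup>2 * x\<^sup>2) + 2 * (Y\<^sup>2 * y\<^sup>2)"
      using zero_le_power2[of "X * x + Y * y"] unfolding l_def by (simp add: power2_eq_square algebra_simps)
    also have "\<dots> \<le> 2 * (N * c * x\<^sup>2) + 2 * (N * c * y\<^sup>2)" using XY by simp
    finally show ?thesis by (simp add: \<kappa>_def algebra_simps)
  qed
  moreover have "e\<^sup>2 \<le> 8 * l\<^sup>2 + 2 * \<kappa>\<^sup>2"
    using zero_le_power2[of "2 * l - \<kappa>"] unfolding e_def by (simp add: power2_eq_square algebra_simps)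
  ultimately have e2: "e\<^sup>2 \<le> 16 * (N * \<kappa>) + 2 * \<kappa>\<^sup>2" by linarith
  define w where "w = 16 * (N * \<kappa>) + 2 * \<kappa>\<^sup>2"
  have w: "0 \<le> w" using N \<kappa> by (simp add: w_def)
  have e4: "e ^ 4 \<le> w\<^sup>2"
  proof -
    have "e ^ 4 = (e\<^sup>2)\<^sup>2" by simp
    also have "\<dots> \<le> w\<^sup>2" using e2 by (intro power_mono) (auto simp: w_def)
    finally show ?thesis .
  qed
  have "(N + e) ^ 4 = N ^ 4 + 4 * N ^ 3 * e + 6 * N\<^sup>2 * e\<^sup>2 + 4 * N * e ^ 3 + e ^ 4"
    by (simp add: power2_eq_square power3_eq_cube power4_eq_xxxx algebra_simps)
  also have "\<dots> \<le> N ^ 4 + 4 * N ^ 3 * e + 8 * N\<^sup>2 * e\<^sup>2 + 3 * e ^ 4"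
  proof -
    \<comment> \<open>The term with \<open>e ^ 3\<close> has the sign of \<open>e\<close>; this
      square trades it for the even powers \<open>e^2\<close> and \<open>e^4\<close>.\<close>
    have "0 \<le> 2 * (N * e - e\<^sup>2)\<^sup>2" by simp
    also have "\<dots> = 2 * N\<^sup>2 * e\<^sup>2 - 4 * N * e ^ 3 + 2 * e ^ 4"
      by (simp add: power2_eq_square power3_eq_cube power4_eq_xxxx algebra_simps)
    finally show ?thesis by simp
  qed
  also have "\<dots> \<le> N ^ 4 + 4 * N ^ 3 * e + 8 * N\<^sup>2 * w + 3 * w\<^sup>2"
    using e2 e4 N by (intro add_mono mult_left_mono) (auto simp: w_def)
  \<comment> \<open>The coefficients are 132 = 4 + 8 * 16, 784 = 8 * 2 + 3 * 256, 192 = 3 * 64 and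
    12 = 3 * 4.\<close>
  also have "\<dots> = N ^ 4 + 8 * (N ^ 3 * l) + 132 * (N ^ 3 * \<kappa>) + 784 * (N\<^sup>2 * \<kappa>\<^sup>2) + 192 * (N * \<kappa> ^ 3) + 12 * \<kappa> ^ 4"
    by (simp add: e_def w_def power2_eq_square power3_eq_cube power4_eq_xxxx algebra_simps)
  also have "\<dots> \<le> N ^ 4 + 8 * (N ^ 3 * l) + 2000 * (N ^ 3 * \<kappa> + \<kappa> ^ 4)"
  proof -
    \<comment> \<open>Each mixed monomial is at most the larger of \<open>N ^ 3 * \<kappa>\<close>
      and \<open>\<kappa> ^ 4\<close>. The resulting sums 132 + 784 + 192 and 784 + 192 + 12 stay
      below 2000.\<close>
    have "N\<^sup>2 * \<kappa>\<^sup>2 \<le> N ^ 3 * \<kappa> + \<kappa> ^ 4 \<and> N * \<kappa> ^ 3 \<le> N ^ 3 * \<kappa> + \<kappa> ^ 4"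
    proof (cases "N \<le> \<kappa>")
      case True
      have "N\<^sup>2 * \<kappa>\<^sup>2 \<le> \<kappa>\<^sup>2 * \<kappa>\<^sup>2" "N * \<kappa> ^ 3 \<le> \<kappa> * \<kappa> ^ 3"
        by (intro mult_right_mono power_mono True N zero_le_power \<kappa>)+
      moreover have "0 \<le> N ^ 3 * \<kappa>" using N \<kappa> by simp
      moreover have "\<kappa>\<^sup>2 * \<kappa>\<^sup>2 = \<kappa> ^ 4" "\<kappa> * \<kappa> ^ 3 = \<kappa> ^ 4"
        by (simp_all add: eval_nat_numeral)
      ultimately show ?thesis by linarith
    next
      case False
      then have le: "\<kappa> \<le> N" by simp
      have "N\<^sup>2 * \<kappa>\<^sup>2 = (N\<^sup>2 * \<kappa>) * \<kappa>" by (simp add: power2_eq_square)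
      also have "\<dots> \<le> (N\<^sup>2 * \<kappa>) * N" using le N \<kappa> by (intro mult_left_mono) auto
      also have "\<dots> = N ^ 3 * \<kappa>" by (simp add: power2_eq_square power3_eq_cube)
      finally have 1: "N\<^sup>2 * \<kappa>\<^sup>2 \<le> N ^ 3 * \<kappa>" .
      have "N * \<kappa> ^ 3 = (N * \<kappa>) * \<kappa>\<^sup>2" by (simp add: power2_eq_square power3_eq_cube)
      also have "\<dots> \<le> (N * \<kappa>) * N\<^sup>2" using le N \<kappa> by (intro mult_left_mono power_mono) auto
      also have "\<dots> = N ^ 3 * \<kappa>" by (simp add: power2_eq_square power3_eq_cube)
      finally have 2: "N * \<kappa> ^ 3 \<le> N ^ 3 * \<kappa>" .
      have "0 \<le> \<kappa> ^ 4" using \<kappa> by simp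
      with 1 2 show ?thesis by (auto intro: add_increasing2)
    qed
    moreover have "0 \<le> N ^ 3 * \<kappa>" "0 \<le> \<kappa> ^ 4" using N \<kappa> by auto
    moreover have "x + 132 * A + 784 * B + 192 * C + 12 * D \<le> x + 2000 * (A + D)"
      if "B \<le> A + D \<and> C \<le> A + D" "0 \<le> A" "0 \<le> D" for x A B C D :: real
      using that(2,3) that(1)[THEN conjunct1] that(1)[THEN conjunct2] by simp
    ultimately show ?thesis by blast
  qed
  finally show ?thesis
    unfolding eq by (simp add: l_def X_def Y_def \<kappa>_def c_def algebra_simps)
qed

lemma norm_h_sq:
  assumes "0 \<le> mesh a b M"
  shows "(norm_h a b M f)\<^sup>2 = inner_h a b M f f"
  unfolding norm_h_def inner_h_def
  by (intro real_sqrt_pow2 mult_nonneg_nonneg[OF assms] sum_nonneg zero_le_square)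

lemma energy_eq_sum:
  assumes "0 \<le> mesh a b M"
  shows "energy a b M P Q U V = mesh a b M * (\<Sum>i\<in>{1..<M}.
    2 * (U i * ((P i)\<^sup>2 + (Q i)\<^sup>2)) - (U i)\<^sup>2 - 4 * (V i)\<^sup>2 + U i * lap a b M U i
      + 2 * (P i * lap a b M P i) + 2 * (Q i * lap a b M Q i))"
proof -
  have ring: "2 * (m * A) - m * B - 4 * (m * C) + m * D + 2 * (m * E) + 2 * (m * G)
      = m * (2 * A - B - 4 * C + D + 2 * E + 2 * G)" for m A B C D E G :: real
    by (simp add: algebra_simps)
  show ?thesis
    unfolding energy_def norm_h_sq[OF assms] inner_h_def cmul_def ring
    by (simp add: sum.distrib sum_subtractf sum_distrib_left power2_eq_square)
qed

text \<open>The noise does not act on \<open>U\<close>, and the energy is quadratic in the other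
  variables, so the expansion is exact. The last two lines, with variances in place of the squares,
  are the source of all three correction terms in the theorem.\<close>

lemma energy_perturb:
  assumes h: "0 \<le> mesh a b M"
  shows "energy a b M (\<lambda>i. P i + f i * x) (\<lambda>i. Q i - f i * y) U (\<lambda>i. V i + g i * z)
    = energy a b M P Q U V
      + mesh a b M * (\<Sum>i\<in>{1..<M}. 4 * (U i * P i * f i) + 4 * (f i * lap a b M P i)) * x
      - mesh a b M * (\<Sum>i\<in>{1..<M}. 4 * (U i * Q i * f i) + 4 * (f i * lap a b M Q i)) * y
      - mesh a b M * (\<Sum>i\<in>{1..<M}. 8 * (V i * g i)) * z
      + mesh a b M * (\<Sum>i\<in>{1..<M}. 2 * (U i * (f i)\<^sup>2) + 2 * (f i * lap a b M f i)) * (x\<^sup>2 + y\<^sup>2)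
      - mesh a b M * (\<Sum>i\<in>{1..<M}. 4 * (g i)\<^sup>2) * z\<^sup>2"
proof -
  have s1: "(\<Sum>i\<in>{1..<M}. P i * lap a b M f i) = (\<Sum>i\<in>{1..<M}. f i * lap a b M P i)"
    and s2: "(\<Sum>i\<in>{1..<M}. Q i * lap a b M f i) = (\<Sum>i\<in>{1..<M}. f i * lap a b M Q i)"
    by (rule lap_symmetric)+
  have c1: "(\<Sum>i\<in>{1..<M}. 4 * (U i * P i * f i) + 4 * (f i * lap a b M P i))
      = (\<Sum>i\<in>{1..<M}. 4 * (U i * P i * f i) + 2 * (P i * lap a b M f i) + 2 * (f i * lap a b M P i))"
    by (simp add: sum.distrib sum_distrib_left[symmetric] s1[simplified])
  have c2: "(\<Sum>i\<in>{1..<M}. 4 * (U i * Q i * f i) + 4 * (f i * lap a b M Q i))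
      = (\<Sum>i\<in>{1..<M}. 4 * (U i * Q i * f i) + 2 * (Q i * lap a b M f i) + 2 * (f i * lap a b M Q i))"
    by (simp add: sum.distrib sum_distrib_left[symmetric] s2[simplified])
  show ?thesis
    unfolding energy_eq_sum[OF h] lap_shift lap_shift_minus c1 c2
    unfolding sum_distrib_left sum_distrib_right sum.distrib[symmetric] sum_subtractf[symmetric]
    by (intro sum.cong refl) (simp add: power2_eq_square algebra_simps)
qed

text \<open>Symmetry of the discrete Laplacian moves it off the velocities, so that the right-hand
  side pairs each velocity with the corresponding component of the gradient.\<close>

lemma energy_has_real_derivative:
  assumes h: "0 \<le> mesh a b M"
    and p: "\<And>i. i \<in> {1..<M} \<Longrightarrow> ((\<lambda>r. p r i) has_real_derivative p' i) (at r within S)"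
    and q: "\<And>i. i \<in> {1..<M} \<Longrightarrow> ((\<lambda>r. q r i) has_real_derivative q' i) (at r within S)"
    and u: "\<And>i. i \<in> {1..<M} \<Longrightarrow> ((\<lambda>r. u r i) has_real_derivative u' i) (at r within S)"
    and v: "\<And>i. i \<in> {1..<M} \<Longrightarrow> ((\<lambda>r. v r i) has_real_derivative v' i) (at r within S)"
  shows "((\<lambda>r. energy a b M (p r) (q r) (u r) (v r)) has_real_derivative mesh a b M * (\<Sum>i\<in>{1..<M}.
    4 * p' i * (u r i * p r i + lap a b M (p r) i) + 4 * q' i * (u r i * q r i + lap a b M (q r) i)
    - 8 * v r i * v' i + 2 * u' i * ((p r i)\<^sup>2 + (q r i)\<^sup>2 - u r i + lap a b M (u r) i))) (at r within S)"
proof -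
  note lp = lap_has_real_derivative[of M p p' r S a b, OF p]
  note lq = lap_has_real_derivative[of M q q' r S a b, OF q]
  note lu = lap_has_real_derivative[of M u u' r S a b, OF u]
  have s1: "(\<Sum>i\<in>{1..<M}. p r i * lap a b M p' i) = (\<Sum>i\<in>{1..<M}. p' i * lap a b M (p r) i)"
    and s2: "(\<Sum>i\<in>{1..<M}. q r i * lap a b M q' i) = (\<Sum>i\<in>{1..<M}. q' i * lap a b M (q r) i)"
    and s3: "(\<Sum>i\<in>{1..<M}. u r i * lap a b M u' i) = (\<Sum>i\<in>{1..<M}. u' i * lap a b M (u r) i)"
    by (rule lap_symmetric)+
  have "((\<lambda>r. energy a b M (p r) (q r) (u r) (v r)) has_real_derivative mesh a b M * (\<Sum>i\<in>{1..<M}.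
    2 * (u' i * ((p r i)\<^sup>2 + (q r i)\<^sup>2) + u r i * (2 * p r i * p' i + 2 * q r i * q' i))
    - 2 * u r i * u' i - 8 * v r i * v' i + (u' i * lap a b M (u r) i + u r i * lap a b M u' i)
    + 2 * (p' i * lap a b M (p r) i + p r i * lap a b M p' i)
    + 2 * (q' i * lap a b M (q r) i + q r i * lap a b M q' i))) (at r within S)"
    unfolding energy_eq_sum[OF h]
    by (rule DERIV_cmult, rule DERIV_sum, (rule derivative_eq_intros p q u v lp lq lu refl | assumption)+)
      (simp add: algebra_simps)
  also have "(\<Sum>i\<in>{1..<M}.
    2 * (u' i * ((p r i)\<^sup>2 + (q r i)\<^sup>2) + u r i * (2 * p r i * p' i + 2 * q r i * q' i))
    - 2 * u r i * u' i - 8 * v r i * v' i + (u' i * lap a b M (u r) i + u r i * lap a b M u' i)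
    + 2 * (p' i * lap a b M (p r) i + p r i * lap a b M p' i)
    + 2 * (q' i * lap a b M (q r) i + q r i * lap a b M q' i))
    = (\<Sum>i\<in>{1..<M}. 2 * (u' i * ((p r i)\<^sup>2 + (q r i)\<^sup>2) + u r i * (2 * p r i * p' i + 2 * q r i * q' i))
    - 2 * u r i * u' i - 8 * v r i * v' i + u' i * lap a b M (u r) i
    + 2 * (p' i * lap a b M (p r) i)
    + 2 * (q' i * lap a b M (q r) i))
    + (\<Sum>i\<in>{1..<M}. u r i * lap a b M u' i) + 2 * (\<Sum>i\<in>{1..<M}. p r i * lap a b M p' i)
    + 2 * (\<Sum>i\<in>{1..<M}. q r i * lap a b M q' i)"
    unfolding sum_distrib_left sum.distrib[symmetric] by (intro sum.cong refl) (simp add: algebra_simps)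
  also have "\<dots> = (\<Sum>i\<in>{1..<M}.
    4 * p' i * (u r i * p r i + lap a b M (p r) i) + 4 * q' i * (u r i * q r i + lap a b M (q r) i)
    - 8 * v r i * v' i + 2 * u' i * ((p r i)\<^sup>2 + (q r i)\<^sup>2 - u r i + lap a b M (u r) i))"
    unfolding s1 s2 s3 sum_distrib_left sum.distrib[symmetric]
    by (intro sum.cong refl) (simp add: algebra_simps)
  finally show ?thesis .
qed

section \<open>Bounds for the drift terms\<close>

text \<open>One summand of the one-step errors. At a Brownian increment over a time step \<open>h\<close> its expectation is
  of order \<open>sqrt h\<close>.\<close>

definition err :: "real \<Rightarrow> real" where
  "err x = \<bar>x\<bar> + x ^ 8"

lemma err_nonneg [simp]: "0 \<le> err x"
  by (simp add: err_def)

text \<open>A polynomial of degree 7 without constant term is of order m for small m and below order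
  m^8 for large m, where m is the largest of the three arguments. The shape comes from the
  derivative of \<open>N ^ 4\<close>: a cubed charge, of degree 6 in the increments, times a linear
  factor.\<close>

lemma monomial_le_err:
  assumes "x \<ge> 0" "y \<ge> 0" "z \<ge> 0"
  shows "(x + y + z) * (1 + (x + y + z)) ^ 6 \<le> 2 * 9 ^ 8 * (err x + err y + err z)"
proof -
  define m where "m = max x (max y z)"
  have m: "0 \<le> m" using assms by (auto simp: m_def)
  have le: "(x + y + z) * (1 + (x + y + z)) ^ 6 \<le> (3 * m) * (1 + 3 * m) ^ 6"
    using assms by (intro mult_mono power_mono) (auto simp: m_def)
  have "(3 * m) * (1 + 3 * m) ^ 6 \<le> 2 * 9 ^ 8 * (m + m ^ 8)"
  proof (cases "m \<le> 1")
    case True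
    have "(3 * m) * (1 + 3 * m) ^ 6 \<le> (3 * m) * 4 ^ 6"
      using True m by (intro mult_left_mono power_mono) auto
    also have "\<dots> \<le> 2 * 9 ^ 8 * m" using m by simp
    also have "\<dots> \<le> 2 * 9 ^ 8 * (m + m ^ 8)" using m by simp
    finally show ?thesis .
  next
    case False
    have "(3 * m) * (1 + 3 * m) ^ 6 \<le> (3 * m) * (4 * m) ^ 6"
      using False m by (intro mult_left_mono power_mono) auto
    also have "\<dots> = 3 * 4 ^ 6 * m ^ 7" by (simp add: power_mult_distrib eval_nat_numeral)
    also have "\<dots> \<le> 3 * 4 ^ 6 * m ^ 8"
      using False by (intro mult_left_mono power_increasing) auto
    also have "\<dots> \<le> 2 * 9 ^ 8 * m ^ 8" using m by (intro mult_right_mono) auto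
    also have "\<dots> \<le> 2 * 9 ^ 8 * (m + m ^ 8)" using m by simp
    finally show ?thesis .
  qed
  moreover have "m + m ^ 8 \<le> err x + err y + err z"
  proof -
    have "m + m ^ 8 = err m" using m by (simp add: err_def)
    moreover have "m \<in> {x, y, z}" by (auto simp: m_def max_def)
    ultimately show ?thesis using err_nonneg[of x] err_nonneg[of y] err_nonneg[of z] by auto
  qed
  then have "2 * 9 ^ 8 * (m + m ^ 8) \<le> 2 * 9 ^ 8 * (err x + err y + err z)"
    by (intro mult_left_mono) auto
  ultimately show ?thesis using le by linarith
qed

lemma err_abs: "err \<bar>x\<bar> = err x"
  by (simp add: err_def)

lemma bigo_cmult: "f \<in> O[F](g) \<Longrightarrow> (\<lambda>z. c * f z :: real) \<in> O[F](g)"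
  by (cases "c = 0") simp_all

lemma bigo_uminus: "f \<in> O[F](g) \<Longrightarrow> (\<lambda>z. - f z :: real) \<in> O[F](g)"
  by simp

lemmas bigo_1_intros = bigo_const bigo_cmult bigo_uminus sum_in_bigo big_sum_in_bigo
  landau_o.big.mult_in_1

locale kgs_data =
  fixes a b C1 C2 T :: real and M :: nat and e1 e2 P0 Q0 U0 V0 :: "nat \<Rightarrow> real"
  assumes ab: "a < b" and T: "0 < T"
begin

abbreviation "I \<equiv> {1..<M}"
abbreviation "h \<equiv> mesh a b M"
abbreviation "A \<equiv> lap a b M"

definition "f1 i = C1 * e1 i"
definition "f2 i = C2 / 2 * e2 i"

lemma h_nonneg: "0 \<le> h"
  using ab by (simp add: mesh_def)

definition dP where "dP Q U i = - (A Q i + U i * Q i)" for Q U :: "nat \<Rightarrow> real"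
definition dQ where "dQ P U i = A P i + U i * P i" for P U :: "nat \<Rightarrow> real"
definition dV where "dV P Q U i = 1 / 2 * (A U i - U i + P i * P i + Q i * Q i)" for P Q U :: "nat \<Rightarrow> real"

text \<open>The filter \<open>F\<close> is left open: along a principal filter such a statement is a
  uniform bound over a set of states.\<close>

lemma drift_bigo:
  fixes P Q U V :: "'z \<Rightarrow> nat \<Rightarrow> real"
  assumes P: "\<And>i. i \<in> I \<Longrightarrow> (\<lambda>z. P z i) \<in> O[F](\<lambda>_. 1)"
    and Q: "\<And>i. i \<in> I \<Longrightarrow> (\<lambda>z. Q z i) \<in> O[F](\<lambda>_. 1)"
    and U: "\<And>i. i \<in> I \<Longrightarrow> (\<lambda>z. U z i) \<in> O[F](\<lambda>_. 1)" and i: "i \<in> I"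
  shows "(\<lambda>z. dP (Q z) (U z) i) \<in> O[F](\<lambda>_. 1)" "(\<lambda>z. dQ (P z) (U z) i) \<in> O[F](\<lambda>_. 1)"
    "(\<lambda>z. dV (P z) (Q z) (U z) i) \<in> O[F](\<lambda>_. 1)"
  unfolding dP_def dQ_def dV_def lap_def by (intro bigo_1_intros P Q U i | assumption)+

text \<open>The chain rule for \<open>N ^ 4\<close>, with the drift evaluated at the state and the
  gradient at the state shifted by the noise still to come.\<close>

definition "nsq4_rate P Q U x y = 4 * nsq M (\<lambda>i. P i + f1 i * x) (\<lambda>i. Q i - f1 i * y) ^ 3 *
  (\<Sum>i\<in>I. 2 * ((P i + f1 i * x) * dP Q U i + (Q i - f1 i * y) * dQ P U i))"

text \<open>Conservation of charge: at zero shift the terms with \<open>U\<close> cancel in each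
  component, and those with \<open>A\<close> cancel in the sum by symmetry. What is left carries a
  factor \<open>x\<close> or \<open>y\<close>.\<close>

lemma nsq4_rate_eq: "nsq4_rate P Q U x y = 4 * nsq M (\<lambda>i. P i + f1 i * x) (\<lambda>i. Q i - f1 i * y) ^ 3 *
  (\<Sum>i\<in>I. 2 * f1 i * (dP Q U i * x - dQ P U i * y))"
proof -
  have "(\<Sum>i\<in>I. 2 * ((P i + f1 i * x) * dP Q U i + (Q i - f1 i * y) * dQ P U i))
    = (\<Sum>i\<in>I. 2 * f1 i * (dP Q U i * x - dQ P U i * y))
      + 2 * ((\<Sum>i\<in>I. Q i * A P i) - (\<Sum>i\<in>I. P i * A Q i))"
    unfolding sum_distrib_left sum.distrib[symmetric] sum_subtractf[symmetric]
    by (intro sum.cong refl) (simp add: dP_def dQ_def algebra_simps)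
  then show ?thesis
    using lap_symmetric[where ?a = a and ?b = b and M = M and p = Q and q = P] by (simp add: nsq4_rate_def)
qed

lemma nsq4_rate_bigo:
  fixes P Q U :: "'z \<Rightarrow> nat \<Rightarrow> real"
  assumes P: "\<And>i. i \<in> I \<Longrightarrow> (\<lambda>z. P z i) \<in> O[F](\<lambda>_. 1)"
    and Q: "\<And>i. i \<in> I \<Longrightarrow> (\<lambda>z. Q z i) \<in> O[F](\<lambda>_. 1)"
    and U: "\<And>i. i \<in> I \<Longrightarrow> (\<lambda>z. U z i) \<in> O[F](\<lambda>_. 1)"
    and x: "x \<in> O[F](D)" and y: "y \<in> O[F](D)" and D: "\<And>z. 0 \<le> D z"
  shows "(\<lambda>z. nsq4_rate (P z) (Q z) (U z) (x z) (y z)) \<in> O[F](\<lambda>z. D z * (1 + D z) ^ 6)"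
proof -
  have one: "(\<lambda>_. 1) \<in> O[F](\<lambda>z. 1 + D z)" and Dw: "D \<in> O[F](\<lambda>z. 1 + D z)"
    using D by (auto intro!: bigoI[of _ 1] always_eventually)
  have "(\<lambda>z. nsq M (\<lambda>i. P z i + f1 i * x z) (\<lambda>i. Q z i - f1 i * y z)) \<in> O[F](\<lambda>z. (1 + D z)\<^sup>2)"
    unfolding nsq_def
    by (intro big_sum_in_bigo sum_in_bigo landau_o.big_power bigo_cmult
        landau_o.big_trans[OF P one] landau_o.big_trans[OF Q one]
        landau_o.big_trans[OF x Dw] landau_o.big_trans[OF y Dw])
  then have "(\<lambda>z. nsq M (\<lambda>i. P z i + f1 i * x z) (\<lambda>i. Q z i - f1 i * y z) ^ 3)
      \<in> O[F](\<lambda>z. ((1 + D z)\<^sup>2) ^ 3)"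
    by (rule landau_o.big_power)
  then have 1: "(\<lambda>z. 4 * nsq M (\<lambda>i. P z i + f1 i * x z) (\<lambda>i. Q z i - f1 i * y z) ^ 3)
      \<in> O[F](\<lambda>z. (1 + D z) ^ 6)"
    by (intro bigo_cmult) (simp add: power_mult[symmetric])
  have mx: "(\<lambda>z. g z * x z) \<in> O[F](D)" and my: "(\<lambda>z. g z * y z) \<in> O[F](D)"
    if "g \<in> O[F](\<lambda>_. 1)" for g :: "'z \<Rightarrow> real"
    using landau_o.big.mult[OF that x] landau_o.big.mult[OF that y] by simp_all
  have 2: "(\<lambda>z. \<Sum>i\<in>I. 2 * f1 i * (dP (Q z) (U z) i * x z - dQ (P z) (U z) i * y z)) \<in> O[F](D)"
    by (intro big_sum_in_bigo bigo_cmult sum_in_bigo mx my drift_bigo[OF P Q U] | assumption)+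
  show ?thesis
    unfolding nsq4_rate_eq using landau_o.big.mult[OF 1 2] by (simp only: mult.commute)
qed

text \<open>The derivative of the energy along the drift at \<open>(P, Q, U, V)\<close>, with the gradient taken at a
  point shifted by the noise increments. The linear and quadratic shape in \<open>x, y, z\<close> found below
  contains the conservation of energy: the expression vanishes for \<open>x = y = z = 0\<close>.\<close>

definition energy_rate where
  "energy_rate P Q U V x y z = h * (\<Sum>i\<in>I.
    4 * dP Q U i * (U i * (P i + f1 i * x) + A (\<lambda>i. P i + f1 i * x) i)
    + 4 * dQ P U i * (U i * (Q i - f1 i * y) + A (\<lambda>i. Q i - f1 i * y) i)
    - 8 * (V i + f2 i * z) * dV P Q U i
    + 2 * (2 * V i) * ((P i + f1 i * x)\<^sup>2 + (Q i - f1 i * y)\<^sup>2 - U i + A U i))"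

text \<open>Since \<open>A P + U P\<close> is \<open>dQ\<close> and \<open>A Q + U Q\<close> is
  \<open>- dP\<close>, the unshifted terms of \<open>P\<close> and \<open>Q\<close> cancel each
  other. The last bracket of \<open>energy_rate\<close> is \<open>2 * dV\<close> at zero shift and
  so cancels the term with \<open>- 8 * V * dV\<close>.\<close>

lemma energy_rate_eq:
  "energy_rate P Q U V x y z = h * (\<Sum>i\<in>I.
    4 * dP Q U i * (U i * f1 i + A f1 i) * x - 4 * dQ P U i * (U i * f1 i + A f1 i) * y
    - 8 * f2 i * dV P Q U i * z
    + 4 * V i * (2 * P i * f1 i * x + (f1 i)\<^sup>2 * x\<^sup>2 - 2 * Q i * f1 i * y + (f1 i)\<^sup>2 * y\<^sup>2))"
  unfolding energy_rate_def lap_shift lap_shift_minus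
  by (intro arg_cong[where f = "\<lambda>s. h * s"] sum.cong refl)
    (simp add: dP_def dQ_def dV_def power2_eq_square algebra_simps)

text \<open>The true order is \<open>D + D^2\<close>; it is weakened to the order found for
  \<open>N ^ 4\<close>, so that one error function serves both.\<close>

lemma energy_rate_bigo:
  fixes P Q U V :: "'z \<Rightarrow> nat \<Rightarrow> real"
  assumes P: "\<And>i. i \<in> I \<Longrightarrow> (\<lambda>z. P z i) \<in> O[F](\<lambda>_. 1)"
    and Q: "\<And>i. i \<in> I \<Longrightarrow> (\<lambda>z. Q z i) \<in> O[F](\<lambda>_. 1)"
    and U: "\<And>i. i \<in> I \<Longrightarrow> (\<lambda>z. U z i) \<in> O[F](\<lambda>_. 1)"
    and V: "\<And>i. i \<in> I \<Longrightarrow> (\<lambda>z. V z i) \<in> O[F](\<lambda>_. 1)"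
    and x: "x \<in> O[F](D)" and y: "y \<in> O[F](D)" and z: "z \<in> O[F](D)" and D: "\<And>z. 0 \<le> D z"
  shows "(\<lambda>\<zeta>. energy_rate (P \<zeta>) (Q \<zeta>) (U \<zeta>) (V \<zeta>) (x \<zeta>) (y \<zeta>) (z \<zeta>)) \<in> O[F](\<lambda>z. D z * (1 + D z) ^ 6)"
proof -
  have one: "(\<lambda>_. 1) \<in> O[F](\<lambda>z. 1 + D z)" and Dw: "D \<in> O[F](\<lambda>z. 1 + D z)"
    using D by (auto intro!: bigoI[of _ 1] always_eventually)
  have D1: "D \<in> O[F](\<lambda>z. D z * (1 + D z) ^ 6)"
  proof -
    have "D z \<le> D z * (1 + D z) ^ 6" for z
      using D[of z] one_le_power[of "1 + D z" 6] by (simp add: mult_le_cancel_left1)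
    then show ?thesis using D by (intro bigoI[of _ 1] always_eventually) auto
  qed
  have D2: "(\<lambda>z. (D z)\<^sup>2) \<in> O[F](\<lambda>z. D z * (1 + D z) ^ 6)"
  proof -
    have "(D z)\<^sup>2 \<le> D z * (1 + D z) ^ 6" for z
    proof -
      have "D z \<le> 1 + D z" by simp
      also have "\<dots> \<le> (1 + D z) ^ 6" using D[of z] power_increasing[of 1 6 "1 + D z"] by simp
      finally show ?thesis using D[of z] by (simp add: power2_eq_square mult_left_mono)
    qed
    then show ?thesis using D by (intro bigoI[of _ 1] always_eventually) auto
  qed
  have mult: "(\<lambda>z. g z * k z) \<in> O[F](l)"
    if "g \<in> O[F](\<lambda>_. 1)" "k \<in> O[F](l)" for g k l :: "'z \<Rightarrow> real"
    using landau_o.big.mult[OF that] by simp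
  note lin = landau_o.big_trans[OF x D1] landau_o.big_trans[OF y D1] landau_o.big_trans[OF z D1]
    landau_o.big_trans[OF landau_o.big_power[OF x, of 2] D2]
    landau_o.big_trans[OF landau_o.big_power[OF y, of 2] D2]
  have b: "(\<lambda>\<zeta>. 4 * dP (Q \<zeta>) (U \<zeta>) i * (U \<zeta> i * f1 i + A f1 i)) \<in> O[F](\<lambda>_. 1)"
    "(\<lambda>\<zeta>. 4 * dQ (P \<zeta>) (U \<zeta>) i * (U \<zeta> i * f1 i + A f1 i)) \<in> O[F](\<lambda>_. 1)"
    "(\<lambda>\<zeta>. 8 * f2 i * dV (P \<zeta>) (Q \<zeta>) (U \<zeta>) i) \<in> O[F](\<lambda>_. 1)"
    "(\<lambda>\<zeta>. 4 * V \<zeta> i) \<in> O[F](\<lambda>_. 1)"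
    "(\<lambda>\<zeta>. 2 * P \<zeta> i * f1 i) \<in> O[F](\<lambda>_. 1)" "(\<lambda>\<zeta>. 2 * Q \<zeta> i * f1 i) \<in> O[F](\<lambda>_. 1)"
    if "i \<in> I" for i
    by (intro bigo_1_intros drift_bigo[OF P Q U] P Q U V that | assumption)+
  show ?thesis
    unfolding energy_rate_eq
    by (intro bigo_cmult big_sum_in_bigo sum_in_bigo mult b lin | assumption)+
qed

definition "comp_le R P Q U V \<longleftrightarrow> (\<forall>i\<in>I. \<bar>P i\<bar> \<le> R \<and> \<bar>Q i\<bar> \<le> R \<and> \<bar>U i\<bar> \<le> R \<and> \<bar>V i\<bar> \<le> R)"
  for R :: real and P Q U V :: "nat \<Rightarrow> real"

text \<open>Landau symbols along the principal filter of the states bounded by \<open>R\<close>,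
  with unrestricted increments, are uniform bounds. Their calculus supplies constants that depend on
  \<open>R\<close> and the data only, hence are the same for all paths and times.\<close>

lemma rate_bounds:
  obtains K where "0 \<le> K"
    "\<And>P Q U V x y z. comp_le R P Q U V \<Longrightarrow> \<bar>energy_rate P Q U V x y z\<bar> \<le> K * (err x + err y + err z)"
    "\<And>P Q U V x y z. comp_le R P Q U V \<Longrightarrow> \<bar>nsq4_rate P Q U x y\<bar> \<le> K * (err x + err y + err z)"
    "\<And>P Q U V i. comp_le R P Q U V \<Longrightarrow> i \<in> I \<Longrightarrow>
      \<bar>dP Q U i\<bar> \<le> K \<and> \<bar>dQ P U i\<bar> \<le> K \<and> \<bar>dV P Q U i\<bar> \<le> K"
proof -
  define S where "S = {(P, Q, U, V, x :: real, y :: real, z :: real). comp_le R P Q U V}"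
  define F where "F = principal S"
  define pP where "pP = (\<lambda>(P :: nat \<Rightarrow> real, Q :: nat \<Rightarrow> real, U :: nat \<Rightarrow> real, V :: nat \<Rightarrow> real, x :: real, y :: real, z :: real). P)"
  define pQ where "pQ = (\<lambda>(P :: nat \<Rightarrow> real, Q :: nat \<Rightarrow> real, U :: nat \<Rightarrow> real, V :: nat \<Rightarrow> real, x :: real, y :: real, z :: real). Q)"
  define pU where "pU = (\<lambda>(P :: nat \<Rightarrow> real, Q :: nat \<Rightarrow> real, U :: nat \<Rightarrow> real, V :: nat \<Rightarrow> real, x :: real, y :: real, z :: real). U)"
  define pV where "pV = (\<lambda>(P :: nat \<Rightarrow> real, Q :: nat \<Rightarrow> real, U :: nat \<Rightarrow> real, V :: nat \<Rightarrow> real, x :: real, y :: real, z :: real). V)"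
  define px where "px = (\<lambda>(P :: nat \<Rightarrow> real, Q :: nat \<Rightarrow> real, U :: nat \<Rightarrow> real, V :: nat \<Rightarrow> real, x :: real, y :: real, z :: real). x)"
  define py where "py = (\<lambda>(P :: nat \<Rightarrow> real, Q :: nat \<Rightarrow> real, U :: nat \<Rightarrow> real, V :: nat \<Rightarrow> real, x :: real, y :: real, z :: real). y)"
  define pz where "pz = (\<lambda>(P :: nat \<Rightarrow> real, Q :: nat \<Rightarrow> real, U :: nat \<Rightarrow> real, V :: nat \<Rightarrow> real, x :: real, y :: real, z :: real). z)"
  note p_defs = pP_def pQ_def pU_def pV_def px_def py_def pz_def
  define D where "D = (\<lambda>\<zeta>. \<bar>px \<zeta>\<bar> + \<bar>py \<zeta>\<bar> + \<bar>pz \<zeta>\<bar>)"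
  have ev: "eventually Pr F \<longleftrightarrow> (\<forall>z\<in>S. Pr z)" for Pr by (simp add: F_def eventually_principal)
  have b: "(\<lambda>\<zeta>. pP \<zeta> i) \<in> O[F](\<lambda>_. 1)" "(\<lambda>\<zeta>. pQ \<zeta> i) \<in> O[F](\<lambda>_. 1)"
    "(\<lambda>\<zeta>. pU \<zeta> i) \<in> O[F](\<lambda>_. 1)" "(\<lambda>\<zeta>. pV \<zeta> i) \<in> O[F](\<lambda>_. 1)" if "i \<in> I" for i
    using that by (auto intro!: bigoI[of _ R] simp: ev S_def p_defs comp_le_def)
  have d: "px \<in> O[F](D)" "py \<in> O[F](D)" "pz \<in> O[F](D)" and D: "0 \<le> D \<zeta>" for \<zeta>
    by (auto intro!: bigoI[of _ 1] simp: D_def)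
  have "(\<lambda>\<zeta>. energy_rate (pP \<zeta>) (pQ \<zeta>) (pU \<zeta>) (pV \<zeta>) (px \<zeta>) (py \<zeta>) (pz \<zeta>))
      \<in> O[F](\<lambda>\<zeta>. D \<zeta> * (1 + D \<zeta>) ^ 6)"
    by (intro energy_rate_bigo b d D | assumption)+
  then obtain K1 where "0 < K1"
    and K1: "\<forall>\<zeta>\<in>S. \<bar>energy_rate (pP \<zeta>) (pQ \<zeta>) (pU \<zeta>) (pV \<zeta>) (px \<zeta>) (py \<zeta>) (pz \<zeta>)\<bar>
      \<le> K1 * \<bar>D \<zeta> * (1 + D \<zeta>) ^ 6\<bar>"
    by (auto elim!: landau_o.bigE simp: ev)
  have "(\<lambda>\<zeta>. nsq4_rate (pP \<zeta>) (pQ \<zeta>) (pU \<zeta>) (px \<zeta>) (py \<zeta>)) \<in> O[F](\<lambda>\<zeta>. D \<zeta> * (1 + D \<zeta>) ^ 6)"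
    by (intro nsq4_rate_bigo b d D | assumption)+
  then obtain K2 where "0 < K2"
    and K2: "\<forall>\<zeta>\<in>S. \<bar>nsq4_rate (pP \<zeta>) (pQ \<zeta>) (pU \<zeta>) (px \<zeta>) (py \<zeta>)\<bar> \<le> K2 * \<bar>D \<zeta> * (1 + D \<zeta>) ^ 6\<bar>"
    by (auto elim!: landau_o.bigE simp: ev)
  have "(\<lambda>\<zeta>. \<Sum>i\<in>I. \<bar>dP (pQ \<zeta>) (pU \<zeta>) i\<bar> + \<bar>dQ (pP \<zeta>) (pU \<zeta>) i\<bar> + \<bar>dV (pP \<zeta>) (pQ \<zeta>) (pU \<zeta>) i\<bar>)
      \<in> O[F](\<lambda>_. 1)"
    by (intro big_sum_in_bigo sum_in_bigo landau_o.big.abs_in_iff[THEN iffD2]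
        drift_bigo[where P = pP and Q = pQ and U = pU] b | assumption)+
  then obtain K3 where "0 < K3" and K3: "\<forall>\<zeta>\<in>S. \<bar>\<Sum>i\<in>I. \<bar>dP (pQ \<zeta>) (pU \<zeta>) i\<bar>
      + \<bar>dQ (pP \<zeta>) (pU \<zeta>) i\<bar> + \<bar>dV (pP \<zeta>) (pQ \<zeta>) (pU \<zeta>) i\<bar>\<bar> \<le> K3"
    by (auto elim!: landau_o.bigE simp: ev)
  define K where "K = K1 * (2 * 9 ^ 8) + K2 * (2 * 9 ^ 8) + K3"
  have DE: "\<bar>D \<zeta> * (1 + D \<zeta>) ^ 6\<bar> \<le> 2 * 9 ^ 8 * (err (px \<zeta>) + err (py \<zeta>) + err (pz \<zeta>))" for \<zeta>
    using monomial_le_err[of "\<bar>px \<zeta>\<bar>" "\<bar>py \<zeta>\<bar>" "\<bar>pz \<zeta>\<bar>"] D[of \<zeta>]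
    by (simp add: D_def err_abs)
  have KE: "k * \<bar>D \<zeta> * (1 + D \<zeta>) ^ 6\<bar> \<le> K * (err (px \<zeta>) + err (py \<zeta>) + err (pz \<zeta>))"
    if "k \<in> {K1, K2}" for k \<zeta>
  proof -
    have "0 \<le> k" using that \<open>0 < K1\<close> \<open>0 < K2\<close> by auto
    then have "k * \<bar>D \<zeta> * (1 + D \<zeta>) ^ 6\<bar> \<le> k * (2 * 9 ^ 8 * (err (px \<zeta>) + err (py \<zeta>) + err (pz \<zeta>)))"
      by (intro mult_left_mono DE)
    also have "\<dots> = (k * (2 * 9 ^ 8)) * (err (px \<zeta>) + err (py \<zeta>) + err (pz \<zeta>))" by simp
    also have "\<dots> \<le> K * (err (px \<zeta>) + err (py \<zeta>) + err (pz \<zeta>))"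
      using that \<open>0 < K1\<close> \<open>0 < K2\<close> \<open>0 < K3\<close> by (intro mult_right_mono) (auto simp: K_def)
    finally show ?thesis .
  qed
  show ?thesis
  proof (rule that[of K])
    show "0 \<le> K" using \<open>0 < K1\<close> \<open>0 < K2\<close> \<open>0 < K3\<close> by (simp add: K_def)
  next
    fix P Q U V :: "nat \<Rightarrow> real" and x y z :: real
    assume "comp_le R P Q U V"
    then have S: "(P, Q, U, V, x, y, z) \<in> S" by (simp add: S_def)
    show "\<bar>energy_rate P Q U V x y z\<bar> \<le> K * (err x + err y + err z)"
      using order_trans[OF K1[rule_format, OF S] KE[of K1]] by (simp add: p_defs)
    show "\<bar>nsq4_rate P Q U x y\<bar> \<le> K * (err x + err y + err z)"
      using order_trans[OF K2[rule_format, OF S] KE[of K2]] by (simp add: p_defs)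
  next
    fix P Q U V :: "nat \<Rightarrow> real" and i
    assume "comp_le R P Q U V" and i: "i \<in> I"
    then have S: "(P, Q, U, V, 0, 0, 0) \<in> S" by (simp add: S_def)
    have "\<bar>dP Q U i\<bar> + \<bar>dQ P U i\<bar> + \<bar>dV P Q U i\<bar> \<le> (\<Sum>i\<in>I. \<bar>dP Q U i\<bar> + \<bar>dQ P U i\<bar> + \<bar>dV P Q U i\<bar>)"
      using i by (intro member_le_sum) auto
    also have "\<dots> \<le> K3" using K3[rule_format, OF S] by (simp add: p_defs)
    also have "\<dots> \<le> K" using \<open>0 < K1\<close> \<open>0 < K2\<close> by (simp add: K_def)
    finally show "\<bar>dP Q U i\<bar> \<le> K \<and> \<bar>dQ P U i\<bar> \<le> K \<and> \<bar>dV P Q U i\<bar> \<le> K" by linarith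
  qed
qed

end

section \<open>Deterministic estimates along a path\<close>

text \<open>This rule and the next ones work with a weight \<open>G\<close> that dominates fourth
  powers: linear combinations keep this property, and products of two such functions have their
  squares dominated.\<close>

lemma bigo_even_power_add:
  fixes f g :: "'z \<Rightarrow> real"
  assumes "even k" "(\<lambda>z. f z ^ k) \<in> O[F](G)" "(\<lambda>z. g z ^ k) \<in> O[F](G)"
  shows "(\<lambda>z. (f z + g z) ^ k) \<in> O[F](G)"
proof -
  have "(x + y) ^ k \<le> 2 ^ k * (x ^ k + y ^ k)" for x y :: real
    using power_add_le[of x y k] unfolding power_even_abs[OF \<open>even k\<close>] .
  then have "(\<lambda>z. (f z + g z) ^ k) \<in> O[F](\<lambda>z. f z ^ k + g z ^ k)"
    using \<open>even k\<close> by (intro bigoI[of _ "2 ^ k"] always_eventually) (simp add: zero_le_even_power)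
  also have "(\<lambda>z. f z ^ k + g z ^ k) \<in> O[F](G)" by (intro sum_in_bigo assms)
  finally show ?thesis .
qed

lemma bigo_power_cmult:
  fixes f :: "'z \<Rightarrow> real"
  assumes "(\<lambda>z. f z ^ k) \<in> O[F](G)"
  shows "(\<lambda>z. (c * f z) ^ k) \<in> O[F](G)"
  unfolding power_mult_distrib by (intro bigo_cmult assms)

lemma bigo_even_power_diff:
  fixes f g :: "'z \<Rightarrow> real"
  assumes "even k" "(\<lambda>z. f z ^ k) \<in> O[F](G)" "(\<lambda>z. g z ^ k) \<in> O[F](G)"
  shows "(\<lambda>z. (f z - g z) ^ k) \<in> O[F](G)"
  using bigo_even_power_add[OF assms(1,2) bigo_power_cmult[OF assms(3), of "-1"]] by simp

lemma bigo_even_power_sum: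
  fixes f :: "'i \<Rightarrow> 'z \<Rightarrow> real"
  assumes "even k" "0 < k" "\<And>i. i \<in> S \<Longrightarrow> (\<lambda>z. f i z ^ k) \<in> O[F](G)"
  shows "(\<lambda>z. (\<Sum>i\<in>S. f i z) ^ k) \<in> O[F](G)"
  using assms by (induction S rule: infinite_finite_induct) (auto intro: bigo_even_power_add simp: zero_power)

lemma bigo_square_mult:
  fixes f g :: "'z \<Rightarrow> real"
  assumes "(\<lambda>z. f z ^ 4) \<in> O[F](G)" "(\<lambda>z. g z ^ 4) \<in> O[F](G)"
  shows "(\<lambda>z. (f z * g z)\<^sup>2) \<in> O[F](G)"
proof -
  have "(x * y)\<^sup>2 \<le> x ^ 4 + y ^ 4" for x y :: real
  proof -
    have "2 * (x\<^sup>2 * y\<^sup>2) \<le> x ^ 4 + y ^ 4"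
      using sum_squares_bound[of "x\<^sup>2" "y\<^sup>2"] by (simp add: mult.assoc)
    moreover have "0 \<le> x\<^sup>2 * y\<^sup>2" by simp
    ultimately have "x\<^sup>2 * y\<^sup>2 \<le> x ^ 4 + y ^ 4" by linarith
    then show ?thesis by (simp add: power_mult_distrib)
  qed
  then have "(\<lambda>z. (f z * g z)\<^sup>2) \<in> O[F](\<lambda>z. f z ^ 4 + g z ^ 4)"
    by (intro bigoI[of _ 1] always_eventually) simp
  also have "(\<lambda>z. f z ^ 4 + g z ^ 4) \<in> O[F](G)" by (intro sum_in_bigo assms)
  finally show ?thesis .
qed

text \<open>Young's inequality with exponents 4/3 and 4, up to a constant, from comparing the two
  absolute values.\<close>

lemma bigo_cube_mult:
  fixes f g :: "'z \<Rightarrow> real"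
  assumes "(\<lambda>z. f z ^ 4) \<in> O[F](G)" "(\<lambda>z. g z ^ 4) \<in> O[F](G)"
  shows "(\<lambda>z. f z ^ 3 * g z) \<in> O[F](G)"
proof -
  have "\<bar>x ^ 3 * y\<bar> \<le> x ^ 4 + y ^ 4" for x y :: real
  proof (cases "\<bar>x\<bar> \<le> \<bar>y\<bar>")
    case True
    then have "\<bar>x\<bar> ^ 3 * \<bar>y\<bar> \<le> \<bar>y\<bar> ^ 3 * \<bar>y\<bar>" by (intro mult_right_mono power_mono) auto
    also have "\<dots> = \<bar>y\<bar> ^ 4" by (simp only: power_Suc2[symmetric]) simp
    also have "\<dots> = y ^ 4" by simp
    finally show ?thesis by (simp add: abs_mult power_abs add_increasing)
  next
    case False
    then have "\<bar>x\<bar> ^ 3 * \<bar>y\<bar> \<le> \<bar>x\<bar> ^ 3 * \<bar>x\<bar>" by (intro mult_left_mono) auto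
    also have "\<dots> = \<bar>x\<bar> ^ 4" by (simp only: power_Suc2[symmetric]) simp
    also have "\<dots> = x ^ 4" by simp
    finally show ?thesis by (simp add: abs_mult power_abs add_increasing2)
  qed
  then have "(\<lambda>z. f z ^ 3 * g z) \<in> O[F](\<lambda>z. f z ^ 4 + g z ^ 4)"
    by (intro bigoI[of _ 1] always_eventually) simp
  also have "(\<lambda>z. f z ^ 4 + g z ^ 4) \<in> O[F](G)" by (intro sum_in_bigo assms)
  finally show ?thesis .
qed

context kgs_data
begin

text \<open>The system along a single sample path. Bounds proved at this level have constants
  independent of the path and can be integrated over the probability space afterwards.\<close>

definition is_path ::
  "(nat \<Rightarrow> real \<Rightarrow> real) \<Rightarrow> (real \<Rightarrow> nat \<Rightarrow> real) \<Rightarrow> (real \<Rightarrow> nat \<Rightarrow> real) \<Rightarrow> (real \<Rightarrow> nat \<Rightarrow> real)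
    \<Rightarrow> (real \<Rightarrow> nat \<Rightarrow> real) \<Rightarrow> bool" where
  "is_path w P Q U V \<longleftrightarrow>
    (\<forall>k\<in>{0, 1, 2}. continuous_on {0..T} (w k) \<and> w k 0 = 0) \<and>
    (\<forall>i\<in>I. continuous_on {0..T} (\<lambda>t. P t i) \<and> continuous_on {0..T} (\<lambda>t. Q t i) \<and>
      continuous_on {0..T} (\<lambda>t. U t i) \<and> continuous_on {0..T} (\<lambda>t. V t i)) \<and>
    (\<forall>t\<in>{0..T}. \<forall>i\<in>I.
      P t i = P0 i + integral {0..t} (\<lambda>r. dP (Q r) (U r) i) + f1 i * w 1 t \<and>
      Q t i = Q0 i + integral {0..t} (\<lambda>r. dQ (P r) (U r) i) - f1 i * w 0 t \<and>
      U t i = U0 i + integral {0..t} (\<lambda>r. 2 * V r i) \<and>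
      V t i = V0 i + integral {0..t} (\<lambda>r. dV (P r) (Q r) (U r) i) + f2 i * w 2 t)"

text \<open>The path with the drift switched off after time \<open>\<tau>\<close>, while the noise goes on.\<close>

definition "sP w P \<tau> t i = P (min t \<tau>) i + f1 i * (w (1::nat) t - w 1 (min t \<tau>))" for \<tau> t :: real
definition "sQ w Q \<tau> t i = Q (min t \<tau>) i - f1 i * (w (0::nat) t - w 0 (min t \<tau>))" for \<tau> t :: real
definition "sU U \<tau> t i = (U (min t \<tau>) i :: real)" for \<tau> t :: real
definition "sV w V \<tau> t i = V (min t \<tau>) i + f2 i * (w (2::nat) t - w 2 (min t \<tau>))" for \<tau> t :: real

lemmas stopped_defs = sP_def sQ_def sU_def sV_def

definition "bdd R \<tau> P Q U V \<longleftrightarrow> (\<forall>r\<in>{0..\<tau>}. comp_le R (P r) (Q r) (U r) (V r))" for R \<tau> :: real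

definition "energy_shift P Q U V x y z =
  energy a b M (\<lambda>i. P i + f1 i * x) (\<lambda>i. Q i - f1 i * y) U (\<lambda>i. V i + f2 i * z)"

definition "nsq4_shift P Q x y = nsq M (\<lambda>i. P i + f1 i * x) (\<lambda>i. Q i - f1 i * y) ^ 4"

definition "err_integral w s t =
  integral {s..t} (\<lambda>r. err (w (1 :: nat) t - w 1 r) + err (w 0 t - w 0 r) + err (w 2 t - w 2 r))" for s t :: real

context
  fixes w P Q U V assumes path: "is_path w P Q U V"
begin

lemma path_cont:
  "i \<in> I \<Longrightarrow> continuous_on {0..T} (\<lambda>t. P t i)" "i \<in> I \<Longrightarrow> continuous_on {0..T} (\<lambda>t. Q t i)"
  "i \<in> I \<Longrightarrow> continuous_on {0..T} (\<lambda>t. U t i)" "i \<in> I \<Longrightarrow> continuous_on {0..T} (\<lambda>t. V t i)"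
  "k \<in> {0, 1, 2} \<Longrightarrow> continuous_on {0..T} (w k)"
  using path by (auto simp: is_path_def)

lemma path_eqs:
  assumes "i \<in> I" "t \<in> {0..T}"
  shows "P t i = P0 i + integral {0..t} (\<lambda>r. dP (Q r) (U r) i) + f1 i * w 1 t"
    "Q t i = Q0 i + integral {0..t} (\<lambda>r. dQ (P r) (U r) i) - f1 i * w 0 t"
    "U t i = U0 i + integral {0..t} (\<lambda>r. 2 * V r i)"
    "V t i = V0 i + integral {0..t} (\<lambda>r. dV (P r) (Q r) (U r) i) + f2 i * w 2 t"
  using path assms unfolding is_path_def by blast+

lemma drift_cont:
  assumes "i \<in> I"
  shows "continuous_on {0..T} (\<lambda>r. dP (Q r) (U r) i)" "continuous_on {0..T} (\<lambda>r. dQ (P r) (U r) i)"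
    "continuous_on {0..T} (\<lambda>r. dV (P r) (Q r) (U r) i)" "continuous_on {0..T} (\<lambda>r. 2 * V r i)"
  unfolding dP_def dQ_def dV_def lap_def by (intro continuous_intros path_cont assms | assumption)+

text \<open>The paths themselves are as rough as the noise; after subtraction of the noise they are
  integrals of continuous functions.\<close>

lemma path_deriv:
  assumes i: "i \<in> I" and r: "r \<in> {0..T}"
  shows "((\<lambda>r. P r i - f1 i * w 1 r) has_real_derivative dP (Q r) (U r) i) (at r within {0..T})"
    "((\<lambda>r. Q r i + f1 i * w 0 r) has_real_derivative dQ (P r) (U r) i) (at r within {0..T})"
    "((\<lambda>r. U r i) has_real_derivative 2 * V r i) (at r within {0..T})"
    "((\<lambda>r. V r i - f2 i * w 2 r) has_real_derivative dV (P r) (Q r) (U r) i) (at r within {0..T})"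
proof -
  have *: "(g has_real_derivative g' r) (at r within {0..T})"
    if "continuous_on {0..T} g'" "\<And>t. t \<in> {0..T} \<Longrightarrow> g t = c + integral {0..t} g'" for g g' c
  proof -
    have "((\<lambda>t. c + integral {0..t} g') has_real_derivative 0 + g' r) (at r within {0..T})"
      by (intro DERIV_add DERIV_const integral_has_real_derivative that(1) r)
    then have "((\<lambda>t. c + integral {0..t} g') has_real_derivative g' r) (at r within {0..T})" by simp
    then show ?thesis
      by (rule has_field_derivative_transform_within[OF _ zero_less_one r]) (use that(2) in simp)
  qed
  show "((\<lambda>r. P r i - f1 i * w 1 r) has_real_derivative dP (Q r) (U r) i) (at r within {0..T})"
    by (rule *[OF drift_cont(1)[OF i], of _ "P0 i"]) (use path_eqs(1)[OF i] in simp)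
  show "((\<lambda>r. Q r i + f1 i * w 0 r) has_real_derivative dQ (P r) (U r) i) (at r within {0..T})"
    by (rule *[OF drift_cont(2)[OF i], of _ "Q0 i"]) (use path_eqs(2)[OF i] in simp)
  show "((\<lambda>r. U r i) has_real_derivative 2 * V r i) (at r within {0..T})"
    by (rule *[OF drift_cont(4)[OF i], of _ "U0 i"]) (use path_eqs(3)[OF i] in simp)
  show "((\<lambda>r. V r i - f2 i * w 2 r) has_real_derivative dV (P r) (Q r) (U r) i) (at r within {0..T})"
    by (rule *[OF drift_cont(3)[OF i], of _ "V0 i"]) (use path_eqs(4)[OF i] in simp)
qed

lemma stopped_cont:
  assumes "0 \<le> \<tau>"
  shows "i \<in> I \<Longrightarrow> continuous_on {0..T} (\<lambda>t. sP w P \<tau> t i)" "i \<in> I \<Longrightarrow> continuous_on {0..T} (\<lambda>t. sQ w Q \<tau> t i)"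
    "i \<in> I \<Longrightarrow> continuous_on {0..T} (\<lambda>t. sU U \<tau> t i)" "i \<in> I \<Longrightarrow> continuous_on {0..T} (\<lambda>t. sV w V \<tau> t i)"
proof -
  have *: "continuous_on {0..T} (\<lambda>t. g (min t \<tau>))" if "continuous_on {0..T} g" for g :: "real \<Rightarrow> real"
    by (rule continuous_on_compose2[OF that]) (use assms in \<open>auto intro!: continuous_intros\<close>)
  show "continuous_on {0..T} (\<lambda>t. sP w P \<tau> t i)" if "i \<in> I"
    unfolding sP_def by (intro continuous_intros *[OF path_cont(1)[OF that]] *[OF path_cont(5)] path_cont(5)) auto
  show "continuous_on {0..T} (\<lambda>t. sQ w Q \<tau> t i)" if "i \<in> I"
    unfolding sQ_def by (intro continuous_intros *[OF path_cont(2)[OF that]] *[OF path_cont(5)] path_cont(5)) auto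
  show "continuous_on {0..T} (\<lambda>t. sU U \<tau> t i)" if "i \<in> I"
    unfolding sU_def by (rule *[OF path_cont(3)[OF that]])
  show "continuous_on {0..T} (\<lambda>t. sV w V \<tau> t i)" if "i \<in> I"
    unfolding sV_def by (intro continuous_intros *[OF path_cont(4)[OF that]] *[OF path_cont(5)] path_cont(5)) auto
qed

end

lemma one_step:
  obtains K where "0 \<le> K"
    "\<And>w P Q U V \<tau> s t. is_path w P Q U V \<Longrightarrow> bdd R \<tau> P Q U V \<Longrightarrow> 0 \<le> \<tau> \<Longrightarrow> \<tau> \<le> T \<Longrightarrow> 0 \<le> s \<Longrightarrow> s \<le> t \<Longrightarrow> t \<le> T \<Longrightarrow>
      \<bar>energy a b M (sP w P \<tau> t) (sQ w Q \<tau> t) (sU U \<tau> t) (sV w V \<tau> t)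
        - energy_shift (sP w P \<tau> s) (sQ w Q \<tau> s) (sU U \<tau> s) (sV w V \<tau> s) (w 1 t - w 1 s) (w 0 t - w 0 s) (w 2 t - w 2 s)\<bar>
        \<le> K * err_integral w s t \<and>
      \<bar>nsq M (sP w P \<tau> t) (sQ w Q \<tau> t) ^ 4 - nsq4_shift (sP w P \<tau> s) (sQ w Q \<tau> s) (w 1 t - w 1 s) (w 0 t - w 0 s)\<bar>
        \<le> K * err_integral w s t"
proof (rule rate_bounds[of R])
  fix K :: real
  assume K: "0 \<le> K"
    and Ke: "\<And>P Q U V x y z. comp_le R P Q U V \<Longrightarrow> \<bar>energy_rate P Q U V x y z\<bar> \<le> K * (err x + err y + err z)"
    and Kn: "\<And>P Q U V x y z. comp_le R P Q U V \<Longrightarrow> \<bar>nsq4_rate P Q U x y\<bar> \<le> K * (err x + err y + err z)"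
  show ?thesis
  proof (rule that[OF K])
    fix w P Q U V and \<tau> s t :: real
    assume path: "is_path w P Q U V" and b: "bdd R \<tau> P Q U V" and \<tau>: "0 \<le> \<tau>" "\<tau> \<le> T"
      and st: "0 \<le> s" "s \<le> t" "t \<le> T"
    let ?g = "\<lambda>r. err (w 1 t - w 1 r) + err (w 0 t - w 0 r) + err (w 2 t - w 2 r)"
    let ?E = "\<bar>energy a b M (sP w P \<tau> t) (sQ w Q \<tau> t) (sU U \<tau> t) (sV w V \<tau> t)
        - energy_shift (sP w P \<tau> s) (sQ w Q \<tau> s) (sU U \<tau> s) (sV w V \<tau> s) (w 1 t - w 1 s) (w 0 t - w 0 s) (w 2 t - w 2 s)\<bar>"
    let ?N = "\<bar>nsq M (sP w P \<tau> t) (sQ w Q \<tau> t) ^ 4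
        - nsq4_shift (sP w P \<tau> s) (sQ w Q \<tau> s) (w 1 t - w 1 s) (w 0 t - w 0 s)\<bar>"
    have gcont: "continuous_on {s..t} ?g"
      unfolding err_def
      by (intro continuous_intros continuous_on_subset[OF path_cont(5)[OF path]]) (use st in auto)
    have Int: "integral {s..t} (\<lambda>r. K * ?g r) = K * integral {s..t} ?g" by simp
    show "?E \<le> K * err_integral w s t \<and> ?N \<le> K * err_integral w s t"
    proof (cases "\<tau> \<le> s")
      \<comment> \<open>After the exit time only the noise moves the process, so the comparison is
        an equality.\<close>
      case True
      then have m: "min s \<tau> = \<tau>" "min t \<tau> = \<tau>" using st by auto
      have "sP w P \<tau> t = (\<lambda>i. sP w P \<tau> s i + f1 i * (w 1 t - w 1 s))"
        "sQ w Q \<tau> t = (\<lambda>i. sQ w Q \<tau> s i - f1 i * (w 0 t - w 0 s))" "sU U \<tau> t = sU U \<tau> s"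
        "sV w V \<tau> t = (\<lambda>i. sV w V \<tau> s i + f2 i * (w 2 t - w 2 s))"
        by (auto simp: stopped_defs m algebra_simps)
      then have "?E = 0" "?N = 0" by (simp_all add: energy_shift_def nsq4_shift_def)
      moreover have "0 \<le> K * integral {s..t} ?g"
        using K by (intro mult_nonneg_nonneg Henstock_Kurzweil_Integration.integral_nonneg
            integrable_continuous_real gcont) auto
      ultimately show ?thesis by (simp add: err_integral_def)
    next
      case False
      define t' where "t' = min t \<tau>"
      have t': "s \<le> t'" "t' \<le> t" "t' \<le> \<tau>" "{s..t'} \<subseteq> {0..T}" using False st by (auto simp: t'_def)
      \<comment> \<open>The noise contained in \<open>P r\<close> cancels against
        \<open>w 1 r\<close>. Hence \<open>p\<close> is differentiable in \<open>r\<close> with the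
        drift as its derivative; the same holds for \<open>q\<close> and \<open>v\<close>.\<close>
      define p where "p r i = P r i + f1 i * (w 1 t - w 1 r)" for r i
      define q where "q r i = Q r i - f1 i * (w 0 t - w 0 r)" for r i
      define v where "v r i = V r i + f2 i * (w 2 t - w 2 r)" for r i
      have dp: "((\<lambda>r. p r i) has_real_derivative dP (Q r) (U r) i) (at r within {s..t'})"
        and dq: "((\<lambda>r. q r i) has_real_derivative dQ (P r) (U r) i) (at r within {s..t'})"
        and du: "((\<lambda>r. U r i) has_real_derivative 2 * V r i) (at r within {s..t'})"
        and dv: "((\<lambda>r. v r i) has_real_derivative dV (P r) (Q r) (U r) i) (at r within {s..t'})"
        if i: "i \<in> I" and r: "r \<in> {s..t'}" for i r
      proof -
        have r': "r \<in> {0..T}" using r t' by auto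
        note d = DERIV_subset[OF path_deriv(1)[OF path i r'] t'(4)]
          DERIV_subset[OF path_deriv(2)[OF path i r'] t'(4)]
          DERIV_subset[OF path_deriv(3)[OF path i r'] t'(4)]
          DERIV_subset[OF path_deriv(4)[OF path i r'] t'(4)]
        show "((\<lambda>r. p r i) has_real_derivative dP (Q r) (U r) i) (at r within {s..t'})"
          using DERIV_add[OF d(1) DERIV_const[of "f1 i * w 1 t"]] by (simp add: p_def algebra_simps)
        show "((\<lambda>r. q r i) has_real_derivative dQ (P r) (U r) i) (at r within {s..t'})"
          using DERIV_diff[OF d(2) DERIV_const[of "f1 i * w 0 t"]] by (simp add: q_def algebra_simps)
        show "((\<lambda>r. v r i) has_real_derivative dV (P r) (Q r) (U r) i) (at r within {s..t'})"
          using DERIV_add[OF d(4) DERIV_const[of "f2 i * w 2 t"]] by (simp add: v_def algebra_simps)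
        show "((\<lambda>r. U r i) has_real_derivative 2 * V r i) (at r within {s..t'})" by (rule d(3))
      qed
      have bd: "comp_le R (P r) (Q r) (U r) (V r)" if "r \<in> {s..t'}" for r
        using b that t' st unfolding bdd_def by auto
      have hcont: "continuous_on {s..t} (\<lambda>r. K * ?g r)" by (intro continuous_intros gcont)
      have hcont': "continuous_on {s..t'} (\<lambda>r. K * ?g r)"
        by (rule continuous_on_subset[OF hcont]) (use t' in auto)
      have sub: "integral {s..t'} (\<lambda>r. K * ?g r) \<le> integral {s..t} (\<lambda>r. K * ?g r)"
        using t' K by (intro integral_subset_le integrable_continuous_real hcont
            continuous_on_subset[OF hcont]) auto
      have "\<bar>energy a b M (p t') (q t') (U t') (v t') - energy a b M (p s) (q s) (U s) (v s)\<bar>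
          \<le> integral {s..t'} (\<lambda>r. K * ?g r)"
      proof (rule increment_le_integral[OF t'(1)])
        fix r assume r: "r \<in> {s..t'}"
        show "((\<lambda>r. energy a b M (p r) (q r) (U r) (v r)) has_real_derivative
            energy_rate (P r) (Q r) (U r) (V r) (w 1 t - w 1 r) (w 0 t - w 0 r) (w 2 t - w 2 r)) (at r within {s..t'})"
          using energy_has_real_derivative[OF h_nonneg dp dq du dv, OF _ r _ r _ r _ r]
          unfolding energy_rate_def p_def q_def v_def by simp
        show "\<bar>energy_rate (P r) (Q r) (U r) (V r) (w 1 t - w 1 r) (w 0 t - w 0 r) (w 2 t - w 2 r)\<bar> \<le> K * ?g r"
          by (rule Ke[OF bd[OF r]])
      qed (rule hcont')
      moreover have "\<bar>nsq M (p t') (q t') ^ 4 - nsq M (p s) (q s) ^ 4\<bar>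
          \<le> integral {s..t'} (\<lambda>r. K * ?g r)"
      proof (rule increment_le_integral[OF t'(1)])
        fix r assume r: "r \<in> {s..t'}"
        let ?d = "nsq4_rate (P r) (Q r) (U r) (w 1 t - w 1 r) (w 0 t - w 0 r)"
        have "((\<lambda>r. nsq M (p r) (q r)) has_real_derivative
            (\<Sum>i\<in>I. 2 * (p r i * dP (Q r) (U r) i + q r i * dQ (P r) (U r) i))) (at r within {s..t'})"
          by (intro nsq_has_real_derivative dp dq r | assumption)+
        from DERIV_power[OF this, of 4]
        show "((\<lambda>r. nsq M (p r) (q r) ^ 4) has_real_derivative ?d) (at r within {s..t'})"
          by (simp add: nsq4_rate_def p_def[abs_def] q_def[abs_def] mult_ac)
        show "\<bar>?d\<bar> \<le> K * ?g r"
          by (rule Kn[OF bd[OF r]])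
      qed (rule hcont')
      \<comment> \<open>At \<open>t'\<close> the remaining shift is exactly the noise that the
        stopped process still collects between \<open>t'\<close> and \<open>t\<close>.\<close>
      moreover have "p t' = sP w P \<tau> t" "q t' = sQ w Q \<tau> t" "U t' = sU U \<tau> t" "v t' = sV w V \<tau> t"
        by (auto simp: stopped_defs t'_def p_def q_def v_def)
      moreover have "p s = (\<lambda>i. sP w P \<tau> s i + f1 i * (w 1 t - w 1 s))"
        "q s = (\<lambda>i. sQ w Q \<tau> s i - f1 i * (w 0 t - w 0 s))" "U s = sU U \<tau> s"
        "v s = (\<lambda>i. sV w V \<tau> s i + f2 i * (w 2 t - w 2 s))"
        using False by (auto simp: stopped_defs p_def q_def v_def min_def)
      ultimately show ?thesis using sub Int by (simp add: energy_shift_def nsq4_shift_def err_integral_def)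
    qed
  qed
qed

text \<open>The stopped process is the initial value, plus the drift integrated up to
  \<open>min t \<tau>\<close>, plus the full noise at time \<open>t\<close>. The drift integral is
  at most \<open>K0 * T\<close>, so only the noise is unbounded, and it enters linearly.
  \<open>U\<close> carries no noise and stays below \<open>R\<close>, up to the case distinction
  hidden in \<open>K\<close>.\<close>

lemma stopped_bound:
  obtains K where "0 \<le> K"
    "\<And>w P Q U V \<tau> t i. is_path w P Q U V \<Longrightarrow> bdd R \<tau> P Q U V \<Longrightarrow> 0 \<le> \<tau> \<Longrightarrow> \<tau> \<le> T \<Longrightarrow> t \<in> {0..T} \<Longrightarrow> i \<in> I \<Longrightarrow>
      \<bar>sP w P \<tau> t i\<bar> \<le> K * (1 + \<bar>w 1 t\<bar>) \<and> \<bar>sQ w Q \<tau> t i\<bar> \<le> K * (1 + \<bar>w 0 t\<bar>) \<and>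
      \<bar>sU U \<tau> t i\<bar> \<le> K \<and> \<bar>sV w V \<tau> t i\<bar> \<le> K * (1 + \<bar>w 2 t\<bar>)"
proof (rule rate_bounds[of R])
  fix K0 :: real
  assume K0: "0 \<le> K0"
    and rate: "\<And>P Q U V i. comp_le R P Q U V \<Longrightarrow> i \<in> I \<Longrightarrow>
      \<bar>dP Q U i\<bar> \<le> K0 \<and> \<bar>dQ P U i\<bar> \<le> K0 \<and> \<bar>dV P Q U i\<bar> \<le> K0"
  define c where "c i = \<bar>P0 i\<bar> + \<bar>Q0 i\<bar> + \<bar>V0 i\<bar> + \<bar>f1 i\<bar> + \<bar>f2 i\<bar>" for i
  define K where "K = K0 * T + \<bar>R\<bar> + (\<Sum>i\<in>I. c i)"
  show ?thesis
  proof (rule that[of K])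
    show "0 \<le> K" using K0 T by (auto simp: K_def c_def intro!: add_nonneg_nonneg sum_nonneg)
  next
    fix w P Q U V i and \<tau> t :: real
    assume path: "is_path w P Q U V" and b: "bdd R \<tau> P Q U V" and \<tau>: "0 \<le> \<tau>" "\<tau> \<le> T"
      and t: "t \<in> {0..T}" and i: "i \<in> I"
    define t' where "t' = min t \<tau>"
    have t': "t' \<in> {0..T}" "t' \<in> {0..\<tau>}" using t \<tau> by (auto simp: t'_def)
    have "c i \<le> (\<Sum>i\<in>I. c i)" using i by (intro member_le_sum) (auto simp: c_def)
    then have cK: "K0 * T + c i \<le> K" by (simp add: K_def)
    have drift: "\<bar>integral {0..t'} g\<bar> \<le> K0 * T"
      if g: "continuous_on {0..T} g" "\<And>r. r \<in> {0..t'} \<Longrightarrow> \<bar>g r\<bar> \<le> K0" for g :: "real \<Rightarrow> real"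
    proof -
      have "norm (integral {0..t'} g) \<le> K0 * (t' - 0)"
        by (rule integral_bound) (use t' g in \<open>auto intro: continuous_on_subset\<close>)
      also have "\<dots> \<le> K0 * T" using K0 t' by (intro mult_left_mono) auto
      finally show ?thesis by simp
    qed
    have r: "\<bar>dP (Q r) (U r) i\<bar> \<le> K0" "\<bar>dQ (P r) (U r) i\<bar> \<le> K0" "\<bar>dV (P r) (Q r) (U r) i\<bar> \<le> K0"
      if "r \<in> {0..t'}" for r
    proof -
      have "comp_le R (P r) (Q r) (U r) (V r)" using b that t' unfolding bdd_def by auto
      from rate[OF this i]
      show "\<bar>dP (Q r) (U r) i\<bar> \<le> K0" "\<bar>dQ (P r) (U r) i\<bar> \<le> K0" "\<bar>dV (P r) (Q r) (U r) i\<bar> \<le> K0"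
        by auto
    qed
    have tri: "\<bar>x + y + f * z\<bar> \<le> K * (1 + \<bar>z\<bar>)"
      if "\<bar>x\<bar> + \<bar>f\<bar> \<le> c i" "\<bar>y\<bar> \<le> K0 * T" for x y z f :: real
    proof -
      have "0 \<le> K0 * T" using K0 T by simp
      then have K1: "\<bar>x\<bar> + \<bar>y\<bar> \<le> K" "\<bar>f\<bar> \<le> K" using that cK by linarith+
      have "\<bar>x + y + f * z\<bar> \<le> \<bar>x\<bar> + \<bar>y\<bar> + \<bar>f\<bar> * \<bar>z\<bar>"
        using abs_triangle_ineq[of "x + y" "f * z"] abs_triangle_ineq[of x y] by (simp add: abs_mult)
      also have "\<dots> \<le> K + K * \<bar>z\<bar>" using K1 by (intro add_mono mult_right_mono) auto
      finally show ?thesis by (simp add: algebra_simps)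
    qed
    have "sP w P \<tau> t i = P0 i + integral {0..t'} (\<lambda>r. dP (Q r) (U r) i) + f1 i * w 1 t"
      "sQ w Q \<tau> t i = Q0 i + integral {0..t'} (\<lambda>r. dQ (P r) (U r) i) + (- f1 i) * w 0 t"
      "sV w V \<tau> t i = V0 i + integral {0..t'} (\<lambda>r. dV (P r) (Q r) (U r) i) + f2 i * w 2 t"
      unfolding stopped_defs t'_def[symmetric] path_eqs[OF path i t'(1)] by (simp_all add: algebra_simps)
    moreover have "\<bar>sU U \<tau> t i\<bar> \<le> K"
    proof -
      have "\<bar>sU U \<tau> t i\<bar> \<le> R" using b t' i unfolding bdd_def comp_le_def sU_def t'_def by auto
      moreover have "0 \<le> K0 * T" "0 \<le> (\<Sum>i\<in>I. c i)" using K0 T by (auto simp: c_def intro!: sum_nonneg)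
      ultimately show ?thesis by (simp add: K_def)
    qed
    ultimately show "\<bar>sP w P \<tau> t i\<bar> \<le> K * (1 + \<bar>w 1 t\<bar>) \<and> \<bar>sQ w Q \<tau> t i\<bar> \<le> K * (1 + \<bar>w 0 t\<bar>) \<and>
      \<bar>sU U \<tau> t i\<bar> \<le> K \<and> \<bar>sV w V \<tau> t i\<bar> \<le> K * (1 + \<bar>w 2 t\<bar>)"
      by (simp only:) (intro conjI tri drift drift_cont[OF path i] r, auto simp: c_def)
  qed
qed

text \<open>\<open>U\<close> carries no noise, and its velocity \<open>2 * V\<close> is bounded by
  \<open>2 * R\<close> up to \<open>\<tau>\<close>. The dependence on \<open>R\<close> is harmless
  where this is used.\<close>

lemma sU_Lipschitz:
  assumes path: "is_path w P Q U V" and b: "bdd R \<tau> P Q U V" and \<tau>: "0 \<le> \<tau>" "\<tau> \<le> T"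
    and st: "0 \<le> s" "s \<le> t" "t \<le> T" and i: "i \<in> I"
  shows "\<bar>sU U \<tau> t i - sU U \<tau> s i\<bar> \<le> 2 * R * (t - s)"
proof -
  let ?s = "min s \<tau>" and ?t = "min t \<tau>"
  have sub: "{?s..?t} \<subseteq> {0..T}" "{?s..?t} \<subseteq> {0..\<tau>}" and le: "?s \<le> ?t" using st \<tau> by auto
  have R: "0 \<le> R" using b i \<tau> unfolding bdd_def comp_le_def by force
  have "\<bar>U ?t i - U ?s i\<bar> \<le> integral {?s..?t} (\<lambda>_. 2 * R)"
  proof (rule increment_le_integral[OF le])
    fix r assume r: "r \<in> {?s..?t}"
    then have rT: "r \<in> {0..T}" "r \<in> {0..\<tau>}" using sub by auto
    show "((\<lambda>r. U r i) has_real_derivative 2 * V r i) (at r within {?s..?t})"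
      by (rule DERIV_subset[OF path_deriv(3)[OF path i rT(1)] sub(1)])
    have "\<bar>V r i\<bar> \<le> R" using b i rT(2) unfolding bdd_def comp_le_def by blast
    then show "\<bar>2 * V r i\<bar> \<le> 2 * R" by (simp add: abs_mult)
  qed auto
  also have "\<dots> = 2 * R * (?t - ?s)" using le by simp
  also have "\<dots> \<le> 2 * R * (t - s)" using R st by (intro mult_left_mono) auto
  finally show ?thesis by (simp add: sU_def)
qed

section \<open>Growth of the fourth powers of \<open>U\<close> and \<open>V\<close>\<close>

definition "quart u v = (\<Sum>i\<in>I. u i ^ 4 + v i ^ 4)" for u v :: "nat \<Rightarrow> real"

lemma quart_nonneg: "0 \<le> quart u v"
  unfolding quart_def by (intro sum_nonneg) auto

lemma le_quart: "i \<in> I \<Longrightarrow> u i ^ 4 + v i ^ 4 \<le> quart u v"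
  unfolding quart_def by (intro member_le_sum) auto

definition "growth_weight u v x N = quart u v + x ^ 4 + N ^ 4" for u v :: "nat \<Rightarrow> real" and x N :: real

text \<open>The equations of \<open>U\<close> and \<open>V\<close> are linear once \<open>N\<close>
  is regarded as a source, and so the rate has degree four in \<open>U\<close>, \<open>v\<close>,
  \<open>x\<close> and \<open>N\<close>. The Landau symbols refer to the filter \<open>top\<close>
  here: the bound holds for all states, not only those below \<open>R\<close>.\<close>

lemma UV_growth_rate:
  obtains c where "0 \<le> c"
    "\<And>P Q U v x. (\<Sum>i\<in>I. 4 * (U i ^ 3 * (2 * (v i + f2 i * x))) + 4 * (v i ^ 3 * dV P Q U i))
      \<le> c * growth_weight U v x (nsq M P Q)"
proof -
  define G where "G = (\<lambda>(P, Q, U, v, x). growth_weight U v x (nsq M P Q))"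
  have G: "growth_weight U v x (nsq M P Q) = \<bar>G (P, Q, U, v, x)\<bar>" for P Q U v x
    using quart_nonneg[of U v] by (simp add: G_def growth_weight_def add_nonneg_nonneg)
  define F :: "((nat \<Rightarrow> real) \<times> (nat \<Rightarrow> real) \<times> (nat \<Rightarrow> real) \<times> (nat \<Rightarrow> real) \<times> real) filter" where "F = top"
  have ev: "eventually Pr F \<longleftrightarrow> (\<forall>z. Pr z)" for Pr by (simp add: F_def eventually_top)
  have Gge: "y ^ 4 \<le> \<bar>G (P, Q, U, v, x)\<bar>"
    if "y ^ 4 \<le> quart U v \<or> y ^ 4 \<le> x ^ 4 \<or> y ^ 4 \<le> nsq M P Q ^ 4" for y P Q U v x
  proof -
    have "0 \<le> x ^ 4" "0 \<le> nsq M P Q ^ 4" by auto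
    then show ?thesis using that quart_nonneg[of U v] unfolding G[symmetric] growth_weight_def by linarith
  qed
  have U: "(\<lambda>(P, Q, U, v, x). U i ^ 4) \<in> O[F](G)" and v: "(\<lambda>(P, Q, U, v, x). v i ^ 4) \<in> O[F](G)"
    if "i \<in> I" for i
  proof -
    have "U i ^ 4 \<le> \<bar>G (P, Q, U, v, x)\<bar> \<and> v i ^ 4 \<le> \<bar>G (P, Q, U, v, x)\<bar>" for P Q U v x
    proof -
      have "0 \<le> U i ^ 4" "0 \<le> v i ^ 4" by auto
      then show ?thesis using le_quart[OF that, of U v] by (intro conjI Gge disjI1; linarith)
    qed
    then show "(\<lambda>(P, Q, U, v, x). U i ^ 4) \<in> O[F](G)" "(\<lambda>(P, Q, U, v, x). v i ^ 4) \<in> O[F](G)"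
      by (auto intro!: bigoI[of _ 1] simp: ev)
  qed
  have x: "(\<lambda>(P, Q, U, v, x). x ^ 4) \<in> O[F](G)"
    by (auto intro!: bigoI[of _ 1] Gge simp: ev)
  have PQ: "(\<lambda>(P, Q, U, v, x). (P i * P i) ^ 4) \<in> O[F](G)" "(\<lambda>(P, Q, U, v, x). (Q i * Q i) ^ 4) \<in> O[F](G)"
    if i: "i \<in> I" for i
  proof -
    have "(P i * P i) ^ 4 \<le> nsq M P Q ^ 4 \<and> (Q i * Q i) ^ 4 \<le> nsq M P Q ^ 4" for P Q
    proof -
      have "(P i)\<^sup>2 + (Q i)\<^sup>2 \<le> nsq M P Q" unfolding nsq_def using i by (intro member_le_sum) auto
      then have "P i * P i \<le> nsq M P Q" "Q i * Q i \<le> nsq M P Q"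
        using zero_le_square[of "P i"] zero_le_square[of "Q i"] unfolding power2_eq_square by linarith+
      then show ?thesis by (auto intro!: power_mono)
    qed
    then show "(\<lambda>(P, Q, U, v, x). (P i * P i) ^ 4) \<in> O[F](G)" "(\<lambda>(P, Q, U, v, x). (Q i * Q i) ^ 4) \<in> O[F](G)"
      by (auto intro!: bigoI[of _ 1] Gge simp: ev)
  qed
  note cl = U[unfolded case_prod_beta] v[unfolded case_prod_beta] x[unfolded case_prod_beta] PQ[unfolded case_prod_beta]
  have "(\<lambda>(P, Q, U, v, x). \<Sum>i\<in>I. 4 * (U i ^ 3 * (2 * (v i + f2 i * x))) + 4 * (v i ^ 3 * dV P Q U i)) \<in> O[F](G)"
    unfolding case_prod_beta dV_def lap_def
    by (intro big_sum_in_bigo sum_in_bigo bigo_cmult bigo_cube_mult bigo_power_cmult bigo_even_power_add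
        bigo_even_power_diff bigo_even_power_sum cl | assumption | simp)+
  then obtain c where "0 < c" and c: "\<And>P Q U v x.
      \<bar>\<Sum>i\<in>I. 4 * (U i ^ 3 * (2 * (v i + f2 i * x))) + 4 * (v i ^ 3 * dV P Q U i)\<bar> \<le> c * \<bar>G (P, Q, U, v, x)\<bar>"
    by (auto elim!: landau_o.bigE simp: ev)
  show ?thesis
  proof (rule that[of c])
    show "0 \<le> c" using \<open>0 < c\<close> by simp
    show "(\<Sum>i\<in>I. 4 * (U i ^ 3 * (2 * (v i + f2 i * x))) + 4 * (v i ^ 3 * dV P Q U i))
      \<le> c * growth_weight U v x (nsq M P Q)" for P Q U v x
      using c[of U v x P Q] unfolding G by simp
  qed
qed

text \<open>No bound on the components enters, so \<open>L\<close> is independent of the truncation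
  level. Up to \<open>\<tau>\<close> the charge of the path is that of the stopped process, whose
  moments are controlled.\<close>

lemma stopped_UV_growth:
  obtains L where "0 \<le> L"
    "\<And>w P Q U V \<tau> t. is_path w P Q U V \<Longrightarrow> 0 \<le> \<tau> \<Longrightarrow> \<tau> \<le> T \<Longrightarrow> t \<in> {0..T} \<Longrightarrow>
      quart (sU U \<tau> t) (sV w V \<tau> t)
      \<le> L * (1 + w 2 t ^ 4 + integral {0..t} (\<lambda>r. w 2 r ^ 4 + nsq M (sP w P \<tau> r) (sQ w Q \<tau> r) ^ 4))"
proof (rule UV_growth_rate)
  fix c assume c: "0 \<le> c"
    and rate: "\<And>P Q U v x. (\<Sum>i\<in>I. 4 * (U i ^ 3 * (2 * (v i + f2 i * x))) + 4 * (v i ^ 3 * dV P Q U i))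
      \<le> c * growth_weight U v x (nsq M P Q)"
  define q0 where "q0 = quart U0 V0"
  define g where "g = (\<Sum>i\<in>I. f2 i ^ 4)"
  have q0: "0 \<le> q0" and g: "0 \<le> g" by (auto simp: q0_def g_def quart_nonneg intro!: sum_nonneg)
  define L where "L = 16 * exp (c * T) * (q0 + c) + 16 * g"
  show ?thesis
  proof (rule that[of L])
    show "0 \<le> L" using c q0 g by (simp add: L_def)
  next
    fix w P Q U V and \<tau> t :: real
    assume path: "is_path w P Q U V" and \<tau>: "0 \<le> \<tau>" "\<tau> \<le> T" and t: "t \<in> {0..T}"
    define t' where "t' = min t \<tau>"
    have t': "0 \<le> t'" "t' \<le> t" "t' \<le> \<tau>" "{0..t'} \<subseteq> {0..T}" using t \<tau> by (auto simp: t'_def)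
    \<comment> \<open>removing the noise makes the path differentiable\<close>
    define v where "v r i = V r i - f2 i * w 2 r" for r i
    define q where "q r = quart (U r) (v r)" for r
    define k where "k r = w 2 r ^ 4 + nsq M (sP w P \<tau> r) (sQ w Q \<tau> r) ^ 4" for r
    have kcont: "continuous_on {0..T} k"
      unfolding k_def nsq_def
      by (intro continuous_intros path_cont(5)[OF path] stopped_cont(1,2)[OF path \<tau>(1)] | simp)+
    have kint: "k integrable_on {0..t}" "k integrable_on {0..t'}"
      using t t' by (auto intro!: integrable_continuous_real continuous_on_subset[OF kcont])
    have k0: "0 \<le> k r" for r by (simp add: k_def)
    have Ik: "0 \<le> integral {0..t'} k"
      using k0 kint by (intro Henstock_Kurzweil_Integration.integral_nonneg) auto
    have "q t' \<le> exp (c * t') * (q 0 + integral {0..t'} (\<lambda>r. c * k r))"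
    proof (rule Gronwall_derivative[OF t'(1) c])
      fix r assume r: "r \<in> {0..t'}"
      then have rT: "r \<in> {0..T}" using t' by auto
      have dU: "((\<lambda>r. U r i) has_real_derivative 2 * V r i) (at r within {0..t'})"
        and dv: "((\<lambda>r. v r i) has_real_derivative dV (P r) (Q r) (U r) i) (at r within {0..t'})" if "i \<in> I" for i
        unfolding v_def
        using DERIV_subset[OF path_deriv(3)[OF path that rT] t'(4)]
          DERIV_subset[OF path_deriv(4)[OF path that rT] t'(4)] by auto
      show "(q has_real_derivative (\<Sum>i\<in>I. 4 * (U r i ^ 3 * (2 * V r i)) + 4 * (v r i ^ 3 * dV (P r) (Q r) (U r) i)))
          (at r within {0..t'})"
        unfolding q_def quart_def by (rule DERIV_sum, (rule derivative_eq_intros dU dv refl | assumption)+) simp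
      have V: "V r i = v r i + f2 i * w 2 r" for i by (simp add: v_def)
      have m: "min r \<tau> = r" using r t' by auto
      have "nsq M (P r) (Q r) = nsq M (sP w P \<tau> r) (sQ w Q \<tau> r)"
        by (simp add: sP_def sQ_def m nsq_def)
      then show "(\<Sum>i\<in>I. 4 * (U r i ^ 3 * (2 * V r i)) + 4 * (v r i ^ 3 * dV (P r) (Q r) (U r) i)) \<le> c * q r + c * k r"
        using rate[where P = "P r" and Q = "Q r" and U = "U r" and v = "v r" and x = "w 2 r"]
        unfolding V[symmetric] growth_weight_def q_def k_def by (simp add: algebra_simps)
    qed (use c k0 t' in \<open>auto intro!: continuous_intros continuous_on_subset[OF kcont]\<close>)
    also have "q 0 = q0"
    proof -
      have "U 0 i = U0 i" "v 0 i = V0 i" if "i \<in> I" for i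
        using path_eqs(3,4)[OF path that, of 0] T by (auto simp: v_def)
      then show ?thesis by (simp add: q_def q0_def quart_def)
    qed
    also have "integral {0..t'} (\<lambda>r. c * k r) = c * integral {0..t'} k" by simp
    also have "exp (c * t') * (q0 + c * integral {0..t'} k) \<le> exp (c * T) * (q0 + c * integral {0..t} k)"
    proof (intro mult_mono add_mono mult_left_mono)
      show "exp (c * t') \<le> exp (c * T)" using c t t' by (simp add: mult_left_mono)
      show "integral {0..t'} k \<le> integral {0..t} k"
        using t' kint k0 by (intro integral_subset_le) auto
      show "0 \<le> q0 + c * integral {0..t'} k"
        using q0 c k0 kint by (intro add_nonneg_nonneg mult_nonneg_nonneg Henstock_Kurzweil_Integration.integral_nonneg) auto
    qed (use c Ik in auto)
    also have "\<dots> \<le> exp (c * T) * ((q0 + c) * (1 + integral {0..t} k))"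
    proof -
      have "0 \<le> integral {0..t} k" using k0 kint by (intro Henstock_Kurzweil_Integration.integral_nonneg) auto
      then show ?thesis using q0 c by (intro mult_left_mono) (auto simp: algebra_simps)
    qed
    finally have qt: "q t' \<le> exp (c * T) * ((q0 + c) * (1 + integral {0..t} k))" .
    \<comment> \<open>The noise is put back: \<open>v\<close> has none of it and the stopped process
      has it up to \<open>t\<close>. The factor 16 = 2^4 comes from
      \<open>power_add_le\<close>.\<close>
    have "sU U \<tau> t i ^ 4 + sV w V \<tau> t i ^ 4 \<le> 16 * (U t' i ^ 4 + v t' i ^ 4) + 16 * (f2 i ^ 4 * w 2 t ^ 4)" for i
    proof -
      have "sV w V \<tau> t i = v t' i + f2 i * w 2 t" by (simp add: sV_def v_def t'_def algebra_simps)
      then have "sV w V \<tau> t i ^ 4 \<le> 16 * (v t' i ^ 4 + f2 i ^ 4 * w 2 t ^ 4)"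
        using power_add_le[of "v t' i" "f2 i * w 2 t" 4] by (simp add: power_mult_distrib)
      moreover have "sU U \<tau> t i ^ 4 \<le> 16 * U t' i ^ 4" by (simp add: sU_def t'_def)
      ultimately show ?thesis by simp
    qed
    then have "quart (sU U \<tau> t) (sV w V \<tau> t)
        \<le> (\<Sum>i\<in>I. 16 * (U t' i ^ 4 + v t' i ^ 4) + 16 * (f2 i ^ 4 * w 2 t ^ 4))"
      unfolding quart_def by (intro sum_mono)
    also have "\<dots> = 16 * q t' + 16 * g * w 2 t ^ 4"
      by (simp add: q_def quart_def g_def sum.distrib sum_distrib_left sum_distrib_right mult.assoc)
    also have "\<dots> \<le> 16 * (exp (c * T) * ((q0 + c) * (1 + integral {0..t} k))) + 16 * g * w 2 t ^ 4"
      using qt by simp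
    also have "\<dots> \<le> L * (1 + integral {0..t} k) + L * w 2 t ^ 4"
    proof -
      have "0 \<le> integral {0..t} k" using k0 kint by (intro Henstock_Kurzweil_Integration.integral_nonneg) auto
      then show ?thesis
        using q0 c g unfolding L_def
        by (intro add_mono) (auto simp: algebra_simps intro!: mult_right_mono)
    qed
    finally show "quart (sU U \<tau> t) (sV w V \<tau> t)
      \<le> L * (1 + w 2 t ^ 4 + integral {0..t} (\<lambda>r. w 2 r ^ 4 + nsq M (sP w P \<tau> r) (sQ w Q \<tau> r) ^ 4))"
      unfolding k_def by (simp add: algebra_simps)
  qed
qed

text \<open>The cubic term is a product of \<open>U\<close> and the density of the charge, so its
  square costs fourth powers of both. The quadratic terms in \<open>P\<close> and \<open>Q\<close>
  contribute \<open>N^2\<close>, which is the reason for the summand 1 on the right.\<close>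

lemma energy_square_bound:
  obtains c where "0 \<le> c"
    "\<And>P Q U V. (energy a b M P Q U V)\<^sup>2 \<le> c * (1 + quart U V + nsq M P Q ^ 4)"
proof -
  define G where "G = (\<lambda>(P, Q, U, V). 1 + quart U V + nsq M P Q ^ 4)"
  define F :: "((nat \<Rightarrow> real) \<times> (nat \<Rightarrow> real) \<times> (nat \<Rightarrow> real) \<times> (nat \<Rightarrow> real)) filter" where "F = top"
  have ev: "eventually Pr F \<longleftrightarrow> (\<forall>z. Pr z)" for Pr by (simp add: F_def eventually_top)
  have Gabs: "\<bar>G (P, Q, U, V)\<bar> = 1 + quart U V + nsq M P Q ^ 4" for P Q U V
    using quart_nonneg[of U V] by (simp add: G_def add_nonneg_nonneg)
  have UV: "(\<lambda>(P, Q, U, V). U i ^ 4) \<in> O[F](G)" "(\<lambda>(P, Q, U, V). V i ^ 4) \<in> O[F](G)" if "i \<in> I" for i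
  proof -
    have "U i ^ 4 \<le> \<bar>G (P, Q, U, V)\<bar> \<and> V i ^ 4 \<le> \<bar>G (P, Q, U, V)\<bar>" for P Q U V
    proof -
      note le_quart[OF that, of U V]
      moreover have "0 \<le> U i ^ 4" "0 \<le> V i ^ 4" "0 \<le> nsq M P Q ^ 4" by auto
      ultimately show ?thesis unfolding Gabs by linarith
    qed
    then show "(\<lambda>(P, Q, U, V). U i ^ 4) \<in> O[F](G)" "(\<lambda>(P, Q, U, V). V i ^ 4) \<in> O[F](G)"
      by (auto intro!: bigoI[of _ 1] simp: ev)
  qed
  have PQ: "(\<lambda>(P, Q, U, V). P i ^ 4) \<in> O[F](G)" "(\<lambda>(P, Q, U, V). Q i ^ 4) \<in> O[F](G)"
    "(\<lambda>(P, Q, U, V). (P i * P i + Q i * Q i) ^ 4) \<in> O[F](G)" if i: "i \<in> I" for i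
  proof -
    have "(P i ^ 4 \<le> \<bar>G (P, Q, U, V)\<bar> \<and> Q i ^ 4 \<le> \<bar>G (P, Q, U, V)\<bar>) \<and>
        (P i * P i + Q i * Q i) ^ 4 \<le> \<bar>G (P, Q, U, V)\<bar>" for P Q U V
    proof -
      have le: "(P i)\<^sup>2 + (Q i)\<^sup>2 \<le> nsq M P Q" unfolding nsq_def using i by (intro member_le_sum) auto
      have 1: "(P i * P i + Q i * Q i) ^ 4 \<le> nsq M P Q ^ 4"
        using le by (intro power_mono) (auto simp: power2_eq_square)
      have 2: "y ^ 4 \<le> 1 + nsq M P Q ^ 4" if "y\<^sup>2 \<le> nsq M P Q" for y
      proof -
        have "y ^ 4 = (y\<^sup>2)\<^sup>2" by simp
        also have "\<dots> \<le> (nsq M P Q)\<^sup>2" using that by (intro power_mono) auto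
        also have "\<dots> \<le> 1 + nsq M P Q ^ 4"
        proof -
          have "2 * (nsq M P Q)\<^sup>2 \<le> nsq M P Q ^ 4 + 1"
            using sum_squares_bound[of "(nsq M P Q)\<^sup>2" 1] by simp
          moreover have "0 \<le> (nsq M P Q)\<^sup>2" by simp
          ultimately show ?thesis by linarith
        qed
        finally show ?thesis .
      qed
      have "P i ^ 4 \<le> 1 + nsq M P Q ^ 4" "Q i ^ 4 \<le> 1 + nsq M P Q ^ 4"
        by (rule 2, use le zero_le_power2[of "P i"] zero_le_power2[of "Q i"] in linarith)+
      then show ?thesis using 1 quart_nonneg[of U V] unfolding Gabs by linarith
    qed
    then show "(\<lambda>(P, Q, U, V). P i ^ 4) \<in> O[F](G)" "(\<lambda>(P, Q, U, V). Q i ^ 4) \<in> O[F](G)"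
      "(\<lambda>(P, Q, U, V). (P i * P i + Q i * Q i) ^ 4) \<in> O[F](G)"
      by (auto intro!: bigoI[of _ 1] simp: ev)
  qed
  note cl = UV[unfolded case_prod_beta] PQ[unfolded case_prod_beta]
  have "(\<lambda>(P, Q, U, V). (h * (\<Sum>i\<in>I. 2 * (U i * (P i * P i + Q i * Q i)) - U i * U i - 4 * (V i * V i)
      + U i * A U i + 2 * (P i * A P i) + 2 * (Q i * A Q i)))\<^sup>2) \<in> O[F](G)"
    unfolding case_prod_beta lap_def
    by (intro bigo_power_cmult bigo_square_mult bigo_even_power_add bigo_even_power_diff
        bigo_even_power_sum cl | assumption | simp)+
  then obtain c where "0 < c" and c: "\<And>P Q U V. \<bar>(h * (\<Sum>i\<in>I. 2 * (U i * (P i * P i + Q i * Q i)) - U i * U i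
      - 4 * (V i * V i) + U i * A U i + 2 * (P i * A P i) + 2 * (Q i * A Q i)))\<^sup>2\<bar> \<le> c * \<bar>G (P, Q, U, V)\<bar>"
    by (auto elim!: landau_o.bigE simp: ev)
  show ?thesis
  proof (rule that[of c])
    show "0 \<le> c" using \<open>0 < c\<close> by simp
    fix P Q U V
    show "(energy a b M P Q U V)\<^sup>2 \<le> c * (1 + quart U V + nsq M P Q ^ 4)"
      using c[of U P Q V] unfolding Gabs energy_eq_sum[OF h_nonneg] power2_eq_square by simp
  qed
qed

end

section \<open>Time integrals and exit times\<close>

text \<open>Fubini for a process with continuous paths; \<open>caratheodory_measurable\<close>
  provides the joint measurability, and the bound on first absolute moments the integrability on the
  product.\<close>

lemma (in prob_space) expectation_time_integral:
  fixes X :: "real \<Rightarrow> 'a \<Rightarrow> real"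
  assumes st: "s \<le> t"
    and cont: "\<And>w. w \<in> space M \<Longrightarrow> continuous_on {s..t} (\<lambda>r. X r w)"
    and int: "\<And>r. r \<in> {s..t} \<Longrightarrow> integrable M (X r)"
    and bound: "\<And>r. r \<in> {s..t} \<Longrightarrow> expectation (\<lambda>w. \<bar>X r w\<bar>) \<le> C"
  shows "integrable M (\<lambda>w. integral {s..t} (\<lambda>r. X r w))"
    "set_integrable lborel {s..t} (\<lambda>r. expectation (X r))"
    "expectation (\<lambda>w. integral {s..t} (\<lambda>r. X r w)) = (LBINT r:{s..t}. expectation (X r))"
    "\<bar>expectation (\<lambda>w. integral {s..t} (\<lambda>r. X r w))\<bar> \<le> C * (t - s)"
proof -
  interpret pair_sigma_finite lborel M ..
  define Y where "Y r = X (max s (min t r))" for r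
  have Y: "Y r = X r" if "r \<in> {s..t}" for r using that by (simp add: Y_def)
  have c: "max s (min t r) \<in> {s..t}" for r using st by auto
  define f where "f = (\<lambda>(r, w). indicator {s..t} r *\<^sub>R Y r w)"
  have Ym: "(\<lambda>(r, w). Y r w) \<in> borel_measurable (borel \<Otimes>\<^sub>M M)"
    unfolding Y_def by (rule caratheodory_measurable[OF st borel_measurable_integrable[OF int] cont])
  have Ym': "(\<lambda>p. Y (fst p) (snd p)) \<in> borel_measurable (lborel \<Otimes>\<^sub>M M)"
    using Ym by (simp add: case_prod_beta' cong: measurable_cong_sets sets_pair_measure_cong)
  have fm: "f \<in> borel_measurable (lborel \<Otimes>\<^sub>M M)"
    unfolding f_def case_prod_beta'
    by (intro borel_measurable_scaleR Ym' borel_measurable_indicator' ) measurable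
  have C: "0 \<le> C" using order_trans[OF _ bound[of s]] st by simp
  have int_abs: "integrable lborel (\<lambda>r. \<integral>w. norm (f (r, w)) \<partial>M)"
  proof (rule Bochner_Integration.integrable_bound)
    show "integrable lborel (\<lambda>r. C * indicator {s..t} r)"
      by (intro integrable_mult_right integrable_real_indicator) (use st in auto)
    show "(\<lambda>r. \<integral>w. norm (f (r, w)) \<partial>M) \<in> borel_measurable lborel"
      using fm by measurable
    have "norm (\<integral>w. norm (f (r, w)) \<partial>M) \<le> norm (C * indicator {s..t} r)" for r
    proof (cases "r \<in> {s..t}")
      case True
      then have "(\<integral>w. norm (f (r, w)) \<partial>M) = expectation (\<lambda>w. \<bar>X r w\<bar>)" by (simp add: f_def Y)
      then show ?thesis using bound[OF True] True C by simp
    qed (simp add: f_def)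
    then show "AE r in lborel. norm (\<integral>w. norm (f (r, w)) \<partial>M) \<le> norm (C * indicator {s..t} r)" by simp
  qed
  have fint: "integrable (lborel \<Otimes>\<^sub>M M) f"
  proof (rule Fubini_integrable[OF fm int_abs])
    show "AE r in lborel. integrable M (\<lambda>w. f (r, w))"
      using int[OF c] by (intro AE_I2) (simp add: f_def Y_def)
  qed
  have HK: "integral {s..t} (\<lambda>r. X r w) = (\<integral>r. f (r, w) \<partial>lborel)" if "w \<in> space M" for w
  proof -
    have "(\<integral>r. f (r, w) \<partial>lborel) = (LBINT r:{s..t}. X r w)"
      unfolding set_lebesgue_integral_def f_def
      by (intro Bochner_Integration.integral_cong refl) (simp add: Y indicator_def)
    then show ?thesis
      using set_borel_integral_eq_integral(2)[OF borel_integrable_atLeastAtMost'[OF cont[OF that]]] by simp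
  qed
  have swap: "integrable (M \<Otimes>\<^sub>M lborel) (\<lambda>(w, r). f (r, w))"
    using fint by (rule integrable_product_swap)
  interpret Q: pair_sigma_finite M lborel ..
  have "integrable M (\<lambda>w. \<integral>r. f (r, w) \<partial>lborel)"
    using Q.integrable_fst'[OF swap] by simp
  then show 1: "integrable M (\<lambda>w. integral {s..t} (\<lambda>r. X r w))"
    using HK by (simp cong: Bochner_Integration.integrable_cong)
  have E: "(\<integral>w. f (r, w) \<partial>M) = indicator {s..t} r *\<^sub>R expectation (X r)" for r
    by (cases "r \<in> {s..t}") (simp_all add: f_def Y)
  show 2: "set_integrable lborel {s..t} (\<lambda>r. expectation (X r))"
    using integrable_fst'[OF fint] by (simp add: set_integrable_def E)
  have "expectation (\<lambda>w. integral {s..t} (\<lambda>r. X r w)) = (\<integral>w. \<integral>r. f (r, w) \<partial>lborel \<partial>M)"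
    by (intro Bochner_Integration.integral_cong refl HK)
  also have "\<dots> = (\<integral>r. \<integral>w. f (r, w) \<partial>M \<partial>lborel)"
    using Fubini_integral[of "\<lambda>r w. f (r, w)"] fint by simp
  also have "\<dots> = (LBINT r:{s..t}. expectation (X r))" by (simp add: set_lebesgue_integral_def E)
  finally show 3: "expectation (\<lambda>w. integral {s..t} (\<lambda>r. X r w)) = (LBINT r:{s..t}. expectation (X r))" .
  have "\<bar>LBINT r:{s..t}. expectation (X r)\<bar> \<le> (\<integral>r. C * indicator {s..t} r \<partial>lborel)"
    unfolding set_lebesgue_integral_def
  proof (rule order_trans[OF integral_abs_bound], rule integral_mono)
    show "integrable lborel (\<lambda>r. \<bar>indicat_real {s..t} r *\<^sub>R expectation (X r)\<bar>)"
      using 2 unfolding set_integrable_def by simp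
    fix r :: real
    have "\<bar>expectation (X r)\<bar> \<le> C" if "r \<in> {s..t}"
      using order_trans[OF integral_abs_bound bound[OF that]] .
    then show "\<bar>indicat_real {s..t} r *\<^sub>R expectation (X r)\<bar> \<le> C * indicator {s..t} r"
      by (simp add: indicator_def)
  qed (intro integrable_mult_right integrable_real_indicator, use st in auto)
  also have "\<dots> = C * (t - s)" using st by simp
  finally show "\<bar>expectation (\<lambda>w. integral {s..t} (\<lambda>r. X r w))\<bar> \<le> C * (t - s)"
    unfolding 3 .
qed

text \<open>Inserting \<open>0\<close> gives the value \<open>0\<close> when already \<open>m 0 > R\<close>.\<close>

definition last_time :: "real \<Rightarrow> (real \<Rightarrow> real) \<Rightarrow> real \<Rightarrow> real" where
  "last_time T m R = Sup (insert 0 {s \<in> {0..T}. \<forall>r\<in>{0..s}. m r \<le> R})"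

lemma last_time_bounds:
  assumes "0 \<le> T"
  shows "0 \<le> last_time T m R" "last_time T m R \<le> T"
proof -
  have "bdd_above (insert 0 {s \<in> {0..T}. \<forall>r\<in>{0..s}. m r \<le> R})" by (auto intro!: bdd_aboveI[of _ T] assms)
  then show "0 \<le> last_time T m R" unfolding last_time_def by (intro cSup_upper) auto
  show "last_time T m R \<le> T" unfolding last_time_def using assms by (intro cSup_least) auto
qed

text \<open>By continuity, rational times suffice, because their closure in an interval of positive
  length is the whole closed interval. Thus the event is decided by countably many values strictly
  before \<open>r\<close>.\<close>

lemma le_last_time_iff:
  assumes r: "0 < r" "r \<le> T" and cont: "continuous_on {0..T} m"
  shows "r \<le> last_time T m R \<longleftrightarrow> (\<forall>q\<in>{0<..<r} \<inter> \<rat>. m q \<le> R)"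
proof
  let ?S = "insert 0 {s \<in> {0..T}. \<forall>r\<in>{0..s}. m r \<le> R}"
  have bdd: "bdd_above ?S" using r by (auto intro!: bdd_aboveI[of _ T])
  assume le: "r \<le> last_time T m R"
  show "\<forall>q\<in>{0<..<r} \<inter> \<rat>. m q \<le> R"
  proof
    fix q assume q: "q \<in> {0<..<r} \<inter> \<rat>"
    then have "q < Sup ?S" using le by (simp add: last_time_def)
    then obtain s where "s \<in> ?S" "q < s" using less_cSup_iff[OF _ bdd] by blast
    with q show "m q \<le> R" by auto
  qed
next
  let ?S = "insert 0 {s \<in> {0..T}. \<forall>r\<in>{0..s}. m r \<le> R}"
  have bdd: "bdd_above ?S" using r by (auto intro!: bdd_aboveI[of _ T])
  assume le: "\<forall>q\<in>{0<..<r} \<inter> \<rat>. m q \<le> R"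
  have cl: "closure ({0<..<r} \<inter> \<rat>) = {0..r}"
    using closure_open_Int_superset[of "{0<..<r}" \<rat>] r by (simp add: Rats_closure_real)
  have "m ` closure ({0<..<r} \<inter> \<rat>) \<subseteq> {..R}"
    by (rule image_closure_subset) (use le r in \<open>auto simp: cl intro: continuous_on_subset[OF cont]\<close>)
  then have "r \<in> ?S" using r by (auto simp: cl image_subset_iff)
  then show "r \<le> last_time T m R" unfolding last_time_def by (intro cSup_upper bdd)
qed

text \<open>The time \<open>r = 0\<close> is excluded because \<open>last_time\<close> is also 0
  when the path starts above \<open>R\<close>.\<close>

lemma le_before_last_time:
  assumes r: "0 < r" "r \<le> last_time T m R" "last_time T m R \<le> T" and cont: "continuous_on {0..T} m"
  shows "m r \<le> R"
proof -
  have rT: "r \<le> T" using r by simp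
  have cl: "closure ({0<..<r} \<inter> \<rat>) = {0..r}"
    using closure_open_Int_superset[of "{0<..<r}" \<rat>] r by (simp add: Rats_closure_real)
  have "m ` closure ({0<..<r} \<inter> \<rat>) \<subseteq> {..R}"
    by (rule image_closure_subset)
      (use le_last_time_iff[OF r(1) rT cont, of R] r rT in \<open>auto simp: cl intro: continuous_on_subset[OF cont]\<close>)
  then show ?thesis using r by (auto simp: cl image_subset_iff)
qed

text \<open>Continuous paths are bounded on \<open>{0..T}\<close>. Equality for large
  \<open>n\<close>, not mere convergence, makes truncated and original quantities eventually
  coincide.\<close>

lemma last_time_eventually:
  assumes T: "0 < T" and cont: "continuous_on {0..T} m"
  shows "eventually (\<lambda>n. last_time T m (real n) = T) sequentially"
proof -
  have "compact (m ` {0..T})" by (intro compact_continuous_image cont compact_Icc)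
  then obtain B where B: "\<forall>x\<in>m ` {0..T}. norm x \<le> B" using compact_imp_bounded bounded_iff by metis
  obtain N where N: "B \<le> real N" using real_arch_simple by blast
  show ?thesis
  proof (rule eventually_sequentiallyI[of N])
    fix n assume "N \<le> n"
    then have "real N \<le> real n" by simp
    have "m q \<le> real n" if "q \<in> {0..T}" for q
    proof -
      have "norm (m q) \<le> B" using B that by blast
      then show ?thesis using N \<open>real N \<le> real n\<close> by simp
    qed
    then have "T \<le> last_time T m (real n)" using T by (subst le_last_time_iff[OF T _ cont]) auto
    then show "last_time T m (real n) = T" using last_time_bounds[of T m n] T by simp
  qed
qed

text \<open>The stopping-time property. By \<open>le_last_time_iff\<close> the event is a countable
  intersection over rational times below \<open>x <= t\<close>, all of them observable at time
  \<open>t\<close>.\<close>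

lemma min_last_time_measurable:
  assumes t: "t \<in> {0..T}" and sp: "\<And>r. r \<in> {0..t} \<Longrightarrow> subalgebra N (G r)"
    and mono: "\<And>r. r \<in> {0..t} \<Longrightarrow> sets (G r) \<subseteq> sets (G t)"
    and meas: "\<And>r. r \<in> {0..t} \<Longrightarrow> m r \<in> borel_measurable (G r)"
    and cont: "\<And>w. w \<in> space N \<Longrightarrow> continuous_on {0..T} (\<lambda>r. m r w)"
  shows "(\<lambda>w. min t (last_time T (\<lambda>r. m r w) R)) \<in> borel_measurable (G t)"
  unfolding borel_measurable_iff_ge
proof
  fix x :: real
  have spG: "space (G r) = space N" if "r \<in> {0..t}" for r using sp[OF that] by (simp add: subalgebra_def)
  have tt: "t \<in> {0..t}" using t by auto
  consider "x \<le> 0" | "0 < x" "x \<le> t" | "t < x" by linarith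
  then show "{w \<in> space (G t). x \<le> min t (last_time T (\<lambda>r. m r w) R)} \<in> sets (G t)"
  proof cases
    case 1
    then have "{w \<in> space (G t). x \<le> min t (last_time T (\<lambda>r. m r w) R)} = space (G t)"
      using t last_time_bounds(1)[of T _ R] by (auto intro: order_trans)
    then show ?thesis by simp
  next
    case 2
    have "{w \<in> space (G t). x \<le> min t (last_time T (\<lambda>r. m r w) R)}
        = {w \<in> space (G t). \<forall>q\<in>{0<..<x} \<inter> \<rat>. m q w \<le> R}"
      using 2 t spG[OF tt] le_last_time_iff[OF 2(1) _ cont] by auto
    also have "\<dots> = {w \<in> space (G t). \<forall>q :: rat. of_rat q \<in> {0<..<x} \<longrightarrow> m (of_rat q) w \<le> R}"
      by (auto simp: Rats_def)
    also have "\<dots> \<in> sets (G t)"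
    proof (rule sets.sets_Collect_countable_All)
      fix q :: rat
      show "{w \<in> space (G t). of_rat q \<in> {0<..<x} \<longrightarrow> m (of_rat q) w \<le> R} \<in> sets (G t)"
      proof (cases "of_rat q \<in> {0<..<x}")
        case True
        then have q: "of_rat q \<in> {0..t}" using 2 by auto
        have "{w \<in> space (G (of_rat q)). m (of_rat q) w \<le> R} \<in> sets (G (of_rat q))"
          using meas[OF q] by measurable
        then have "{w \<in> space (G t). m (of_rat q) w \<le> R} \<in> sets (G t)"
          using mono[OF q] spG[OF q] spG[OF tt] by auto
        then show ?thesis unfolding eqTrueI[OF True] by simp
      next
        case False
        then have "{w \<in> space (G t). of_rat q \<in> {0<..<x} \<longrightarrow> m (of_rat q) w \<le> R} = space (G t)"
          by blast
        then show ?thesis by (simp only: sets.top)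
      qed
    qed
    finally show ?thesis .
  next
    case 3
    then have "{w \<in> space (G t). x \<le> min t (last_time T (\<lambda>r. m r w) R)} = {}"
      by (metis (mono_tags, lifting) Collect_empty_eq min.bounded_iff not_le)
    then show ?thesis by (simp only: sets.empty_sets)
  qed
qed

text \<open>Composition of \<open>(\<sigma> w, w)\<close> with the jointly measurable
  process.\<close>

lemma stopped_measurable:
  fixes X :: "real \<Rightarrow> 'w \<Rightarrow> real"
  assumes t: "0 \<le> t" and X: "\<And>r. r \<in> {0..t} \<Longrightarrow> X r \<in> borel_measurable G"
    and cont: "\<And>w. w \<in> space G \<Longrightarrow> continuous_on {0..t} (\<lambda>r. X r w)"
    and \<sigma>: "\<sigma> \<in> borel_measurable G" "\<And>w. w \<in> space G \<Longrightarrow> \<sigma> w \<in> {0..t}"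
  shows "(\<lambda>w. X (\<sigma> w) w) \<in> borel_measurable G"
proof -
  have "(\<lambda>w. (\<sigma> w, w)) \<in> measurable G (borel \<Otimes>\<^sub>M G)" using \<sigma>(1) by measurable
  from measurable_compose[OF this caratheodory_measurable[OF t X cont]]
  have "(\<lambda>w. X (max 0 (min t (\<sigma> w))) w) \<in> borel_measurable G" by simp
  moreover have "max 0 (min t (\<sigma> w)) = \<sigma> w" if "w \<in> space G" for w using \<sigma>(2)[OF that] by auto
  ultimately show ?thesis by (simp cong: measurable_cong)
qed

section \<open>The truncated process\<close>

text \<open>The noise is assumed in a regularized form: all its paths are continuous and start at 0.
  The filtration \<open>G\<close> is kept abstract, so that it can be the augmented one.\<close>

locale kgs_noise = prob_space \<Omega> + kgs_data a b C1 C2 T M e1 e2 P0 Q0 U0 V0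
  for \<Omega> :: "'w measure" and a b C1 C2 T :: real and M :: nat and e1 e2 P0 Q0 U0 V0 :: "nat \<Rightarrow> real" +
  fixes G :: "real \<Rightarrow> 'w measure" and W :: "nat \<Rightarrow> real \<Rightarrow> 'w \<Rightarrow> real"
    and P Q U V :: "real \<Rightarrow> 'w \<Rightarrow> nat \<Rightarrow> real"
  assumes G_sub: "t \<in> {0..T} \<Longrightarrow> subalgebra \<Omega> (G t)"
    and G_mono: "0 \<le> s \<Longrightarrow> s \<le> t \<Longrightarrow> t \<le> T \<Longrightarrow> sets (G s) \<subseteq> sets (G t)"
    and W_meas: "k \<in> {0, 1, 2} \<Longrightarrow> t \<in> {0..T} \<Longrightarrow> W k t \<in> borel_measurable (G t)"
    and W_cont: "k \<in> {0, 1, 2} \<Longrightarrow> w \<in> space \<Omega> \<Longrightarrow> continuous_on {0..T} (\<lambda>t. W k t w)"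
    and W_0: "k \<in> {0, 1, 2} \<Longrightarrow> W k 0 w = 0"
    and W_normal: "k \<in> {0, 1, 2} \<Longrightarrow> 0 \<le> s \<Longrightarrow> s < t \<Longrightarrow> t \<le> T \<Longrightarrow>
      distributed \<Omega> lborel (\<lambda>w. W k t w - W k s w) (normal_density 0 (sqrt (t - s)))"
    and W_indep: "k \<in> {0, 1, 2} \<Longrightarrow> 0 \<le> s \<Longrightarrow> s < t \<Longrightarrow> t \<le> T \<Longrightarrow> Z \<in> borel_measurable (G s) \<Longrightarrow>
      indep_var borel Z borel (\<lambda>w. W k t w - W k s w)"
    and X_meas: "i \<in> {1..<M} \<Longrightarrow> t \<in> {0..T} \<Longrightarrow> (\<lambda>w. P t w i) \<in> borel_measurable (G t)"
      "i \<in> {1..<M} \<Longrightarrow> t \<in> {0..T} \<Longrightarrow> (\<lambda>w. Q t w i) \<in> borel_measurable (G t)"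
      "i \<in> {1..<M} \<Longrightarrow> t \<in> {0..T} \<Longrightarrow> (\<lambda>w. U t w i) \<in> borel_measurable (G t)"
      "i \<in> {1..<M} \<Longrightarrow> t \<in> {0..T} \<Longrightarrow> (\<lambda>w. V t w i) \<in> borel_measurable (G t)"
    and X_cont: "i \<in> {1..<M} \<Longrightarrow> w \<in> space \<Omega> \<Longrightarrow> continuous_on {0..T} (\<lambda>t. P t w i)"
      "i \<in> {1..<M} \<Longrightarrow> w \<in> space \<Omega> \<Longrightarrow> continuous_on {0..T} (\<lambda>t. Q t w i)"
      "i \<in> {1..<M} \<Longrightarrow> w \<in> space \<Omega> \<Longrightarrow> continuous_on {0..T} (\<lambda>t. U t w i)"
      "i \<in> {1..<M} \<Longrightarrow> w \<in> space \<Omega> \<Longrightarrow> continuous_on {0..T} (\<lambda>t. V t w i)"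
    and path_AE: "AE w in \<Omega>. is_path (\<lambda>k t. W k t w) (\<lambda>t. P t w) (\<lambda>t. Q t w) (\<lambda>t. U t w) (\<lambda>t. V t w)"
begin

abbreviation "E \<equiv> expectation"

lemma G_measurable_mono:
  assumes "f \<in> borel_measurable (G s)" "0 \<le> s" "s \<le> t" "t \<le> T"
  shows "f \<in> borel_measurable (G t)"
proof (rule measurable_from_subalg[OF _ assms(1)])
  show "subalgebra (G t) (G s)"
    using G_sub[of s] G_sub[of t] G_mono[of s t] assms by (auto simp: subalgebra_def)
qed

lemma G_measurable_space:
  assumes "f \<in> borel_measurable (G s)" "0 \<le> s" "s \<le> T"
  shows "f \<in> borel_measurable \<Omega>"
  using measurable_from_subalg[OF G_sub assms(1)] assms by auto

lemma space_G: "t \<in> {0..T} \<Longrightarrow> space (G t) = space \<Omega>"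
  using G_sub by (simp add: subalgebra_def)

lemma increment_moments:
  assumes "k \<in> {0, 1, 2}" "0 \<le> s" "s < t" "t \<le> T"
  shows "all_moments \<Omega> (\<lambda>w. W k t w - W k s w)"
    "E (\<lambda>w. W k t w - W k s w) = 0"
    "E (\<lambda>w. (W k t w - W k s w)\<^sup>2) = t - s"
    "E (\<lambda>w. (W k t w - W k s w) ^ 8) = 105 * (t - s) ^ 4"
    "E (\<lambda>w. \<bar>W k t w - W k s w\<bar>) \<le> sqrt (t - s)"
proof -
  have "0 < sqrt (t - s)" using assms by simp
  note nm = normal_moments[OF W_normal[OF assms] this]
  have "sqrt (t - s) ^ 8 = ((sqrt (t - s))\<^sup>2) ^ 4" by (simp add: power_mult[symmetric])
  also have "\<dots> = (t - s) ^ 4" using assms by simp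
  finally have s8: "sqrt (t - s) ^ 8 = (t - s) ^ 4" .
  show "all_moments \<Omega> (\<lambda>w. W k t w - W k s w)"
    "E (\<lambda>w. W k t w - W k s w) = 0"
    "E (\<lambda>w. \<bar>W k t w - W k s w\<bar>) \<le> sqrt (t - s)"
    by (rule nm(1), rule nm(2), rule nm(5))
  show "E (\<lambda>w. (W k t w - W k s w)\<^sup>2) = t - s" using nm(3) assms by simp
  show "E (\<lambda>w. (W k t w - W k s w) ^ 8) = 105 * (t - s) ^ 4" using nm(4) s8 by simp
qed

lemma W_moments:
  assumes "k \<in> {0, 1, 2}" "t \<in> {0..T}"
  shows "all_moments \<Omega> (W k t)" "E (\<lambda>w. W k t w ^ 4) \<le> 1 + 105 * T ^ 4"
proof -
  show am: "all_moments \<Omega> (W k t)"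
  proof (cases "t = 0")
    case True
    have "W k 0 = (\<lambda>_. 0)" by (intro ext W_0 assms(1))
    then show ?thesis using True all_moments_const[of 0] by simp
  next
    case False
    then show ?thesis using increment_moments(1)[of k 0 t] assms W_0[OF assms(1)] by simp
  qed
  have E8: "E (\<lambda>w. W k t w ^ 8) = 105 * t ^ 4"
  proof (cases "t = 0")
    case True then show ?thesis using W_0[OF assms(1)] by simp
  next
    case False
    then show ?thesis using increment_moments(4)[of k 0 t] assms W_0[OF assms(1)] by simp
  qed
  have int: "integrable \<Omega> (\<lambda>w. W k t w ^ j)" for j
    by (intro all_moments_integrable all_moments_power am)
  have "x ^ 4 \<le> 1 + x ^ 8" for x :: real
  proof -
    have "2 * x ^ 4 \<le> x ^ 8 + 1" using sum_squares_bound[of "x ^ 4" 1] by (simp add: power_mult[symmetric])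
    moreover have "0 \<le> x ^ 4" by simp
    ultimately show ?thesis by linarith
  qed
  then have "E (\<lambda>w. W k t w ^ 4) \<le> E (\<lambda>w. 1 + W k t w ^ 8)"
    using int by (intro integral_mono) auto
  also have "\<dots> = 1 + 105 * t ^ 4" using int E8 by (simp add: prob_space)
  also have "\<dots> \<le> 1 + 105 * T ^ 4" using assms by (simp add: power_mono)
  finally show "E (\<lambda>w. W k t w ^ 4) \<le> 1 + 105 * T ^ 4" .
qed

text \<open>This takes the place of the martingale property and the Ito isometry: a factor known at
  time \<open>s\<close> is independent of the increment, so linear terms vanish in mean and squares
  produce \<open>t - s\<close>.\<close>

lemma expectation_increment_mult:
  assumes k: "k \<in> {0, 1, 2}" and st: "0 \<le> s" "s < t" "t \<le> T"
    and Z: "Z \<in> borel_measurable (G s)" "integrable \<Omega> Z"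
  shows "integrable \<Omega> (\<lambda>w. Z w * (W k t w - W k s w))"
    "E (\<lambda>w. Z w * (W k t w - W k s w)) = 0"
    "integrable \<Omega> (\<lambda>w. Z w * (W k t w - W k s w)\<^sup>2)"
    "E (\<lambda>w. Z w * (W k t w - W k s w)\<^sup>2) = (t - s) * E Z"
proof -
  note im = increment_moments[OF k st]
  note ind = W_indep[OF k st Z(1)]
  have ind2: "indep_var borel Z borel (\<lambda>w. (W k t w - W k s w)\<^sup>2)"
    using indep_var_compose[OF ind, of "\<lambda>x. x" borel "\<lambda>x. x\<^sup>2" borel] by (simp add: o_def)
  have i1: "integrable \<Omega> (\<lambda>w. W k t w - W k s w)" by (rule all_moments_integrable[OF im(1)])
  have i2: "integrable \<Omega> (\<lambda>w. (W k t w - W k s w)\<^sup>2)"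
    by (rule all_moments_integrable[OF all_moments_power[OF im(1)]])
  show "integrable \<Omega> (\<lambda>w. Z w * (W k t w - W k s w))"
    "integrable \<Omega> (\<lambda>w. Z w * (W k t w - W k s w)\<^sup>2)"
    by (rule indep_var_integrable[OF ind Z(2) i1], rule indep_var_integrable[OF ind2 Z(2) i2])
  show "E (\<lambda>w. Z w * (W k t w - W k s w)) = 0"
    using indep_var_lebesgue_integral[OF ind Z(2) i1] im(2) by simp
  show "E (\<lambda>w. Z w * (W k t w - W k s w)\<^sup>2) = (t - s) * E Z"
    using indep_var_lebesgue_integral[OF ind2 Z(2) i2] im(3) by simp
qed

text \<open>For an increment over a time d <= T the two parts of \<open>err\<close> have means at
  most sqrt d and 105 * d^4, and d^4 <= sqrt T ^ 7 * sqrt d.\<close>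

definition "Cerr = 1 + 105 * sqrt T ^ 7"

lemma Cerr_nonneg: "0 \<le> Cerr"
  using T by (simp add: Cerr_def)

lemma err_moments:
  assumes k: "k \<in> {0, 1, 2}" and st: "0 \<le> s" "s \<le> t" "t \<le> T"
  shows "integrable \<Omega> (\<lambda>w. err (W k t w - W k s w))"
    "E (\<lambda>w. err (W k t w - W k s w)) \<le> Cerr * sqrt (t - s)"
proof -
  have "integrable \<Omega> (\<lambda>w. err (W k t w - W k s w)) \<and>
    E (\<lambda>w. err (W k t w - W k s w)) \<le> Cerr * sqrt (t - s)"
  proof (cases "s = t")
    case True then show ?thesis by (simp add: err_def)
  next
    case False
    with st have st': "s < t" by simp
    note im = increment_moments[OF k st(1) st' st(3)]
    have i: "integrable \<Omega> (\<lambda>w. \<bar>W k t w - W k s w\<bar>)" "integrable \<Omega> (\<lambda>w. (W k t w - W k s w) ^ 8)"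
      by (intro all_moments_integrable all_moments_power all_moments_abs im(1))+
    have p: "(x\<^sup>2) ^ 4 = x ^ 7 * x" for x :: real by (simp add: eval_nat_numeral)
    have "(t - s) ^ 4 = ((sqrt (t - s))\<^sup>2) ^ 4" using st by simp
    also have "\<dots> = sqrt (t - s) ^ 7 * sqrt (t - s)" by (rule p)
    also have "\<dots> \<le> sqrt T ^ 7 * sqrt (t - s)" using st by (intro mult_right_mono power_mono) auto
    finally have "105 * (t - s) ^ 4 \<le> 105 * sqrt T ^ 7 * sqrt (t - s)" by simp
    then have "E (\<lambda>w. err (W k t w - W k s w)) \<le> Cerr * sqrt (t - s)"
      unfolding err_def Cerr_def using i im(4,5) by (simp add: distrib_right)
    then show ?thesis using i by (simp add: err_def)
  qed
  then show "integrable \<Omega> (\<lambda>w. err (W k t w - W k s w))"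
    "E (\<lambda>w. err (W k t w - W k s w)) \<le> Cerr * sqrt (t - s)" by auto
qed

definition "err3 s t w = err_integral (\<lambda>k t. W k t w) s t"

text \<open>Three noises with mean error of order sqrt (t - s) each, integrated over a time t - s:
  this is the exponent 3/2.\<close>

lemma err3_moments:
  assumes st: "0 \<le> s" "s \<le> t" "t \<le> T"
  shows "integrable \<Omega> (err3 s t)" "E (err3 s t) \<le> 3 * Cerr * ((t - s) * sqrt (t - s))"
proof -
  let ?X = "\<lambda>r w. err (W 1 t w - W 1 r w) + err (W 0 t w - W 0 r w) + err (W 2 t w - W 2 r w)"
  have cont: "continuous_on {s..t} (\<lambda>r. ?X r w)" if "w \<in> space \<Omega>" for w
    unfolding err_def
    by (intro continuous_intros continuous_on_subset[OF W_cont]) (use st that in auto)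
  have int: "integrable \<Omega> (?X r)" if "r \<in> {s..t}" for r
    using that st by (intro Bochner_Integration.integrable_add err_moments) auto
  have bound: "E (\<lambda>w. \<bar>?X r w\<bar>) \<le> 3 * Cerr * sqrt (t - s)" if r: "r \<in> {s..t}" for r
  proof -
    have "E (\<lambda>w. \<bar>?X r w\<bar>) = E (?X r)" by (simp add: add_nonneg_nonneg)
    also have "\<dots> = E (\<lambda>w. err (W 1 t w - W 1 r w)) + E (\<lambda>w. err (W 0 t w - W 0 r w))
        + E (\<lambda>w. err (W 2 t w - W 2 r w))"
      using err_moments(1)[of _ r t] r st by (subst Bochner_Integration.integral_add; simp)+
    also have "\<dots> \<le> Cerr * sqrt (t - r) + Cerr * sqrt (t - r) + Cerr * sqrt (t - r)"
      using r st by (intro add_mono err_moments) auto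
    also have "\<dots> = 3 * Cerr * sqrt (t - r)" by simp
    also have "\<dots> \<le> 3 * Cerr * sqrt (t - s)" using r Cerr_nonneg by (intro mult_left_mono) auto
    finally show ?thesis .
  qed
  note eti = expectation_time_integral[of s t ?X, OF st(2) cont int bound]
  show "integrable \<Omega> (err3 s t)" using eti(1) by (simp add: err3_def[abs_def] err_integral_def)
  have "\<bar>E (err3 s t)\<bar> \<le> 3 * Cerr * sqrt (t - s) * (t - s)" using eti(4) by (simp add: err3_def[abs_def] err_integral_def)
  then show "E (err3 s t) \<le> 3 * Cerr * ((t - s) * sqrt (t - s))" by (simp add: mult_ac)
qed

section \<open>Truncation at the exit time\<close>

definition "absum t w = (\<Sum>i\<in>I. \<bar>P t w i\<bar> + \<bar>Q t w i\<bar> + \<bar>U t w i\<bar> + \<bar>V t w i\<bar>)"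

text \<open>For \<open>R\<close> above this level the truncation bound holds at time 0 too, where
  \<open>last_time\<close> alone does not guarantee it.\<close>

definition "R0 = (\<Sum>i\<in>I. \<bar>P0 i\<bar> + \<bar>Q0 i\<bar> + \<bar>U0 i\<bar> + \<bar>V0 i\<bar>)"

definition "tau R w = last_time T (\<lambda>t. absum t w) R"

definition "YP R t w = sP (\<lambda>k t. W k t w) (\<lambda>t. P t w) (tau R w) t"
definition "YQ R t w = sQ (\<lambda>k t. W k t w) (\<lambda>t. Q t w) (tau R w) t"
definition "YU R t w = sU (\<lambda>t. U t w) (tau R w) t"
definition "YV R t w = sV (\<lambda>k t. W k t w) (\<lambda>t. V t w) (tau R w) t"

lemmas Y_defs = YP_def YQ_def YU_def YV_def

lemma absum_cont: "w \<in> space \<Omega> \<Longrightarrow> continuous_on {0..T} (\<lambda>t. absum t w)"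
  unfolding absum_def by (intro continuous_intros X_cont)

lemma tau_bounds: "0 \<le> tau R w" "tau R w \<le> T"
  using last_time_bounds[of T] T by (auto simp: tau_def)

lemma comp_le_absum:
  assumes "i \<in> I"
  shows "\<bar>P t w i\<bar> \<le> absum t w \<and> \<bar>Q t w i\<bar> \<le> absum t w \<and> \<bar>U t w i\<bar> \<le> absum t w \<and> \<bar>V t w i\<bar> \<le> absum t w"
proof -
  have "\<bar>P t w i\<bar> + \<bar>Q t w i\<bar> + \<bar>U t w i\<bar> + \<bar>V t w i\<bar> \<le> absum t w"
    unfolding absum_def using assms by (intro member_le_sum) auto
  then show ?thesis by linarith
qed

lemma initial_AE: "AE w in \<Omega>. \<forall>i\<in>I. P 0 w i = P0 i \<and> Q 0 w i = Q0 i \<and> U 0 w i = U0 i \<and> V 0 w i = V0 i"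
  using path_AE
proof eventually_elim
  case (elim w)
  show ?case using path_eqs[OF elim, of _ 0] T W_0 by simp
qed

lemma bdd_AE:
  assumes R: "R0 \<le> R"
  shows "AE w in \<Omega>. bdd R (tau R w) (\<lambda>t. P t w) (\<lambda>t. Q t w) (\<lambda>t. U t w) (\<lambda>t. V t w)"
  using initial_AE AE_space
proof eventually_elim
  case (elim w)
  have 0: "absum 0 w \<le> R" using R elim(1) by (simp add: absum_def R0_def)
  have "absum r w \<le> R" if r: "r \<in> {0..tau R w}" for r
  proof (cases "r = 0")
    case False
    then show ?thesis using le_before_last_time[OF _ _ _ absum_cont[OF elim(2)], of r R] r tau_bounds[of R w]
      by (simp add: tau_def)
  qed (simp add: 0)
  then show ?case using comp_le_absum[of _ _ w] unfolding bdd_def comp_le_def by (meson order_trans)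
qed

lemma Y_measurable:
  assumes i: "i \<in> I" and t: "t \<in> {0..T}"
  shows "(\<lambda>w. YP R t w i) \<in> borel_measurable (G t)" "(\<lambda>w. YQ R t w i) \<in> borel_measurable (G t)"
    "(\<lambda>w. YU R t w i) \<in> borel_measurable (G t)" "(\<lambda>w. YV R t w i) \<in> borel_measurable (G t)"
proof -
  have absum_meas: "absum r \<in> borel_measurable (G r)" if "r \<in> {0..T}" for r
    unfolding absum_def[abs_def] by (intro borel_measurable_sum borel_measurable_add borel_measurable_abs X_meas that)
  have \<sigma>: "(\<lambda>w. min t (tau R w)) \<in> borel_measurable (G t)"
    unfolding tau_def
  proof (rule min_last_time_measurable[of t T \<Omega> G absum])
    fix r assume r: "r \<in> {0..t}"
    then have "r \<in> {0..T}" using t by auto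
    then show "subalgebra \<Omega> (G r)" by (rule G_sub)
    show "absum r \<in> borel_measurable (G r)" by (rule absum_meas) fact
    show "sets (G r) \<subseteq> sets (G t)" using r t by (intro G_mono) auto
  qed (use t absum_cont in auto)
  have stop: "(\<lambda>w. X (min t (tau R w)) w) \<in> borel_measurable (G t)"
    if X: "\<And>r. r \<in> {0..T} \<Longrightarrow> X r \<in> borel_measurable (G r)"
      "\<And>w. w \<in> space \<Omega> \<Longrightarrow> continuous_on {0..T} (\<lambda>r. X r w)" for X :: "real \<Rightarrow> 'w \<Rightarrow> real"
  proof (rule stopped_measurable[where t = t and X = X and \<sigma> = "\<lambda>w. min t (tau R w)"])
    show "X r \<in> borel_measurable (G t)" if "r \<in> {0..t}" for r
      using that t by (intro G_measurable_mono[OF X(1)]) auto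
    show "continuous_on {0..t} (\<lambda>r. X r w)" if "w \<in> space (G t)" for w
      using that t space_G[OF t] by (intro continuous_on_subset[OF X(2)]) auto
  qed (use t tau_bounds \<sigma> in auto)
  show "(\<lambda>w. YP R t w i) \<in> borel_measurable (G t)"
    unfolding YP_def sP_def
    by (intro borel_measurable_add borel_measurable_diff borel_measurable_times borel_measurable_const
        stop[of "\<lambda>t w. P t w i"] stop[of "W 1"] W_meas X_meas X_cont W_cont i t) simp_all
  show "(\<lambda>w. YQ R t w i) \<in> borel_measurable (G t)"
    unfolding YQ_def sQ_def
    by (intro borel_measurable_add borel_measurable_diff borel_measurable_times borel_measurable_const
        stop[of "\<lambda>t w. Q t w i"] stop[of "W 0"] W_meas X_meas X_cont W_cont i t) simp_all
  show "(\<lambda>w. YU R t w i) \<in> borel_measurable (G t)"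
    unfolding YU_def sU_def by (intro stop[of "\<lambda>t w. U t w i"] X_meas X_cont i)
  show "(\<lambda>w. YV R t w i) \<in> borel_measurable (G t)"
    unfolding YV_def sV_def
    by (intro borel_measurable_add borel_measurable_diff borel_measurable_times borel_measurable_const
        stop[of "\<lambda>t w. V t w i"] stop[of "W 2"] W_meas X_meas X_cont W_cont i t) simp_all
qed

lemma Y_cont:
  assumes i: "i \<in> I" and w: "w \<in> space \<Omega>"
  shows "continuous_on {0..T} (\<lambda>t. YP R t w i)" "continuous_on {0..T} (\<lambda>t. YQ R t w i)"
    "continuous_on {0..T} (\<lambda>t. YU R t w i)" "continuous_on {0..T} (\<lambda>t. YV R t w i)"
proof -
  have *: "continuous_on {0..T} (\<lambda>t. g (min t (tau R w)))" if "continuous_on {0..T} g" for g :: "real \<Rightarrow> real"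
    by (rule continuous_on_compose2[OF that]) (use tau_bounds[of R w] in \<open>auto intro!: continuous_intros\<close>)
  show "continuous_on {0..T} (\<lambda>t. YP R t w i)"
    unfolding YP_def sP_def by (intro continuous_intros *[OF X_cont(1)[OF i w]] *[OF W_cont] W_cont w) simp_all
  show "continuous_on {0..T} (\<lambda>t. YQ R t w i)"
    unfolding YQ_def sQ_def by (intro continuous_intros *[OF X_cont(2)[OF i w]] *[OF W_cont] W_cont w) simp_all
  show "continuous_on {0..T} (\<lambda>t. YU R t w i)"
    unfolding YU_def sU_def by (rule *[OF X_cont(3)[OF i w]])
  show "continuous_on {0..T} (\<lambda>t. YV R t w i)"
    unfolding YV_def sV_def by (intro continuous_intros *[OF X_cont(4)[OF i w]] *[OF W_cont] W_cont w) simp_all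
qed

lemma Y_moments:
  assumes R: "R0 \<le> R" and i: "i \<in> I" and t: "t \<in> {0..T}"
  shows "all_moments \<Omega> (\<lambda>w. YP R t w i)" "all_moments \<Omega> (\<lambda>w. YQ R t w i)"
    "all_moments \<Omega> (\<lambda>w. YU R t w i)" "all_moments \<Omega> (\<lambda>w. YV R t w i)"
proof -
  obtain K where K: "0 \<le> K" and KY: "\<And>w P Q U V \<tau> t i. is_path w P Q U V \<Longrightarrow> bdd R \<tau> P Q U V \<Longrightarrow>
      0 \<le> \<tau> \<Longrightarrow> \<tau> \<le> T \<Longrightarrow> t \<in> {0..T} \<Longrightarrow> i \<in> I \<Longrightarrow>
      \<bar>sP w P \<tau> t i\<bar> \<le> K * (1 + \<bar>w 1 t\<bar>) \<and> \<bar>sQ w Q \<tau> t i\<bar> \<le> K * (1 + \<bar>w 0 t\<bar>) \<and>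
      \<bar>sU U \<tau> t i\<bar> \<le> K \<and> \<bar>sV w V \<tau> t i\<bar> \<le> K * (1 + \<bar>w 2 t\<bar>)"
    by (rule stopped_bound[of R]) blast
  have ae: "AE w in \<Omega>. \<bar>YP R t w i\<bar> \<le> K * (1 + \<bar>W 1 t w\<bar>) \<and> \<bar>YQ R t w i\<bar> \<le> K * (1 + \<bar>W 0 t w\<bar>) \<and>
      \<bar>YU R t w i\<bar> \<le> K \<and> \<bar>YV R t w i\<bar> \<le> K * (1 + \<bar>W 2 t w\<bar>)"
    using path_AE bdd_AE[OF R]
  proof eventually_elim
    case (elim w)
    show ?case unfolding Y_defs by (rule KY[OF elim tau_bounds t i])
  qed
  have dom: "all_moments \<Omega> (\<lambda>w. K * (1 + \<bar>W k t w\<bar>))" if "k \<in> {0, 1, 2}" for k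
    by (intro all_moments_intros W_moments that t)
  have meas: "f \<in> borel_measurable \<Omega>" if "f \<in> borel_measurable (G t)" for f :: "'w \<Rightarrow> real"
    using G_measurable_space[OF that] t by auto
  have *: "all_moments \<Omega> Y" if "all_moments \<Omega> Z" "Y \<in> borel_measurable (G t)" "AE w in \<Omega>. \<bar>Y w\<bar> \<le> Z w" for Y Z
    by (rule all_moments_dominated[OF that(1) meas[OF that(2)]])
      (use that(3) in \<open>auto elim!: eventually_mono intro: order_trans[OF _ abs_ge_self]\<close>)
  show "all_moments \<Omega> (\<lambda>w. YP R t w i)"
    by (rule *[OF dom[of 1] Y_measurable(1)[OF i t]]) (use ae in auto)
  show "all_moments \<Omega> (\<lambda>w. YQ R t w i)"
    by (rule *[OF dom[of 0] Y_measurable(2)[OF i t]]) (use ae in auto)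
  show "all_moments \<Omega> (\<lambda>w. YU R t w i)"
    by (rule *[OF all_moments_const[of K] Y_measurable(3)[OF i t]]) (use ae in auto)
  show "all_moments \<Omega> (\<lambda>w. YV R t w i)"
    by (rule *[OF dom[of 2] Y_measurable(4)[OF i t]]) (use ae in auto)
qed

end

section \<open>Moment bounds and the energy identity for the truncated process\<close>

context kgs_noise
begin

definition "cf1 = (\<Sum>i\<in>I. (f1 i)\<^sup>2)"

lemma cf1_nonneg: "0 \<le> cf1"
  by (auto simp: cf1_def intro: sum_nonneg)

text \<open>The Gronwall bound for \<open>N ^ 4 + 1\<close>. The rate is 4000 = 2 * 2000, as two
  independent noises each contribute a variance t - s to the estimate of
  \<open>nsq4_perturb\<close>.\<close>

definition "CN = (nsq M P0 Q0 ^ 4 + 1) * exp (4000 * cf1 * T)"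

text \<open>The part of the mean energy growth that does not involve the state; in terms of the data
  it is \<open>4 * C1^2\<close> times the Laplacian form of \<open>e1\<close> minus
  \<open>C2^2\<close> times the squared norm of \<open>e2\<close>.\<close>

definition "c0 = h * (\<Sum>i\<in>I. 4 * (f1 i * A f1 i)) - h * (\<Sum>i\<in>I. 4 * (f2 i)\<^sup>2)"

context
  fixes R :: real assumes R: "R0 \<le> R"
begin

definition "N4 t w = nsq M (YP R t w) (YQ R t w) ^ 4"

definition "H t w = energy a b M (YP R t w) (YQ R t w) (YU R t w) (YV R t w)"

definition "UV4 t w = quart (YU R t w) (YV R t w)"

lemma nsq_moments: "t \<in> {0..T} \<Longrightarrow> all_moments \<Omega> (\<lambda>w. nsq M (YP R t w) (YQ R t w))"
  unfolding nsq_def by (intro all_moments_intros Y_moments[OF R])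

lemma nsq_meas: "t \<in> {0..T} \<Longrightarrow> (\<lambda>w. nsq M (YP R t w) (YQ R t w)) \<in> borel_measurable (G t)"
  unfolding nsq_def by (intro borel_measurable_sum borel_measurable_add borel_measurable_power Y_measurable)

lemma N4_moments: "t \<in> {0..T} \<Longrightarrow> all_moments \<Omega> (N4 t)"
  unfolding N4_def[abs_def] by (intro all_moments_power nsq_moments)

lemma UV4_moments: "t \<in> {0..T} \<Longrightarrow> all_moments \<Omega> (UV4 t)"
  unfolding UV4_def[abs_def] quart_def by (intro all_moments_intros Y_moments[OF R])

lemma H_moments: "t \<in> {0..T} \<Longrightarrow> all_moments \<Omega> (H t)"
  unfolding H_def[abs_def] energy_eq_sum[OF h_nonneg] lap_def
  by (intro all_moments_intros Y_moments[OF R])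

definition "N4_shift s t w = nsq4_shift (YP R s w) (YQ R s w) (W 1 t w - W 1 s w) (W 0 t w - W 0 s w)"

definition "H_shift s t w = energy_shift (YP R s w) (YQ R s w) (YU R s w) (YV R s w)
  (W 1 t w - W 1 s w) (W 0 t w - W 0 s w) (W 2 t w - W 2 s w)"

lemma one_step_AE:
  obtains K where "0 \<le> K"
    "\<And>s t. 0 \<le> s \<Longrightarrow> s \<le> t \<Longrightarrow> t \<le> T \<Longrightarrow> AE w in \<Omega>.
      \<bar>H t w - H_shift s t w\<bar> \<le> K * err3 s t w \<and> \<bar>N4 t w - N4_shift s t w\<bar> \<le> K * err3 s t w"
proof (rule one_step[of R])
  fix K assume K: "0 \<le> K"
    and *: "\<And>w P Q U V \<tau> s t. is_path w P Q U V \<Longrightarrow> bdd R \<tau> P Q U V \<Longrightarrow> 0 \<le> \<tau> \<Longrightarrow> \<tau> \<le> T \<Longrightarrow> 0 \<le> s \<Longrightarrow> s \<le> t \<Longrightarrow> t \<le> T \<Longrightarrow>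
      \<bar>energy a b M (sP w P \<tau> t) (sQ w Q \<tau> t) (sU U \<tau> t) (sV w V \<tau> t)
        - energy_shift (sP w P \<tau> s) (sQ w Q \<tau> s) (sU U \<tau> s) (sV w V \<tau> s) (w 1 t - w 1 s) (w 0 t - w 0 s) (w 2 t - w 2 s)\<bar>
        \<le> K * err_integral w s t \<and>
      \<bar>nsq M (sP w P \<tau> t) (sQ w Q \<tau> t) ^ 4 - nsq4_shift (sP w P \<tau> s) (sQ w Q \<tau> s) (w 1 t - w 1 s) (w 0 t - w 0 s)\<bar>
        \<le> K * err_integral w s t"
  show ?thesis
  proof (rule that[OF K])
    fix s t :: real assume st: "0 \<le> s" "s \<le> t" "t \<le> T"
    show "AE w in \<Omega>. \<bar>H t w - H_shift s t w\<bar> \<le> K * err3 s t w \<and> \<bar>N4 t w - N4_shift s t w\<bar> \<le> K * err3 s t w"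
      using path_AE bdd_AE[OF R]
    proof eventually_elim
      case (elim w)
      show ?case unfolding H_def N4_def H_shift_def N4_shift_def Y_defs err3_def by (rule *[OF elim tau_bounds st])
    qed
  qed
qed

text \<open>After the linear terms have vanished in mean, \<open>N ^ 3 <= N ^ 4 + 1\<close> closes
  the estimate. Only \<open>K\<close> depends on \<open>R\<close>, and
  \<open>discrete_Gronwall\<close> eliminates it.\<close>

lemma N4_step:
  obtains K where "0 \<le> K"
    "\<And>s t. 0 \<le> s \<Longrightarrow> s < t \<Longrightarrow> t \<le> T \<Longrightarrow>
      E (N4 t) \<le> E (N4 s) + 4000 * cf1 * (t - s) * (E (N4 s) + 1) + K * ((t - s) * sqrt (t - s))"
proof (rule one_step_AE)
  fix K assume K: "0 \<le> K"
    and *: "\<And>s t. 0 \<le> s \<Longrightarrow> s \<le> t \<Longrightarrow> t \<le> T \<Longrightarrow> AE w in \<Omega>.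
      \<bar>H t w - H_shift s t w\<bar> \<le> K * err3 s t w \<and> \<bar>N4 t w - N4_shift s t w\<bar> \<le> K * err3 s t w"
  \<comment> \<open>3360 = 16 * 2 * 105: the factor 2^4 of \<open>power_add_le\<close> and the
    eighth moments of two increments. The power \<open>sqrt T ^ 5\<close> reduces
    \<open>(t - s) ^ 4\<close> to the order 3/2.\<close>
  define K' where "K' = K * (3 * Cerr) + 2000 * (cf1 ^ 4 * 3360) * sqrt T ^ 5"
  show ?thesis
  proof (rule that[of K'])
    show "0 \<le> K'" using K Cerr_nonneg cf1_nonneg T by (simp add: K'_def)
  next
    fix s t :: real assume st: "0 \<le> s" "s < t" "t \<le> T"
    have s: "s \<in> {0..T}" and t: "t \<in> {0..T}" and st': "s \<le> t" using st by auto
    define N where "N w = nsq M (YP R s w) (YQ R s w)" for w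
    define D1 where "D1 w = W 1 t w - W 1 s w" for w
    define D0 where "D0 w = W 0 t w - W 0 s w" for w
    define Z1 where "Z1 w = N w ^ 3 * (\<Sum>i\<in>I. YP R s w i * f1 i)" for w
    define Z0 where "Z0 w = N w ^ 3 * (\<Sum>i\<in>I. YQ R s w i * f1 i)" for w
    \<comment> \<open>The fourth power of the sum of squares is split into eighth powers, so that no
      product of two different increments has to be averaged.\<close>
    define B where "B w = N4 s w + 8 * (Z1 w * D1 w - Z0 w * D0 w)
      + 2000 * (cf1 * (N w ^ 3 * (D1 w)\<^sup>2 + N w ^ 3 * (D0 w)\<^sup>2) + cf1 ^ 4 * (16 * (D1 w ^ 8 + D0 w ^ 8)))" for w
    have N0: "0 \<le> N w" for w by (simp add: N_def nsq_nonneg)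
    have Nm: "all_moments \<Omega> N" "N \<in> borel_measurable (G s)"
      unfolding N_def[abs_def] by (intro nsq_moments nsq_meas s)+
    have Zm: "all_moments \<Omega> Z1" "all_moments \<Omega> Z0"
      unfolding Z1_def[abs_def] Z0_def[abs_def] by (intro all_moments_intros Nm Y_moments[OF R] s | assumption)+
    have ZG: "Z1 \<in> borel_measurable (G s)" "Z0 \<in> borel_measurable (G s)" "(\<lambda>w. N w ^ 3) \<in> borel_measurable (G s)"
      unfolding Z1_def[abs_def] Z0_def[abs_def]
      by (intro borel_measurable_times borel_measurable_power borel_measurable_sum borel_measurable_const Nm Y_measurable s | assumption)+
    have N3i: "integrable \<Omega> (\<lambda>w. N w ^ 3)" by (intro all_moments_integrable all_moments_power Nm)
    have N4i: "integrable \<Omega> (N4 s)" "integrable \<Omega> (N4 t)" by (intro all_moments_integrable N4_moments s t)+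
    note m1 = expectation_increment_mult[of 1, OF _ st ZG(1) all_moments_integrable[OF Zm(1)], folded D1_def, simplified]
    note m0 = expectation_increment_mult[of 0, OF _ st ZG(2) all_moments_integrable[OF Zm(2)], folded D0_def, simplified]
    note q1 = expectation_increment_mult[of 1, OF _ st ZG(3) N3i, folded D1_def, simplified]
    note q0 = expectation_increment_mult[of 0, OF _ st ZG(3) N3i, folded D0_def, simplified]
    have D8: "integrable \<Omega> (\<lambda>w. D1 w ^ 8)" "integrable \<Omega> (\<lambda>w. D0 w ^ 8)"
      "E (\<lambda>w. D1 w ^ 8) = 105 * (t - s) ^ 4" "E (\<lambda>w. D0 w ^ 8) = 105 * (t - s) ^ 4"
      unfolding D1_def D0_def
      using all_moments_integrable[OF all_moments_power[OF increment_moments(1)[OF _ st]]] increment_moments(4)[OF _ st]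
      by auto
    have "AE w in \<Omega>. N4 t w \<le> B w + K * err3 s t w"
      using *[OF st(1) st' st(3)]
    proof eventually_elim
      case (elim w)
      have p8: "(cf1 * ((D1 w)\<^sup>2 + (D0 w)\<^sup>2)) ^ 4 \<le> cf1 ^ 4 * (16 * (D1 w ^ 8 + D0 w ^ 8))"
        using power_add_le[of "(D1 w)\<^sup>2" "(D0 w)\<^sup>2" 4] cf1_nonneg
        by (simp add: power_mult_distrib mult_left_mono power_mult[symmetric])
      have "N4_shift s t w
        \<le> N4 s w + 8 * (Z1 w * D1 w - Z0 w * D0 w)
          + 2000 * (N w ^ 3 * (cf1 * ((D1 w)\<^sup>2 + (D0 w)\<^sup>2)) + (cf1 * ((D1 w)\<^sup>2 + (D0 w)\<^sup>2)) ^ 4)"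
        using nsq4_perturb[of M "YP R s w" f1 "D1 w" "YQ R s w" "D0 w"]
        by (simp only: N4_shift_def nsq4_shift_def N_def N4_def Z1_def Z0_def D1_def D0_def cf1_def)
      also have "\<dots> \<le> N4 s w + 8 * (Z1 w * D1 w - Z0 w * D0 w)
          + 2000 * (N w ^ 3 * (cf1 * ((D1 w)\<^sup>2 + (D0 w)\<^sup>2)) + cf1 ^ 4 * (16 * (D1 w ^ 8 + D0 w ^ 8)))"
        using p8 by simp
      also have "\<dots> = B w" by (simp add: B_def algebra_simps)
      finally show ?case using elim by linarith
    qed
    moreover have Bi: "integrable \<Omega> B"
      unfolding B_def[abs_def] using N4i m1(1) m0(1) q1(3) q0(3) D8
      by (intro Bochner_Integration.integrable_add Bochner_Integration.integrable_diff integrable_mult_right) auto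
    moreover have e3: "integrable \<Omega> (err3 s t)" "E (err3 s t) \<le> 3 * Cerr * ((t - s) * sqrt (t - s))"
      using err3_moments[OF st(1) st' st(3)] .
    ultimately have "E (N4 t) \<le> E (\<lambda>w. B w + K * err3 s t w)"
      using N4i by (intro integral_mono_AE) auto
    also have "\<dots> = E B + K * E (err3 s t)" using Bi e3 by simp
    also have "E B = E (N4 s) + 2000 * (cf1 * (2 * (t - s) * E (\<lambda>w. N w ^ 3)) + cf1 ^ 4 * (3360 * (t - s) ^ 4))"
      unfolding B_def[abs_def] using N4i m1(1,2) m0(1,2) q1(3,4) q0(3,4) D8 by simp
    also have "\<dots> + K * E (err3 s t) \<le> (E (N4 s)
        + 2000 * (cf1 * (2 * (t - s) * (E (N4 s) + 1)) + cf1 ^ 4 * (3360 * ((t - s) * sqrt (t - s) * sqrt T ^ 5))))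
        + K * (3 * Cerr * ((t - s) * sqrt (t - s)))"
    proof (intro add_mono mult_left_mono)
      have "x ^ 3 \<le> x ^ 4 + 1" if "0 \<le> x" for x :: real
      proof (cases "x \<le> 1")
        case True then show ?thesis using that power_le_one[of x 3] by (simp add: add_increasing)
      next
        case False then show ?thesis using power_increasing[of 3 4 x] by (intro add_increasing2) auto
      qed
      from this[OF N0] have "N w ^ 3 \<le> N4 s w + 1" for w by (simp add: N4_def N_def)
      moreover have "integrable \<Omega> (\<lambda>w. N4 s w + 1)" using N4i by simp
      ultimately have "E (\<lambda>w. N w ^ 3) \<le> E (\<lambda>w. N4 s w + 1)"
        by (intro integral_mono N3i)
      then show "E (\<lambda>w. N w ^ 3) \<le> E (N4 s) + 1" using N4i by (simp add: prob_space)
      have p: "(x\<^sup>2) ^ 4 = x\<^sup>2 * x * x ^ 5" for x :: real by (simp add: eval_nat_numeral)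
      have "(t - s) ^ 4 = ((sqrt (t - s))\<^sup>2) ^ 4" using st by simp
      also have "\<dots> = (sqrt (t - s))\<^sup>2 * sqrt (t - s) * sqrt (t - s) ^ 5" by (rule p)
      also have "(sqrt (t - s))\<^sup>2 = t - s" using st by simp
      also have "(t - s) * sqrt (t - s) * sqrt (t - s) ^ 5 \<le> (t - s) * sqrt (t - s) * sqrt T ^ 5"
        using st by (intro mult_left_mono power_mono) auto
      finally show "(t - s) ^ 4 \<le> (t - s) * sqrt (t - s) * sqrt T ^ 5" .
    qed (use e3 K st cf1_nonneg in auto)
    also have "\<dots> = E (N4 s) + 4000 * cf1 * (t - s) * (E (N4 s) + 1) + K' * ((t - s) * sqrt (t - s))"
      by (simp add: K'_def algebra_simps)
    finally show "E (N4 t) \<le> E (N4 s) + 4000 * cf1 * (t - s) * (E (N4 s) + 1) + K' * ((t - s) * sqrt (t - s))" .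
  qed
qed

lemma Y_initial_AE: "AE w in \<Omega>. \<forall>i\<in>I. YP R 0 w i = P0 i \<and> YQ R 0 w i = Q0 i \<and> YU R 0 w i = U0 i \<and> YV R 0 w i = V0 i"
  using initial_AE
proof eventually_elim
  case (elim w)
  have "min 0 (tau R w) = 0" using tau_bounds[of R w] by simp
  then show ?case using elim by (simp add: Y_defs stopped_defs)
qed

lemma N4_bound:
  assumes t: "t \<in> {0..T}"
  shows "E (N4 t) \<le> CN"
proof (rule N4_step)
  fix K assume K: "0 \<le> K"
    and step: "\<And>s t. 0 \<le> s \<Longrightarrow> s < t \<Longrightarrow> t \<le> T \<Longrightarrow>
      E (N4 t) \<le> E (N4 s) + 4000 * cf1 * (t - s) * (E (N4 s) + 1) + K * ((t - s) * sqrt (t - s))"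
  have "AE w in \<Omega>. N4 0 w = nsq M P0 Q0 ^ 4"
    using Y_initial_AE by eventually_elim (simp add: N4_def nsq_def)
  moreover have "N4 0 \<in> borel_measurable \<Omega>"
    by (rule all_moments_measurable[OF N4_moments]) (use T in simp)
  ultimately have "E (N4 0) = E (\<lambda>_. nsq M P0 Q0 ^ 4)"
    by (intro integral_cong_AE) auto
  then have 0: "E (N4 0) = nsq M P0 Q0 ^ 4" by (simp add: prob_space)
  \<comment> \<open>Adding 1 turns the affine recursion of \<open>N4_step\<close> into the form
    required by Gronwall.\<close>
  have "E (N4 t) + 1 \<le> exp (4000 * cf1 * t) * (E (N4 0) + 1)"
    by (rule discrete_Gronwall[where K = K and u = "\<lambda>t. E (N4 t) + 1"])
      (use t K step cf1_nonneg in \<open>auto simp: 0 algebra_simps\<close>)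
  then have "E (N4 t) \<le> (E (N4 0) + 1) * exp (4000 * cf1 * t)" by (simp add: mult.commute)
  also have "\<dots> \<le> CN"
    unfolding 0 CN_def using t cf1_nonneg by (intro mult_left_mono) (auto intro: mult_left_mono)
  finally show ?thesis .
qed

text \<open>The growth estimate is a premise so that \<open>L\<close> can be fixed once, before
  \<open>R\<close>; a constant obtained inside this context might vary with
  \<open>R\<close>.\<close>

lemma UV4_bound:
  assumes L: "0 \<le> L"
    and growth: "\<And>w P Q U V \<tau> t. is_path w P Q U V \<Longrightarrow> 0 \<le> \<tau> \<Longrightarrow> \<tau> \<le> T \<Longrightarrow> t \<in> {0..T} \<Longrightarrow>
      quart (sU U \<tau> t) (sV w V \<tau> t)
      \<le> L * (1 + w 2 t ^ 4 + integral {0..t} (\<lambda>r. w 2 r ^ 4 + nsq M (sP w P \<tau> r) (sQ w Q \<tau> r) ^ 4))"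
    and t: "t \<in> {0..T}"
  shows "E (UV4 t) \<le> L * (1 + (1 + 105 * T ^ 4) + (1 + 105 * T ^ 4 + CN) * T)"
proof -
  let ?X = "\<lambda>r w. W 2 r w ^ 4 + N4 r w"
  let ?c = "1 + 105 * T ^ 4"
  have W4i: "integrable \<Omega> (\<lambda>w. W 2 r w ^ 4)" if "r \<in> {0..T}" for r
    by (intro all_moments_integrable all_moments_power W_moments that) simp
  have Xi: "integrable \<Omega> (?X r)" if "r \<in> {0..t}" for r
    using that t by (intro Bochner_Integration.integrable_add W4i all_moments_integrable[OF N4_moments]) auto
  have cont: "continuous_on {0..t} (\<lambda>r. ?X r w)" if "w \<in> space \<Omega>" for w
    unfolding N4_def nsq_def
    by (intro continuous_intros continuous_on_subset[OF W_cont] continuous_on_subset[OF Y_cont(1)]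
        continuous_on_subset[OF Y_cont(2)] that | use t in auto)+
  have CN: "0 \<le> CN" by (simp add: CN_def)
  have bound: "E (\<lambda>w. \<bar>?X r w\<bar>) \<le> ?c + CN" if r: "r \<in> {0..t}" for r
  proof -
    have r': "r \<in> {0..T}" using r t by auto
    have "E (\<lambda>w. \<bar>?X r w\<bar>) = E (?X r)"
      by (intro Bochner_Integration.integral_cong) (auto simp: N4_def)
    also have "\<dots> = E (\<lambda>w. W 2 r w ^ 4) + E (N4 r)"
      by (intro Bochner_Integration.integral_add W4i all_moments_integrable[OF N4_moments] r')
    also have "\<dots> \<le> ?c + CN" using W_moments(2)[of 2 r] N4_bound r' by (intro add_mono) auto
    finally show ?thesis .
  qed
  have t0: "0 \<le> t" using t by simp
  note eti = expectation_time_integral[of 0 t ?X, OF t0 cont Xi bound]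
  have UVi: "integrable \<Omega> (UV4 t)" by (intro all_moments_integrable UV4_moments t)
  have "AE w in \<Omega>. UV4 t w \<le> L * (1 + W 2 t w ^ 4 + integral {0..t} (\<lambda>r. ?X r w))"
    using path_AE
  proof eventually_elim
    case (elim w)
    show ?case unfolding UV4_def N4_def Y_defs by (rule growth[OF elim tau_bounds t])
  qed
  then have "E (UV4 t) \<le> E (\<lambda>w. L * (1 + W 2 t w ^ 4 + integral {0..t} (\<lambda>r. ?X r w)))"
    using UVi eti(1) W4i[OF t] by (intro integral_mono_AE) auto
  also have "\<dots> = L * (1 + E (\<lambda>w. W 2 t w ^ 4) + E (\<lambda>w. integral {0..t} (\<lambda>r. ?X r w)))"
    using eti(1) W4i[OF t] by (simp add: prob_space)
  also have "\<dots> \<le> L * (1 + ?c + (?c + CN) * T)"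
  proof (intro mult_left_mono add_mono L order_refl)
    show "E (\<lambda>w. W 2 t w ^ 4) \<le> ?c" using W_moments(2)[of 2 t] t by simp
    have "E (\<lambda>w. integral {0..t} (\<lambda>r. ?X r w)) \<le> (?c + CN) * (t - 0)"
      using eti(4) by linarith
    also have "\<dots> \<le> (?c + CN) * T" using t CN T by (intro mult_left_mono) auto
    finally show "E (\<lambda>w. integral {0..t} (\<lambda>r. ?X r w)) \<le> (?c + CN) * T" .
  qed
  finally show ?thesis .
qed

section \<open>The energy balance at a fixed truncation level\<close>

text \<open>The part of the mean energy growth that depends on the state. The factor is 4 = 2 * 2,
  the coefficient in \<open>energy_perturb\<close> counted for both noises.\<close>

definition "u t = h * (\<Sum>i\<in>I. 4 * (f1 i)\<^sup>2 * E (\<lambda>w. YU R t w i))"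

text \<open>Two-sided, unlike \<open>N4_step\<close>, because the expansion of the shifted energy is
  exact.\<close>

lemma energy_step:
  obtains K where "0 \<le> K"
    "\<And>s t. 0 \<le> s \<Longrightarrow> s < t \<Longrightarrow> t \<le> T \<Longrightarrow>
      \<bar>E (H t) - E (H s) - (t - s) * (u s + c0)\<bar> \<le> K * ((t - s) * sqrt (t - s))"
proof (rule one_step_AE)
  fix K assume K: "0 \<le> K"
    and *: "\<And>s t. 0 \<le> s \<Longrightarrow> s \<le> t \<Longrightarrow> t \<le> T \<Longrightarrow> AE w in \<Omega>.
      \<bar>H t w - H_shift s t w\<bar> \<le> K * err3 s t w \<and> \<bar>N4 t w - N4_shift s t w\<bar> \<le> K * err3 s t w"
  show ?thesis
  proof (rule that[of "K * (3 * Cerr)"])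
    show "0 \<le> K * (3 * Cerr)" using K Cerr_nonneg by simp
  next
    fix s t :: real assume st: "0 \<le> s" "s < t" "t \<le> T"
    have s: "s \<in> {0..T}" and t: "t \<in> {0..T}" and st': "s \<le> t" using st by auto
    define D where "D k w = W k t w - W k s w" for k w
    define Z1 where "Z1 w = h * (\<Sum>i\<in>I. 4 * (YU R s w i * YP R s w i * f1 i) + 4 * (f1 i * A (YP R s w) i))" for w
    define Z0 where "Z0 w = h * (\<Sum>i\<in>I. 4 * (YU R s w i * YQ R s w i * f1 i) + 4 * (f1 i * A (YQ R s w) i))" for w
    define Z2 where "Z2 w = h * (\<Sum>i\<in>I. 8 * (YV R s w i * f2 i))" for w
    define Y where "Y w = h * (\<Sum>i\<in>I. 2 * (YU R s w i * (f1 i)\<^sup>2) + 2 * (f1 i * A f1 i))" for w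
    define c2 where "c2 = h * (\<Sum>i\<in>I. 4 * (f2 i)\<^sup>2)"
    define B where "B w = H s w + Z1 w * D 1 w - Z0 w * D 0 w - Z2 w * D 2 w
      + (Y w * (D 1 w)\<^sup>2 + Y w * (D 0 w)\<^sup>2) - c2 * (D 2 w)\<^sup>2" for w
    have Zm: "all_moments \<Omega> Z1" "all_moments \<Omega> Z0" "all_moments \<Omega> Z2" "all_moments \<Omega> Y"
      unfolding Z1_def[abs_def] Z0_def[abs_def] Z2_def[abs_def] Y_def[abs_def] lap_def
      by (intro all_moments_intros Y_moments[OF R] s | assumption)+
    have ZG: "Z1 \<in> borel_measurable (G s)" "Z0 \<in> borel_measurable (G s)" "Z2 \<in> borel_measurable (G s)"
      "Y \<in> borel_measurable (G s)" "(\<lambda>_. c2) \<in> borel_measurable (G s)"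
      unfolding Z1_def[abs_def] Z0_def[abs_def] Z2_def[abs_def] Y_def[abs_def] lap_def
      by (intro borel_measurable_times borel_measurable_add borel_measurable_sum borel_measurable_const Y_measurable s | assumption)+
    note Zi = Zm[THEN all_moments_integrable]
    note m1 = expectation_increment_mult[of 1, OF _ st ZG(1) Zi(1), folded D_def, simplified]
    note m0 = expectation_increment_mult[of 0, OF _ st ZG(2) Zi(2), folded D_def, simplified]
    note m2 = expectation_increment_mult[of 2, OF _ st ZG(3) Zi(3), folded D_def, simplified]
    note q1 = expectation_increment_mult[of 1, OF _ st ZG(4) Zi(4), folded D_def, simplified]
    note q0 = expectation_increment_mult[of 0, OF _ st ZG(4) Zi(4), folded D_def, simplified]
    have d2: "integrable \<Omega> (\<lambda>w. (D 2 w)\<^sup>2)" "E (\<lambda>w. (D 2 w)\<^sup>2) = t - s"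
      unfolding D_def
      using all_moments_integrable[OF all_moments_power[OF increment_moments(1)[OF _ st]]] increment_moments(3)[OF _ st]
      by auto
    have Hi: "integrable \<Omega> (H s)" "integrable \<Omega> (H t)" by (intro all_moments_integrable H_moments s t)+
    have ae: "AE w in \<Omega>. \<bar>H t w - B w\<bar> \<le> K * err3 s t w"
      using *[OF st(1) st' st(3)]
    proof eventually_elim
      case (elim w)
      have "H_shift s t w = B w"
        unfolding H_shift_def energy_shift_def energy_perturb[OF h_nonneg] B_def Z1_def Z0_def Z2_def Y_def c2_def D_def H_def
        by (simp add: distrib_left)
      then show ?case using elim by simp
    qed
    have Bi: "integrable \<Omega> B"
      unfolding B_def[abs_def]
      using Hi m1(1) m0(1) m2(1) q1(3) q0(3) d2
      by (intro Bochner_Integration.integrable_add Bochner_Integration.integrable_diff integrable_mult_right) auto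
    have EB: "E B = E (H s) + 2 * (t - s) * E Y - c2 * (t - s)"
      unfolding B_def[abs_def] using Hi m1(1,2) m0(1,2) m2(1,2) q1(3,4) q0(3,4) d2 by simp
    have UI: "integrable \<Omega> (\<lambda>w. YU R s w i)" if "i \<in> I" for i
      by (rule all_moments_integrable[OF Y_moments(3)[OF R that s]])
    have EY: "2 * E Y - c2 = u s + c0"
    proof -
      have "E Y = h * (\<Sum>i\<in>I. 2 * (E (\<lambda>w. YU R s w i) * (f1 i)\<^sup>2) + 2 * (f1 i * A f1 i))"
        unfolding Y_def[abs_def] using UI by (simp add: Bochner_Integration.integral_sum prob_space)
      then show ?thesis
        unfolding u_def c0_def c2_def
        by (simp add: sum.distrib sum_distrib_left algebra_simps)
    qed
    note e3 = err3_moments[OF st(1) st' st(3)]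
    have "\<bar>E (H t) - E B\<bar> = \<bar>E (\<lambda>w. H t w - B w)\<bar>" using Hi Bi by simp
    also have "\<dots> \<le> E (\<lambda>w. \<bar>H t w - B w\<bar>)" by (rule integral_abs_bound)
    also have "\<dots> \<le> E (\<lambda>w. K * err3 s t w)"
      using Hi Bi e3 ae by (intro integral_mono_AE) auto
    also have "\<dots> = K * E (err3 s t)" by simp
    also have "\<dots> \<le> K * (3 * Cerr * ((t - s) * sqrt (t - s)))" using K e3 by (intro mult_left_mono) auto
    finally have fin: "\<bar>E (H t) - E B\<bar> \<le> K * (3 * Cerr) * ((t - s) * sqrt (t - s))" by (simp only: mult.assoc)
    have "E B = E (H s) + (t - s) * (u s + c0)"
      unfolding EB EY[symmetric] by (simp add: algebra_simps)
    then show "\<bar>E (H t) - E (H s) - (t - s) * (u s + c0)\<bar> \<le> K * (3 * Cerr) * ((t - s) * sqrt (t - s))"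
      using fin by (simp add: algebra_simps)
  qed
qed

text \<open>Needed to replace \<open>(t - s) * u s\<close> by an integral of \<open>u\<close> up to
  an error of second order.\<close>

lemma u_Lipschitz:
  obtains L where "0 \<le> L" "\<And>s t. 0 \<le> s \<Longrightarrow> s \<le> t \<Longrightarrow> t \<le> T \<Longrightarrow> \<bar>u t - u s\<bar> \<le> L * (t - s)"
proof -
  define L where "L = h * (\<Sum>i\<in>I. 4 * (f1 i)\<^sup>2 * (2 * R))"
  have "0 \<le> R0" unfolding R0_def by (intro sum_nonneg) auto
  with R have R_nonneg: "0 \<le> R" by linarith
  show ?thesis
  proof (rule that[of L])
    show "0 \<le> L" unfolding L_def using h_nonneg R_nonneg by (intro mult_nonneg_nonneg sum_nonneg) auto
  next
    fix s t :: real assume st: "0 \<le> s" "s \<le> t" "t \<le> T"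
    then have s: "s \<in> {0..T}" and t: "t \<in> {0..T}" by auto
    have d: "\<bar>E (\<lambda>w. YU R t w i) - E (\<lambda>w. YU R s w i)\<bar> \<le> 2 * R * (t - s)" if i: "i \<in> I" for i
    proof -
      note ints = all_moments_integrable[OF Y_moments(3)[OF R i s]] all_moments_integrable[OF Y_moments(3)[OF R i t]]
      have "AE w in \<Omega>. \<bar>YU R t w i - YU R s w i\<bar> \<le> 2 * R * (t - s)"
        using path_AE bdd_AE[OF R]
      proof eventually_elim
        case (elim w)
        show ?case unfolding YU_def by (rule sU_Lipschitz[OF elim tau_bounds st i])
      qed
      then have "E (\<lambda>w. \<bar>YU R t w i - YU R s w i\<bar>) \<le> E (\<lambda>_. 2 * R * (t - s))"
        using ints by (intro integral_mono_AE) auto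
      moreover have "\<bar>E (\<lambda>w. YU R t w i - YU R s w i)\<bar> \<le> E (\<lambda>w. \<bar>YU R t w i - YU R s w i\<bar>)"
        by (rule integral_abs_bound)
      ultimately show ?thesis using ints by (simp add: prob_space)
    qed
    have eq: "u t - u s = h * (\<Sum>i\<in>I. 4 * (f1 i)\<^sup>2 * (E (\<lambda>w. YU R t w i) - E (\<lambda>w. YU R s w i)))"
      by (simp add: u_def sum_subtractf right_diff_distrib)
    have "\<bar>u t - u s\<bar> \<le> h * (\<Sum>i\<in>I. 4 * (f1 i)\<^sup>2 * (2 * R * (t - s)))"
      unfolding eq abs_mult[of h] abs_of_nonneg[OF h_nonneg]
    proof (intro mult_left_mono h_nonneg order_trans[OF sum_abs] sum_mono)
      fix i assume "i \<in> I"
      from mult_left_mono[OF d[OF this], of "4 * (f1 i)\<^sup>2"]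
      show "\<bar>4 * (f1 i)\<^sup>2 * (E (\<lambda>w. YU R t w i) - E (\<lambda>w. YU R s w i))\<bar>
        \<le> 4 * (f1 i)\<^sup>2 * (2 * R * (t - s))" by (simp add: abs_mult)
    qed
    also have "\<dots> = L * (t - s)" by (simp only: L_def sum_distrib_right mult.assoc)
    finally show "\<bar>u t - u s\<bar> \<le> L * (t - s)" .
  qed
qed

lemma energy_identity:
  assumes t: "t \<in> {0..T}"
  shows "E (H t) = E (H 0) + c0 * t + integral {0..t} u" "continuous_on {0..T} u"
proof -
  obtain L where L: "0 \<le> L" and Lip: "\<And>s t. 0 \<le> s \<Longrightarrow> s \<le> t \<Longrightarrow> t \<le> T \<Longrightarrow> \<bar>u t - u s\<bar> \<le> L * (t - s)"
    by (rule u_Lipschitz) blast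
  obtain K where K: "0 \<le> K" and step: "\<And>s t. 0 \<le> s \<Longrightarrow> s < t \<Longrightarrow> t \<le> T \<Longrightarrow>
      \<bar>E (H t) - E (H s) - (t - s) * (u s + c0)\<bar> \<le> K * ((t - s) * sqrt (t - s))"
    by (rule energy_step) blast
  have "L-lipschitz_on {0..T} u"
  proof (rule lipschitz_onI)
    fix x y assume "x \<in> {0..T}" "y \<in> {0..T}"
    then show "dist (u x) (u y) \<le> L * dist x y"
      using Lip[of x y] Lip[of y x] by (cases "x \<le> y") (auto simp: dist_real_def abs_minus_commute)
  qed (rule L)
  then show cont: "continuous_on {0..T} u" by (rule lipschitz_on_continuous_on)
  \<comment> \<open>The mean energy minus its expected growth; the claim is that \<open>g\<close> is
    constant. Its increments consist of the error of \<open>energy_step\<close> and the quadrature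
    error of \<open>u\<close>.\<close>
  define g where "g r = E (H r) - c0 * r - integral {0..r} u" for r
  define K' where "K' = K + L * sqrt T"
  have "g t = g 0"
  proof (rule constant_if_superlinear_increments[where K = K'])
    show "0 \<le> t" using t by simp
    show "0 \<le> K'" using K L T by (simp add: K'_def)
    fix s r assume sr: "0 \<le> s" "s < r" "r \<le> t"
    then have rT: "r \<le> T" using t by simp
    have ui: "u integrable_on {x..y}" if "0 \<le> x" "y \<le> T" for x y
      using that by (intro integrable_continuous_real continuous_on_subset[OF cont]) auto
    have "integral {0..r} u = integral {0..s} u + integral {s..r} u"
      using sr rT ui by (intro Henstock_Kurzweil_Integration.integral_combine[symmetric]) auto
    then have gd: "g r - g s = (E (H r) - E (H s) - (r - s) * (u s + c0))
        - (integral {s..r} u - (r - s) * u s)"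
      by (simp add: g_def algebra_simps)
    have "\<bar>integral {s..r} (\<lambda>x. u x - u s)\<bar> \<le> L * (r - s) * (r - s)"
    proof -
      have "norm (integral {s..r} (\<lambda>x. u x - u s)) \<le> (L * (r - s)) * (r - s)"
      proof (rule integral_bound)
        show "continuous_on {s..r} (\<lambda>x. u x - u s)"
          using sr rT by (intro continuous_intros continuous_on_subset[OF cont]) auto
        fix x assume x: "x \<in> {s..r}"
        have "\<bar>u x - u s\<bar> \<le> L * (x - s)" using x sr rT by (intro Lip) auto
        also have "\<dots> \<le> L * (r - s)" using x L by (intro mult_left_mono) auto
        finally show "norm (u x - u s) \<le> L * (r - s)" by simp
      qed (use sr in simp)
      then show ?thesis by simp
    qed
    moreover have "integral {s..r} (\<lambda>x. u x - u s) = integral {s..r} u - (r - s) * u s"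
      using ui[of s r] sr rT by (subst Henstock_Kurzweil_Integration.integral_diff) auto
    ultimately have 2: "\<bar>integral {s..r} u - (r - s) * u s\<bar> \<le> L * (r - s) * (r - s)" by simp
    have "(r - s) = sqrt (r - s) * sqrt (r - s)" using sr by simp
    also have "\<dots> \<le> sqrt T * sqrt (r - s)" using sr rT by (intro mult_right_mono) auto
    finally have "L * (r - s) * (r - s) \<le> L * (r - s) * (sqrt T * sqrt (r - s))"
      using L sr by (intro mult_left_mono) auto
    also have "\<dots> = L * sqrt T * ((r - s) * sqrt (r - s))" by simp
    finally have "\<bar>integral {s..r} u - (r - s) * u s\<bar> \<le> L * sqrt T * ((r - s) * sqrt (r - s))" using 2 by simp
    with step[OF sr(1,2) rT] show "\<bar>g r - g s\<bar> \<le> K' * ((r - s) * sqrt (r - s))"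
      unfolding gd K'_def distrib_right by linarith
  qed
  then show "E (H t) = E (H 0) + c0 * t + integral {0..t} u" by (simp add: g_def)
qed

end

end

section \<open>Removing the truncation\<close>

context kgs_noise
begin

lemma Y_eventually:
  assumes w: "w \<in> space \<Omega>" and t: "t \<in> {0..T}"
  shows "eventually (\<lambda>n. YP (real (n + k)) t w = P t w \<and> YQ (real (n + k)) t w = Q t w \<and>
    YU (real (n + k)) t w = U t w \<and> YV (real (n + k)) t w = V t w) sequentially"
proof -
  have "eventually (\<lambda>n. tau (real (n + k)) w = T) sequentially"
    using last_time_eventually[OF T absum_cont[OF w]]
    unfolding tau_def by (rule eventually_sequentially_seg[THEN iffD2])
  then show ?thesis
  proof eventually_elim
    case (elim n)
    have "min t T = t" using t by simp
    then show ?case by (intro conjI ext) (simp_all add: Y_defs stopped_defs elim del: of_nat_add)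
  qed
qed

definition "HX t w = energy a b M (P t w) (Q t w) (U t w) (V t w)"

definition "UX t w = h * (\<Sum>i\<in>I. 4 * (f1 i)\<^sup>2 * U t w i)"

text \<open>The moment bounds free of the level feed
  \<open>expectation_convergence_L2_bounded\<close>, once for the energy and once for each component
  of \<open>U\<close>; the limit in the time integral follows by domination.\<close>

lemma energy_identity_limit:
  assumes t: "t \<in> {0..T}"
  shows "integrable \<Omega> (HX t)" "integrable \<Omega> (HX 0)"
    "i \<in> I \<Longrightarrow> integrable \<Omega> (\<lambda>w. integral {0..t} (\<lambda>r. U r w i))"
    "E (HX t) = E (HX 0) + c0 * t + E (\<lambda>w. integral {0..t} (\<lambda>r. UX r w))"
proof -
  obtain L where L: "0 \<le> L" and growth: "\<And>w P Q U V \<tau> t. is_path w P Q U V \<Longrightarrow> 0 \<le> \<tau> \<Longrightarrow> \<tau> \<le> T \<Longrightarrow> t \<in> {0..T} \<Longrightarrow>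
      quart (sU U \<tau> t) (sV w V \<tau> t)
      \<le> L * (1 + w 2 t ^ 4 + integral {0..t} (\<lambda>r. w 2 r ^ 4 + nsq M (sP w P \<tau> r) (sQ w Q \<tau> r) ^ 4))"
    by (rule stopped_UV_growth) blast
  obtain c where c: "0 \<le> c" and Hc: "\<And>P Q U V. (energy a b M P Q U V)\<^sup>2
      \<le> c * (1 + quart U V + nsq M P Q ^ 4)"
    by (rule energy_square_bound) blast
  define CUV where "CUV = L * (1 + (1 + 105 * T ^ 4) + (1 + 105 * T ^ 4 + CN) * T)"
  \<comment> \<open>The levels start at \<open>k\<close>, so that each of them is at least
    \<open>R0\<close>.\<close>
  define k where "k = nat \<lceil>R0\<rceil>"
  define \<rho> where "\<rho> n = real (n + k)" for n
  have kR: "R0 \<le> \<rho> n" for n unfolding \<rho>_def k_def by linarith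
  have UV: "E (UV4 (\<rho> n) r) \<le> CUV"
    if "r \<in> {0..T}" for n r
    unfolding CUV_def by (intro UV4_bound[OF kR L] growth that | assumption)+
  have UVi: "integrable \<Omega> (UV4 (\<rho> n) r)" if "r \<in> {0..T}" for n r
    by (intro all_moments_integrable UV4_moments[OF kR] that)
  have N4i: "integrable \<Omega> (N4 (\<rho> n) r)" if "r \<in> {0..T}" for n r
    by (intro all_moments_integrable N4_moments[OF kR] that)
  have Xm: "(\<lambda>w. P r w i) \<in> borel_measurable \<Omega>" "(\<lambda>w. Q r w i) \<in> borel_measurable \<Omega>"
    "(\<lambda>w. U r w i) \<in> borel_measurable \<Omega>" "(\<lambda>w. V r w i) \<in> borel_measurable \<Omega>"
    if "i \<in> I" "r \<in> {0..T}" for i r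
    using that by (auto intro!: G_measurable_space[OF X_meas(1)] G_measurable_space[OF X_meas(2)]
        G_measurable_space[OF X_meas(3)] G_measurable_space[OF X_meas(4)])
  have HXm: "HX r \<in> borel_measurable \<Omega>" if "r \<in> {0..T}" for r
    unfolding HX_def[abs_def] energy_eq_sum[OF h_nonneg] lap_def
    by (intro borel_measurable_times borel_measurable_add borel_measurable_diff borel_measurable_sum
        borel_measurable_power borel_measurable_const Xm that | assumption)+
  \<comment> \<open>None of \<open>c\<close>, \<open>CUV\<close> and \<open>CN\<close> depends on
    the level.\<close>
  have H2: "E (\<lambda>w. (H (\<rho> n) r w)\<^sup>2) \<le> c * (1 + CUV + CN)" if r: "r \<in> {0..T}" for n r
  proof -
    have "E (\<lambda>w. (H (\<rho> n) r w)\<^sup>2) \<le> E (\<lambda>w. c * (1 +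
        UV4 (\<rho> n) r w + N4 (\<rho> n) r w))"
    proof (rule integral_mono)
      show "integrable \<Omega> (\<lambda>w. (H (\<rho> n) r w)\<^sup>2)"
        by (intro all_moments_integrable all_moments_power H_moments[OF kR] r)
      show "integrable \<Omega> (\<lambda>w. c * (1 +
        UV4 (\<rho> n) r w + N4 (\<rho> n) r w))"
        by (intro integrable_mult_right Bochner_Integration.integrable_add UVi N4i r) simp
      show "(H (\<rho> n) r w)\<^sup>2 \<le> c * (1 +
        UV4 (\<rho> n) r w + N4 (\<rho> n) r w)" for w
        unfolding H_def[OF kR] N4_def[OF kR] UV4_def[OF kR] by (rule Hc)
    qed
    also have "\<dots> = c * (1 + E (UV4 (\<rho> n) r)
        + E (N4 (\<rho> n) r))"
      using UVi[OF r, of n] N4i[OF r, of n] by (simp add: prob_space)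
    also have "\<dots> \<le> c * (1 + CUV + CN)"
      by (intro mult_left_mono add_mono order_refl c UV N4_bound[OF kR] r)
    finally show ?thesis .
  qed
  have Hlim: "integrable \<Omega> (HX r)" "(\<lambda>n. E (H (\<rho> n) r)) \<longlonglongrightarrow> E (HX r)"
    if r: "r \<in> {0..T}" for r
  proof -
    have ev: "eventually (\<lambda>n. H (\<rho> n) r w = HX r w) sequentially" if "w \<in> space \<Omega>" for w
      using Y_eventually[OF that r, of k, folded \<rho>_def] by eventually_elim (simp add: H_def[OF kR] HX_def)
    note conv = expectation_convergence_L2_bounded[of "\<lambda>n. H (\<rho> n) r" "HX r" "c * (1 + CUV + CN)",
        OF all_moments_measurable[OF H_moments[OF kR r]] HXm[OF r]
          all_moments_integrable[OF all_moments_power[OF H_moments[OF kR r]]] H2[OF r] ev]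
    show "integrable \<Omega> (HX r)" "(\<lambda>n. E (H (\<rho> n) r)) \<longlonglongrightarrow> E (HX r)"
      by (rule conv(3), simp, rule conv(4), simp)
  qed
  have sq4: "x\<^sup>2 \<le> 1 + x ^ 4" for x :: real
  proof -
    have "2 * x\<^sup>2 \<le> x ^ 4 + 1" using sum_squares_bound[of "x\<^sup>2" 1] by simp
    moreover have "0 \<le> x\<^sup>2" by simp
    ultimately show ?thesis by linarith
  qed
  have abs2: "\<bar>x\<bar> \<le> 1 + x\<^sup>2" for x :: real
    using sum_squares_bound[of "\<bar>x\<bar>" 1] abs_ge_zero[of x] by simp
  have U2: "E (\<lambda>w. (YU (\<rho> n) r w i)\<^sup>2) \<le> 1 + CUV" if i: "i \<in> I" and r: "r \<in> {0..T}" for n r i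
  proof -
    have "E (\<lambda>w. (YU (\<rho> n) r w i)\<^sup>2) \<le> E (\<lambda>w. 1 +
        UV4 (\<rho> n) r w)"
    proof (rule integral_mono)
      show "integrable \<Omega> (\<lambda>w. (YU (\<rho> n) r w i)\<^sup>2)"
        by (intro all_moments_integrable all_moments_power Y_moments[OF kR] i r)
      show "integrable \<Omega> (\<lambda>w. 1 + UV4 (\<rho> n) r w)"
        by (intro Bochner_Integration.integrable_add UVi r) simp
      fix w
      have "YU (\<rho> n) r w i ^ 4 + YV (\<rho> n) r w i ^ 4 \<le> UV4 (\<rho> n) r w"
        unfolding UV4_def[OF kR] by (rule le_quart[OF i])
      moreover have "0 \<le> YV (\<rho> n) r w i ^ 4" by simp
      ultimately show "(YU (\<rho> n) r w i)\<^sup>2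
          \<le> 1 + UV4 (\<rho> n) r w"
        using sq4[of "YU (\<rho> n) r w i"] by linarith
    qed
    also have "\<dots> = 1 + E (UV4 (\<rho> n) r)"
      using UVi[OF r, of n] by (simp add: prob_space)
    also have "\<dots> \<le> 1 + CUV" using UV[OF r] by simp
    finally show ?thesis .
  qed
  have Ulim: "integrable \<Omega> (\<lambda>w. U r w i)" "E (\<lambda>w. \<bar>U r w i\<bar>) \<le> 2 + CUV"
    "(\<lambda>n. E (\<lambda>w. YU (\<rho> n) r w i)) \<longlonglongrightarrow> E (\<lambda>w. U r w i)"
    if i: "i \<in> I" and r: "r \<in> {0..T}" for i r
  proof -
    have ev: "eventually (\<lambda>n. YU (\<rho> n) r w i = U r w i) sequentially" if "w \<in> space \<Omega>" for w
      using Y_eventually[OF that r, of k, folded \<rho>_def] by eventually_elim simp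
    note conv = expectation_convergence_L2_bounded[of "\<lambda>n w. YU (\<rho> n) r w i" "\<lambda>w. U r w i" "1 + CUV",
        OF all_moments_measurable[OF Y_moments(3)[OF kR i r]] Xm(3)[OF i r]
          all_moments_integrable[OF all_moments_power[OF Y_moments(3)[OF kR i r]]] U2[OF i r] ev]
    show int: "integrable \<Omega> (\<lambda>w. U r w i)"
      and "(\<lambda>n. E (\<lambda>w. YU (\<rho> n) r w i)) \<longlonglongrightarrow> E (\<lambda>w. U r w i)"
      by (rule conv(3), simp, rule conv(4), simp)
    have "integrable \<Omega> (\<lambda>w. (U r w i)\<^sup>2)" "E (\<lambda>w. (U r w i)\<^sup>2) \<le> 1 + CUV"
      by (rule conv(1), simp, rule conv(2), simp)
    moreover from this have "E (\<lambda>w. \<bar>U r w i\<bar>) \<le> E (\<lambda>w. 1 + (U r w i)\<^sup>2)"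
      using int by (intro integral_mono abs2) auto
    ultimately show "E (\<lambda>w. \<bar>U r w i\<bar>) \<le> 2 + CUV" by (simp add: prob_space)
  qed
  \<comment> \<open>The number \<open>2 + CUV\<close> bounds first absolute moments through |x| <= 1
    + x^2 and the second-moment bound \<open>1 + CUV\<close>.\<close>
  define Cu where "Cu = h * (\<Sum>i\<in>I. 4 * (f1 i)\<^sup>2 * (2 + CUV))"
  have abs_sum: "\<bar>h * (\<Sum>i\<in>I. 4 * (f1 i)\<^sup>2 * x i)\<bar> \<le> h * (\<Sum>i\<in>I. 4 * (f1 i)\<^sup>2 * \<bar>x i\<bar>)" for x
    unfolding abs_mult[of h] abs_of_nonneg[OF h_nonneg]
    by (intro mult_left_mono h_nonneg order_trans[OF sum_abs]) (simp add: abs_mult)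
  have u_bound: "\<bar>u (\<rho> n) r\<bar> \<le> Cu" if r: "r \<in> {0..T}" for n r
    unfolding u_def[OF kR] Cu_def
  proof (intro order_trans[OF abs_sum] mult_left_mono sum_mono h_nonneg)
    fix i assume i: "i \<in> I"
    have ints: "integrable \<Omega> (\<lambda>w. YU (\<rho> n) r w i)" "integrable \<Omega> (\<lambda>w. (YU (\<rho> n) r w i)\<^sup>2)"
      by (intro all_moments_integrable all_moments_power Y_moments[OF kR] i r)+
    have "\<bar>E (\<lambda>w. YU (\<rho> n) r w i)\<bar> \<le> E (\<lambda>w. \<bar>YU (\<rho> n) r w i\<bar>)"
      by (rule integral_abs_bound)
    also have "\<dots> \<le> E (\<lambda>w. 1 + (YU (\<rho> n) r w i)\<^sup>2)"
      using ints by (intro integral_mono abs2) auto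
    also have "\<dots> \<le> 2 + CUV" using ints U2[OF i r, of n] by (simp add: prob_space)
    finally show "\<bar>E (\<lambda>w. YU (\<rho> n) r w i)\<bar> \<le> 2 + CUV" .
  qed auto
  have UXi: "integrable \<Omega> (UX r)" if "r \<in> {0..T}" for r
    unfolding UX_def[abs_def] using that
    by (intro integrable_mult_right Bochner_Integration.integrable_sum Ulim)
  have EUX: "E (UX r) = h * (\<Sum>i\<in>I. 4 * (f1 i)\<^sup>2 * E (\<lambda>w. U r w i))" if "r \<in> {0..T}" for r
    unfolding UX_def[abs_def] using Ulim(1)[OF _ that] by (simp add: Bochner_Integration.integral_sum)
  have UX_bound: "E (\<lambda>w. \<bar>UX r w\<bar>) \<le> Cu" if r: "r \<in> {0..T}" for r
  proof -
    have "E (\<lambda>w. \<bar>UX r w\<bar>) \<le> E (\<lambda>w. h * (\<Sum>i\<in>I. 4 * (f1 i)\<^sup>2 * \<bar>U r w i\<bar>))"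
    proof (rule integral_mono)
      show "integrable \<Omega> (\<lambda>w. \<bar>UX r w\<bar>)" using UXi[OF r] by simp
      show "integrable \<Omega> (\<lambda>w. h * (\<Sum>i\<in>I. 4 * (f1 i)\<^sup>2 * \<bar>U r w i\<bar>))"
        by (intro integrable_mult_right Bochner_Integration.integrable_sum integrable_abs Ulim(1)[OF _ r])
      show "\<bar>UX r w\<bar> \<le> h * (\<Sum>i\<in>I. 4 * (f1 i)\<^sup>2 * \<bar>U r w i\<bar>)" for w unfolding UX_def by (rule abs_sum)
    qed
    also have "\<dots> = h * (\<Sum>i\<in>I. 4 * (f1 i)\<^sup>2 * E (\<lambda>w. \<bar>U r w i\<bar>))"
      using Ulim(1)[OF _ r] by (simp add: Bochner_Integration.integral_sum)
    also have "\<dots> \<le> Cu"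
      unfolding Cu_def by (intro mult_left_mono sum_mono h_nonneg Ulim(2)[OF _ r]) auto
    finally show ?thesis .
  qed
  have u_lim: "(\<lambda>n. u (\<rho> n) r) \<longlonglongrightarrow> E (UX r)" if r: "r \<in> {0..T}" for r
    unfolding u_def[OF kR] EUX[OF r] by (intro tendsto_intros Ulim(3)[OF _ r])
  have t0: "0 \<le> t" using t by simp
  have tT: "r \<in> {0..T}" if "r \<in> {0..t}" for r using that t by auto
  have UX_cont: "continuous_on {0..t} (\<lambda>r. UX r w)" if "w \<in> space \<Omega>" for w
    unfolding UX_def by (intro continuous_intros continuous_on_subset[OF X_cont(3)] that) (use t in auto)
  note eti = expectation_time_integral[of 0 t UX, OF t0 UX_cont UXi[OF tT] UX_bound[OF tT]]
  have cont_u: "continuous_on {0..t} (u (\<rho> n))" for n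
    by (rule continuous_on_subset[OF energy_identity(2)[OF kR t]]) (use t in auto)
  have int_u: "integral {0..t} (u (\<rho> n)) = (LBINT r:{0..t}. u (\<rho> n) r)" for n
    using set_borel_integral_eq_integral(2)[OF borel_integrable_atLeastAtMost'[OF cont_u]] by simp
  \<comment> \<open>The bound \<open>Cu\<close> is uniform in \<open>n\<close>, although the
    Lipschitz constant found for \<open>u\<close> grows with the level.\<close>
  have u_int_lim: "(\<lambda>n. LBINT r:{0..t}. u (\<rho> n) r) \<longlonglongrightarrow> (LBINT r:{0..t}. E (UX r))"
    unfolding set_lebesgue_integral_def
  proof (rule integral_dominated_convergence[where w = "\<lambda>r. Cu * indicator {0..t} r"])
    show "integrable lborel (\<lambda>r. Cu * indicator {0..t} r)"
      by (intro integrable_mult_right integrable_real_indicator) (use t0 in auto)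
    show "AE r in lborel. (\<lambda>n. indicat_real {0..t} r *\<^sub>R u (\<rho> n) r) \<longlonglongrightarrow> indicat_real {0..t} r *\<^sub>R E (UX r)"
    proof (intro AE_I2)
      fix r :: real
      show "(\<lambda>n. indicat_real {0..t} r *\<^sub>R u (\<rho> n) r) \<longlonglongrightarrow> indicat_real {0..t} r *\<^sub>R E (UX r)"
        using u_lim[OF tT, of r] by (cases "r \<in> {0..t}") auto
    qed
    show "AE r in lborel. norm (indicat_real {0..t} r *\<^sub>R u (\<rho> n) r) \<le> Cu * indicator {0..t} r" for n
      using u_bound[OF tT, of _ n] by (intro AE_I2) (auto simp: indicator_def)
    show "(\<lambda>r. indicat_real {0..t} r *\<^sub>R E (UX r)) \<in> borel_measurable lborel"
      using eti(2) unfolding set_integrable_def by (rule borel_measurable_integrable)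
    show "(\<lambda>r. indicat_real {0..t} r *\<^sub>R u (\<rho> n) r) \<in> borel_measurable lborel" for n
      using borel_integrable_atLeastAtMost'[OF cont_u[of n]] unfolding set_integrable_def
      by (rule borel_measurable_integrable)
  qed
  have int_lim: "(\<lambda>n. integral {0..t} (u (\<rho> n))) \<longlonglongrightarrow> E (\<lambda>w. integral {0..t} (\<lambda>r. UX r w))"
  proof -
    have "E (\<lambda>w. integral {0..t} (\<lambda>r. UX r w)) = (LBINT r:{0..t}. E (UX r))"
      by (rule eti(3))
    with u_int_lim show ?thesis unfolding int_u by simp
  qed
  have 0: "0 \<in> {0..T}" using T by simp
  have "(\<lambda>n. E (H (\<rho> n) 0) + c0 * t + integral {0..t} (u (\<rho> n)))
      \<longlonglongrightarrow> E (HX 0) + c0 * t + E (\<lambda>w. integral {0..t} (\<lambda>r. UX r w))"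
    by (intro tendsto_intros Hlim(2)[OF 0] int_lim)
  then have "(\<lambda>n. E (H (\<rho> n) t))
      \<longlonglongrightarrow> E (HX 0) + c0 * t + E (\<lambda>w. integral {0..t} (\<lambda>r. UX r w))"
    using energy_identity(1)[OF kR t] by simp
  with Hlim(2)[OF t] show "E (HX t) = E (HX 0) + c0 * t + E (\<lambda>w. integral {0..t} (\<lambda>r. UX r w))"
    by (rule LIMSEQ_unique)
  show "integrable \<Omega> (HX t)" "integrable \<Omega> (HX 0)" by (intro Hlim(1) t 0)+
  show "integrable \<Omega> (\<lambda>w. integral {0..t} (\<lambda>r. U r w i))" if i: "i \<in> I"
  proof (rule expectation_time_integral(1)[OF t0])
    show "continuous_on {0..t} (\<lambda>r. U r w i)" if "w \<in> space \<Omega>" for w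
      by (intro continuous_on_subset[OF X_cont(3)] that i) (use t in auto)
    show "integrable \<Omega> (\<lambda>w. U r w i)" "E (\<lambda>w. \<bar>U r w i\<bar>) \<le> 2 + CUV" if "r \<in> {0..t}" for r
      by (intro Ulim i tT that)+
  qed
qed

end

section \<open>Augmentation by null sets\<close>

text \<open>The Wiener processes are continuous almost surely only. Setting them to zero on the exceptional null
  set preserves adaptedness only with respect to the augmented filtration.\<close>

definition augment :: "'w measure \<Rightarrow> 'w measure \<Rightarrow> 'w measure" where
  "augment \<Omega> F = sigma (space \<Omega>) {A \<in> sets \<Omega>. \<exists>B\<in>sets F. AE w in \<Omega>. w \<in> A \<longleftrightarrow> w \<in> B}"

lemma space_augment [simp]: "space (augment \<Omega> F) = space \<Omega>"
  unfolding augment_def by (rule space_measure_of) (auto dest: sets.sets_into_space)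

text \<open>The generating family is already a sigma-algebra: complements and countable unions of
  the approximating sets approximate again, as countably many null sets form a null set.\<close>

lemma sets_augment:
  assumes F: "subalgebra \<Omega> F"
  shows "sets (augment \<Omega> F) = {A \<in> sets \<Omega>. \<exists>B\<in>sets F. AE w in \<Omega>. w \<in> A \<longleftrightarrow> w \<in> B}" (is "_ = ?S")
proof -
  have sp: "space F = space \<Omega>" using F by (simp add: subalgebra_def)
  have "sigma_algebra (space \<Omega>) ?S"
    unfolding sigma_algebra_iff2
  proof (intro conjI ballI allI impI)
    show "?S \<subseteq> Pow (space \<Omega>)" by (auto dest: sets.sets_into_space)
    show "{} \<in> ?S" by (auto intro!: bexI[of _ "{}"])
  next
    fix A assume "A \<in> ?S"
    then obtain B where A: "A \<in> sets \<Omega>" and B: "B \<in> sets F" and ae: "AE w in \<Omega>. w \<in> A \<longleftrightarrow> w \<in> B" by blast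
    have "space \<Omega> - B \<in> sets F" using sets.compl_sets[OF B] sp by simp
    moreover have "AE w in \<Omega>. w \<in> space \<Omega> - A \<longleftrightarrow> w \<in> space \<Omega> - B"
      using ae by eventually_elim auto
    ultimately show "space \<Omega> - A \<in> ?S" using A by blast
  next
    fix A :: "nat \<Rightarrow> 'a set" assume "range A \<subseteq> ?S"
    then have "\<forall>i. A i \<in> sets \<Omega> \<and> (\<exists>B\<in>sets F. AE w in \<Omega>. w \<in> A i \<longleftrightarrow> w \<in> B)" by blast
    then obtain B where A: "\<And>i. A i \<in> sets \<Omega>" and B: "\<And>i. B i \<in> sets F"
      and ae: "\<And>i. AE w in \<Omega>. w \<in> A i \<longleftrightarrow> w \<in> B i" by metis
    have "(\<Union>i. B i) \<in> sets F" using B by blast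
    moreover have "AE w in \<Omega>. w \<in> (\<Union>i. A i) \<longleftrightarrow> w \<in> (\<Union>i. B i)"
    proof -
      have "AE w in \<Omega>. \<forall>i. w \<in> A i \<longleftrightarrow> w \<in> B i" using ae by (simp add: AE_all_countable)
      then show ?thesis by eventually_elim auto
    qed
    moreover have "(\<Union>i. A i) \<in> sets \<Omega>" using A by blast
    ultimately show "(\<Union>i. A i) \<in> ?S" by blast
  qed
  then show ?thesis unfolding augment_def
    by (intro sigma_algebra.sets_measure_of_eq)
qed

lemma augment_subalgebra: "subalgebra \<Omega> F \<Longrightarrow> subalgebra \<Omega> (augment \<Omega> F)"
  by (auto simp: subalgebra_def sets_augment)

lemma augment_mono:
  assumes "subalgebra \<Omega> F" "subalgebra \<Omega> F'" "sets F \<subseteq> sets F'"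
  shows "sets (augment \<Omega> F) \<subseteq> sets (augment \<Omega> F')"
  using assms(3) by (auto simp: sets_augment[OF assms(1)] sets_augment[OF assms(2)])

lemma augment_measurable:
  assumes F: "subalgebra \<Omega> F" and f: "f \<in> measurable F N" and g: "g \<in> measurable \<Omega> N"
    and ae: "AE w in \<Omega>. f w = g w"
  shows "g \<in> measurable (augment \<Omega> F) N"
proof (rule measurableI)
  show "g w \<in> space N" if "w \<in> space (augment \<Omega> F)" for w
    using measurable_space[OF g] that by simp
  fix A assume A: "A \<in> sets N"
  have sp: "space F = space \<Omega>" using F by (simp add: subalgebra_def)
  have "f -` A \<inter> space \<Omega> \<in> sets F" using measurable_sets[OF f A] sp by simp
  moreover have "AE w in \<Omega>. w \<in> g -` A \<inter> space \<Omega> \<longleftrightarrow> w \<in> f -` A \<inter> space \<Omega>"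
    using ae by eventually_elim auto
  ultimately show "g -` A \<inter> space (augment \<Omega> F) \<in> sets (augment \<Omega> F)"
    using measurable_sets[OF g A] unfolding sets_augment[OF F] space_augment by blast
qed

text \<open>Each event of \<open>Z\<close> or \<open>D'\<close> agrees almost surely with one of
  \<open>F\<close> or \<open>D\<close>, and the product formula depends on events only up to null
  sets.\<close>

lemma (in prob_space) augment_indep_var:
  assumes F: "subalgebra M F" and Z: "Z \<in> borel_measurable (augment M F)"
    and D: "D \<in> borel_measurable M" and D': "D' \<in> borel_measurable M" and ae: "AE w in M. D w = D' w"
    and ind: "indep_set (sets F) {D -` A \<inter> space M | A. A \<in> sets borel}"
  shows "indep_var borel Z borel D'"
  unfolding indep_var_eq
proof (intro conjI)
  show Zm: "random_variable borel Z"
    using measurable_from_subalg[OF augment_subalgebra[OF F] Z] .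
  show "random_variable borel D'" by (rule D')
  have stable: "Int_stable {X -` A \<inter> space M | A. A \<in> sets borel}" for X :: "'a \<Rightarrow> 'b :: topological_space"
  proof (rule Int_stableI, safe)
    fix A B :: "'b set" assume "A \<in> sets borel" "B \<in> sets borel"
    then show "\<exists>C. X -` A \<inter> space M \<inter> (X -` B \<inter> space M) = X -` C \<inter> space M \<and> C \<in> sets borel"
      by (intro exI[of _ "A \<inter> B"]) auto
  qed
  show "indep_set (sigma_sets (space M) {Z -` A \<inter> space M | A. A \<in> sets borel})
      (sigma_sets (space M) {D' -` A \<inter> space M | A. A \<in> sets borel})"
  proof (rule indep_set_sigma_sets[OF _ stable stable], rule indep_setI)
    show "{Z -` A \<inter> space M |A. A \<in> sets borel} \<subseteq> events" "{D' -` A \<inter> space M |A. A \<in> sets borel} \<subseteq> events"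
      using measurable_sets[OF Zm] measurable_sets[OF D'] by auto
    fix x y assume "x \<in> {Z -` A \<inter> space M |A. A \<in> sets borel}" "y \<in> {D' -` A \<inter> space M |A. A \<in> sets borel}"
    then obtain A B where A: "A \<in> sets borel" "x = Z -` A \<inter> space M" and B: "B \<in> sets borel" "y = D' -` B \<inter> space M"
      by auto
    have "x \<in> sets (augment M F)" using measurable_sets[OF Z A(1)] A(2) by simp
    then obtain x' where x: "x \<in> events" and x': "x' \<in> sets F" and aex: "AE w in M. w \<in> x \<longleftrightarrow> w \<in> x'"
      by (auto simp: sets_augment[OF F])
    have x'e: "x' \<in> events" using x' F by (auto simp: subalgebra_def)
    define y' where "y' = D -` B \<inter> space M"
    have y: "y \<in> events" "y' \<in> events"
      using measurable_sets[OF D' B(1)] measurable_sets[OF D B(1)] B(2) by (auto simp: y'_def)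
    have aey: "AE w in M. w \<in> y \<longleftrightarrow> w \<in> y'"
      using ae by eventually_elim (auto simp: y'_def B(2))
    have "prob (x \<inter> y) = prob (x' \<inter> y')"
    proof (rule measure_eq_AE)
      show "AE w in M. w \<in> x \<inter> y \<longleftrightarrow> w \<in> x' \<inter> y'" using aex aey by eventually_elim auto
    qed (use x x'e y in auto)
    also have "\<dots> = prob x' * prob y'"
      using B(1) by (intro indep_setD[OF ind] x') (auto simp: y'_def)
    also have "prob x' = prob x" using aex by (intro measure_eq_AE x x'e) (auto elim: eventually_mono)
    also have "prob y' = prob y" using aey by (intro measure_eq_AE y) (auto elim: eventually_mono)
    finally show "prob (x \<inter> y) = prob x * prob y" .
  qed
qed

lemma distributed_cong_AE:
  assumes "distributed M N X f" "AE w in M. X w = Y w" "Y \<in> measurable M N"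
  shows "distributed M N Y f"
  using assms distr_cong_AE[of M M N N X Y] unfolding distributed_def by auto

theorem theorem3p2:
  fixes \<Omega> :: "'w measure" and F :: "real \<Rightarrow> 'w measure" and B :: "nat \<Rightarrow> real \<Rightarrow> 'w \<Rightarrow> real"
    and a b T C1 C2 t :: real and M :: nat
    and \<phi>0 :: "real \<Rightarrow> complex" and u0 \<mu>0 \<eta>1 \<eta>2 :: "real \<Rightarrow> real"
    and P0 Q0 U0 V0 :: "nat \<Rightarrow> real"
    and P Q U V :: "real \<Rightarrow> 'w \<Rightarrow> nat \<Rightarrow> real"
  assumes "prob_space \<Omega>"
    and "filtration (space \<Omega>) F" and "\<And>s. subalgebra \<Omega> (F s)"
    and "indep_wiener3 \<Omega> F B"
    and "a < b" and "0 < T" and "0 < M"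
    and "in_H10 a b \<phi>0" and "in_H10 a b u0" and "in_L2 a b \<mu>0"
    and "in_H10 a b \<eta>1" and "in_L2 a b \<eta>2"
    and "kgs_solution \<Omega> F B T a b M C1 C2 \<eta>1 \<eta>2 P0 Q0 U0 V0 P Q U V"
    and "t \<in> {0..T}"
  shows "integrable \<Omega> (\<lambda>\<omega>. energy a b M (P t \<omega>) (Q t \<omega>) (U t \<omega>) (V t \<omega>)) \<and>
    integrable \<Omega> (\<lambda>\<omega>. energy a b M (P 0 \<omega>) (Q 0 \<omega>) (U 0 \<omega>) (V 0 \<omega>)) \<and>
    integrable \<Omega> (\<lambda>\<omega>. LBINT s:{0..t}.
      inner_h a b M (U s \<omega>) (grid_vec a b M \<eta>1 \<odot> grid_vec a b M \<eta>1)) \<and>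
    prob_space.expectation \<Omega> (\<lambda>\<omega>. energy a b M (P t \<omega>) (Q t \<omega>) (U t \<omega>) (V t \<omega>)) =
      prob_space.expectation \<Omega> (\<lambda>\<omega>. energy a b M (P 0 \<omega>) (Q 0 \<omega>) (U 0 \<omega>) (V 0 \<omega>))
      - C2\<^sup>2 * (norm_h a b M (grid_vec a b M \<eta>2))\<^sup>2 * t
      + 4 * C1\<^sup>2 * inner_h a b M (grid_vec a b M \<eta>1) (lap a b M (grid_vec a b M \<eta>1)) * t
      + 4 * C1\<^sup>2 * prob_space.expectation \<Omega> (\<lambda>\<omega>. LBINT s:{0..t}.
          inner_h a b M (U s \<omega>) (grid_vec a b M \<eta>1 \<odot> grid_vec a b M \<eta>1))"
proof -
  interpret prob_space \<Omega> by fact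
  interpret filtration "space \<Omega>" F by fact
  interpret kgs_data a b C1 C2 T M "grid_vec a b M \<eta>1" "grid_vec a b M \<eta>2" P0 Q0 U0 V0
    by unfold_locales fact+
  note sub = \<open>\<And>s. subalgebra \<Omega> (F s)\<close>
  have wiener: "wiener_process \<Omega> F (B k)" if "k \<in> {0, 1, 2}" for k
    using assms(4) that unfolding indep_wiener3_def by blast
  have ca: "cont_adapted \<Omega> F T M P" "cont_adapted \<Omega> F T M Q" "cont_adapted \<Omega> F T M U" "cont_adapted \<Omega> F T M V"
    using assms(13) unfolding kgs_solution_def by blast+
  note sol_AE = assms(13)[unfolded kgs_solution_def, THEN conjunct2, THEN conjunct2, THEN conjunct2, THEN conjunct2]
  have "AE w in \<Omega>. \<forall>k\<in>{0, 1, 2}. continuous_on {0..} (\<lambda>t. B k t w)"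
    using wiener unfolding wiener_process_def by (intro AE_finite_allI) auto
  then obtain N where N: "N \<in> null_sets \<Omega>"
    "{w\<in>space \<Omega>. \<not> (\<forall>k\<in>{0, 1, 2}. continuous_on {0..} (\<lambda>t. B k t w))} \<subseteq> N"
    by (rule AE_E3) (auto simp: subset_eq)
  have good: "continuous_on {0..} (\<lambda>t. B k t w)" if "w \<in> space \<Omega>" "w \<notin> N" "k \<in> {0, 1, 2}" for w k
    using N(2) that by auto
  have N_AE: "AE w in \<Omega>. w \<notin> N" by (rule AE_not_in[OF N(1)])
  \<comment> \<open>Zero paths on \<open>N\<close> give continuity everywhere. Subtracting
    \<open>B k 0\<close> gives the start at 0 everywhere and matches the way in which the noise
    enters the system.\<close>
  define W where "W k t w = (if w \<in> N then 0 else B k t w - B k 0 w)" for k t w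
  define G where "G t = augment \<Omega> (F t)" for t
  have BF: "B k t \<in> borel_measurable (F t)" if "k \<in> {0, 1, 2}" "0 \<le> t" for k t
    using wiener[OF that(1)] that(2) unfolding wiener_process_def by blast
  have B\<Omega>: "B k t \<in> borel_measurable \<Omega>" if "k \<in> {0, 1, 2}" "0 \<le> t" for k t
    by (rule measurable_from_subalg[OF sub BF[OF that]])
  have W\<Omega>: "W k t \<in> borel_measurable \<Omega>" if "k \<in> {0, 1, 2}" "0 \<le> t" for k t
  proof -
    have [measurable]: "N \<in> sets \<Omega>" "B k t \<in> borel_measurable \<Omega>" "B k 0 \<in> borel_measurable \<Omega>"
      using N(1) B\<Omega> that by auto
    show ?thesis unfolding W_def[abs_def] by measurable
  qed
  interpret kgs_noise \<Omega> a b C1 C2 T M "grid_vec a b M \<eta>1" "grid_vec a b M \<eta>2" P0 Q0 U0 V0 G W P Q U V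
  proof
    fix s t :: real
    show "subalgebra \<Omega> (G t)" unfolding G_def by (rule augment_subalgebra[OF sub])
    show "sets (G s) \<subseteq> sets (G t)" if "s \<le> t"
      unfolding G_def by (intro augment_mono sub sets_F_mono that)
  next
    fix k :: nat and t assume k: "k \<in> {0, 1, 2}" and t: "t \<in> {0..T}"
    have "(\<lambda>w. B k t w - B k 0 w) \<in> borel_measurable (F t)"
    proof (intro borel_measurable_diff BF k)
      have "subalgebra (F t) (F 0)" using sets_F_mono[of 0 t] t by (simp add: subalgebra_def space_F)
      then show "B k 0 \<in> borel_measurable (F t)" by (rule measurable_from_subalg) (use BF k in simp)
    qed (use t in simp)
    then show "W k t \<in> borel_measurable (G t)"
      unfolding G_def
    proof (rule augment_measurable[OF sub])
      show "AE w in \<Omega>. B k t w - B k 0 w = W k t w" using N_AE by eventually_elim (simp add: W_def)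
    qed (use W\<Omega> k t in auto)
  next
    fix k :: nat and w assume k: "k \<in> {0, 1, 2}" and w: "w \<in> space \<Omega>"
    show "continuous_on {0..T} (\<lambda>t. W k t w)"
      unfolding W_def using good[OF w _ k]
      by (cases "w \<in> N") (auto intro!: continuous_intros intro: continuous_on_subset)
  next
    show "W k 0 w = 0" for k w by (simp add: W_def)
  next
    fix k :: nat and s t :: real assume k: "k \<in> {0, 1, 2}" and st: "0 \<le> s" "s < t"
    have ae: "AE w in \<Omega>. B k t w - B k s w = W k t w - W k s w"
      using N_AE by eventually_elim (simp add: W_def)
    have wp: "distributed \<Omega> lborel (\<lambda>w. B k t w - B k s w) (normal_density 0 (sqrt (t - s)))"
      "indep_set (sets (F s)) {(\<lambda>w. B k t w - B k s w) -` A \<inter> space \<Omega> | A. A \<in> sets borel}"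
      using wiener[OF k] st unfolding wiener_process_def by blast+
    have Wm: "(\<lambda>w. W k t w - W k s w) \<in> borel_measurable \<Omega>"
      "(\<lambda>w. B k t w - B k s w) \<in> borel_measurable \<Omega>"
      using st by (intro borel_measurable_diff W\<Omega> B\<Omega> k; simp)+
    show "distributed \<Omega> lborel (\<lambda>w. W k t w - W k s w) (normal_density 0 (sqrt (t - s)))"
      using distributed_cong_AE[OF wp(1) ae] Wm(1) by simp
    show "indep_var borel Z borel (\<lambda>w. W k t w - W k s w)" if "Z \<in> borel_measurable (G s)" for Z :: "'w \<Rightarrow> real"
      using augment_indep_var[OF sub that[unfolded G_def] Wm(2) Wm(1) ae wp(2)] .
  next
    fix i t assume i: "i \<in> {1..<M}" and t: "t \<in> {0..T}"
    have *: "(\<lambda>w. X t w i) \<in> borel_measurable (G t)" if "cont_adapted \<Omega> F T M X" for X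
    proof -
      have X: "(\<lambda>w. X t w i) \<in> borel_measurable (F t)" using that i t unfolding cont_adapted_def by blast
      show ?thesis unfolding G_def
        by (rule augment_measurable[OF sub X measurable_from_subalg[OF sub X]]) simp
    qed
    show "(\<lambda>w. P t w i) \<in> borel_measurable (G t)" "(\<lambda>w. Q t w i) \<in> borel_measurable (G t)"
      "(\<lambda>w. U t w i) \<in> borel_measurable (G t)" "(\<lambda>w. V t w i) \<in> borel_measurable (G t)"
      by (intro * ca)+
  next
    fix i w assume "i \<in> {1..<M}" "w \<in> space \<Omega>"
    then show "continuous_on {0..T} (\<lambda>t. P t w i)" "continuous_on {0..T} (\<lambda>t. Q t w i)"
      "continuous_on {0..T} (\<lambda>t. U t w i)" "continuous_on {0..T} (\<lambda>t. V t w i)"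
      using ca unfolding cont_adapted_def by blast+
  next
    show "AE w in \<Omega>. is_path (\<lambda>k t. W k t w) (\<lambda>t. P t w) (\<lambda>t. Q t w) (\<lambda>t. U t w) (\<lambda>t. V t w)"
      using N_AE AE_space sol_AE
    proof eventually_elim
      case (elim w)
      have cont: "continuous_on {0..T} (\<lambda>t. P t w i)" "continuous_on {0..T} (\<lambda>t. Q t w i)"
        "continuous_on {0..T} (\<lambda>t. U t w i)" "continuous_on {0..T} (\<lambda>t. V t w i)" if "i \<in> {1..<M}" for i
        using ca that elim(2) unfolding cont_adapted_def by blast+
      \<comment> \<open>For continuous integrands the Lebesgue integrals of the system are the gauge
        integrals of \<open>is_path\<close>.\<close>
      have HK: "(LBINT s:{0..t}. g s) = integral {0..t} g" if "continuous_on {0..T} g" "t \<in> {0..T}" for g :: "real \<Rightarrow> real" and t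
        using that by (intro set_borel_integral_eq_integral borel_integrable_atLeastAtMost' continuous_on_subset[OF that(1)]) auto
      have eq: "P t w i = P0 i + integral {0..t} (\<lambda>r. dP (Q r w) (U r w) i) + f1 i * W 1 t w \<and>
        Q t w i = Q0 i + integral {0..t} (\<lambda>r. dQ (P r w) (U r w) i) - f1 i * W 0 t w \<and>
        U t w i = U0 i + integral {0..t} (\<lambda>r. 2 * V r w i) \<and>
        V t w i = V0 i + integral {0..t} (\<lambda>r. dV (P r w) (Q r w) (U r w) i) + f2 i * W 2 t w"
        if t: "t \<in> {0..T}" and i: "i \<in> {1..<M}" for t i
      proof -
        have c: "continuous_on {0..T} (\<lambda>r. dP (Q r w) (U r w) i)" "continuous_on {0..T} (\<lambda>r. dQ (P r w) (U r w) i)"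
          "continuous_on {0..T} (\<lambda>r. dV (P r w) (Q r w) (U r w) i)" "continuous_on {0..T} (\<lambda>r. 2 * V r w i)"
          unfolding dP_def dQ_def dV_def lap_def by (intro continuous_intros cont i | assumption)+
        show ?thesis
          unfolding HK[OF c(1) t, symmetric] HK[OF c(2) t, symmetric] HK[OF c(3) t, symmetric] HK[OF c(4) t, symmetric]
          using elim(3)[rule_format, OF t i] elim(1)
          unfolding dP_def dQ_def dV_def f1_def f2_def cmul_def W_def by simp
      qed
      have cW: "continuous_on {0..T} (\<lambda>t. W k t w)" if "k \<in> {0, 1, 2}" for k
        unfolding W_def using good[OF elim(2,1) that] elim(1)
        by (auto intro!: continuous_intros intro: continuous_on_subset)
      show ?case
        unfolding is_path_def using eq cont cW by (auto simp: W_def)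
    qed
  qed
  note lim = energy_identity_limit[OF \<open>t \<in> {0..T}\<close>]
  let ?e1 = "grid_vec a b M \<eta>1" and ?e2 = "grid_vec a b M \<eta>2"
  let ?J = "\<lambda>w. LBINT s:{0..t}. inner_h a b M (U s w) (?e1 \<odot> ?e1)"
  have UX: "UX r w = 4 * C1\<^sup>2 * inner_h a b M (U r w) (?e1 \<odot> ?e1)" for r w
    unfolding UX_def inner_h_def cmul_def f1_def
    by (simp add: sum_distrib_left power2_eq_square mult_ac)
  have Ji: "integral {0..t} (\<lambda>r. inner_h a b M (U r w) (?e1 \<odot> ?e1)) = ?J w" if "w \<in> space \<Omega>" for w
  proof -
    have "continuous_on {0..t} (\<lambda>r. inner_h a b M (U r w) (?e1 \<odot> ?e1))"
      unfolding inner_h_def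
      by (intro continuous_intros continuous_on_subset[OF X_cont(3)] that) (use \<open>t \<in> {0..T}\<close> in auto)
    from set_borel_integral_eq_integral(2)[OF borel_integrable_atLeastAtMost'[OF this]] show ?thesis by simp
  qed
  \<comment> \<open>Integrability of \<open>?J\<close> has to come from the components of
    \<open>U\<close>: for \<open>C1 = 0\<close> the integral of \<open>UX\<close> vanishes and says
    nothing about it.\<close>
  have J_sum: "?J w = h * (\<Sum>i\<in>I. (?e1 \<odot> ?e1) i * integral {0..t} (\<lambda>r. U r w i))" if "w \<in> space \<Omega>" for w
  proof -
    have "(\<lambda>r. U r w i) integrable_on {0..t}" if "i \<in> I" for i
      by (intro integrable_continuous_real continuous_on_subset[OF X_cont(3)] that \<open>w \<in> space \<Omega>\<close>)
        (use \<open>t \<in> {0..T}\<close> in auto)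
    then have "integral {0..t} (\<lambda>r. \<Sum>i\<in>I. U r w i * (?e1 \<odot> ?e1) i)
        = (\<Sum>i\<in>I. integral {0..t} (\<lambda>r. U r w i) * (?e1 \<odot> ?e1) i)"
      by (subst Henstock_Kurzweil_Integration.integral_sum) (auto intro: integrable_on_mult_left)
    then show ?thesis
      unfolding Ji[OF that, symmetric] unfolding inner_h_def by (simp add: mult.commute)
  qed
  have Jint: "integrable \<Omega> ?J"
  proof -
    have "integrable \<Omega> (\<lambda>w. h * (\<Sum>i\<in>I. (?e1 \<odot> ?e1) i * integral {0..t} (\<lambda>r. U r w i)))"
      by (intro integrable_mult_right Bochner_Integration.integrable_sum lim(3))
    then show ?thesis by (subst Bochner_Integration.integrable_cong[OF refl J_sum])
  qed
  have intUX: "integral {0..t} (\<lambda>r. UX r w) = 4 * C1\<^sup>2 * ?J w" if "w \<in> space \<Omega>" for w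
    unfolding UX by (simp add: Ji[OF that])
  \<comment> \<open>The half in \<open>f2 = C2 / 2 * e2\<close> turns \<open>4 * f2^2\<close> into
    \<open>C2^2 * e2^2\<close>.\<close>
  have c0: "c0 = 4 * C1\<^sup>2 * inner_h a b M ?e1 (lap a b M ?e1) - C2\<^sup>2 * (norm_h a b M ?e2)\<^sup>2"
  proof -
    have "lap a b M f1 i = C1 * lap a b M ?e1 i" for i
      unfolding f1_def[abs_def] by (rule lap_cmult)
    then show ?thesis
      unfolding c0_def norm_h_sq[OF h_nonneg] inner_h_def f1_def f2_def
      by (simp add: sum_distrib_left power2_eq_square mult_ac)
  qed
  have "expectation (\<lambda>w. integral {0..t} (\<lambda>r. UX r w)) = 4 * C1\<^sup>2 * expectation ?J"
    by (subst Bochner_Integration.integral_cong[OF refl intUX]) simp_all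
  with lim(1,2,4) Jint show ?thesis
    unfolding HX_def[abs_def] c0 by (simp add: algebra_simps)
qed

end
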